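(* Let $\Lambda$ be a cyclic Nakayama algebra of infinite global dimension. Then: (i) $\varphi\dim\Lambda=0$ if and only if $\Lambda$ is a self-injective algebra. (ii) $\varphi\dim\Lambda\neq 1$. (iii) $\varphi\dim\Lambda=2$ if and only if $\boldsymbol{\Delta}=\{\Delta_1,\dots,\Delta_r\}\subseteq \boldsymbol{\Omega}^{per}$ (up to isomorphism).
   Context: Cyclic Nakayama algebras. Let $k$ be a field and let $Q$ be the cyclic quiver with vertices $1,\dots,N$ ($N\ge 3$) and arrows $\alpha_i:i\to i+1$ for $1\le i<N$ and $\alpha_N:N\to 1$; indices are read modulo $N$, and paths are written right to left. A cyclic Nakayama algebra is $\Lambda=kQ/\langle REL\rangle$, where $REL$ is an irredundant system of $r\ge 2$ monomial relations $\alpha_{k_{2i}}\cdots\alpha_{k_{2i-1}+1}\alpha_{k_{2i-1}}=0$ ($1\le i\le r$) with $k_f\in\{1,\dots,N\}$ and $1\le k_1<k_3<\dots<k_{2r-1}\le N$. Irredundant means no relation is a consequence of the others. Each relation is a path of length at least $2$ (possibly winding several times around the cycle). All modules are finitely generated and identified with representations of $Q$ satisfying the relations; $S_i$ is the simple module at vertex $i$. All indecomposable modules are uniserial, with composition factors from top to socle $S_i,S_{i+1},\dots$ (indices modulo $N$). $\boldsymbol{\Delta}$-modules. Put $k_0=k_{2r}$. For $1\le j\le r$ let $\Delta_j$ be the shortest indecomposable uniserial module with $\operatorname{soc}\Delta_j\cong S_{k_{2j}}$ and $\operatorname{top}\Delta_j\cong S_{k_{2(j-1)}+1}$ (index modulo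 $N$). Periodic modules. $\Omega X$ is the first syzygy of $X$ (kernel of a projective cover). A module $X$ is $\Omega$-periodic if $\Omega^m(X)\cong X$ for some integer $m\ge 1$. $\boldsymbol{\Omega}^{per}$ is a complete set of representatives of isomorphism classes of indecomposable $\Omega$-periodic modules. The $\varphi$-dimension. Let $K_0$ be the abelian group generated by symbols $[X]$, $X$ a finitely generated $\Lambda$-module, modulo $[C]=[A]+[B]$ if $C\cong A\oplus B$ and $[P]=0$ if $P$ is projective. Let $L:K_0\to K_0$ be the homomorphism with $L[M]=[\Omega M]$. For a module $M$ let $\langle \mathrm{add}\,M\rangle$ be the subgroup of $K_0$ generated by the classes of all indecomposable summands of $M$. Define $$\varphi(M)=\min\{t\ge 0\mid \operatorname{rank}(L^t\langle \mathrm{add}\,M\rangle)=\operatorname{rank}(L^{t+j}\langle \mathrm{add}\,M\rangle)\text{ for all } j\ge 1\},$$ and $\varphi\dim(\Lambda)=\sup\{\varphi(M)\mid M \text{ a finitely generated } \Lambda\text{-module}\}$.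
   Formalization: Part (iii) is stated only for Λ that is not self-injective: for self-injective Λ (e.g. N=r=3, all α_{i+1}α_i=0) the Δ_j are the simple modules, all Ω-periodic, while φdim Λ=0, so the equivalence in (iii) fails. *)

theory Defs
  imports
    "HOL-Algebra.Free_Abelian_Groups"
    "HOL-Algebra.Generated_Groups"
    "HOL-Library.Extended_Nat"
    "HOL-Library.Function_Algebras"
begin

text \<open>
  A relation is the path of \<open>rlen \<Lambda> i\<close> arrows
  \<open>\<alpha>_{k_{2i-1}}, \<alpha>_{k_{2i-1}+1}, \<dots>, \<alpha>_{k_{2i}}\<close>. As it may wind around the cycle, its end points
  do not determine it, so its length is part of the data.
\<close>

record cyclic_quiver_rels =
  nverts :: nat
  nrels :: nat
  kidx :: "nat \<Rightarrow> nat"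
  rlen :: "nat \<Rightarrow> nat"

definition verts :: "cyclic_quiver_rels \<Rightarrow> nat set" where
  "verts \<Lambda> = {1..nverts \<Lambda>}"

definition nxt :: "cyclic_quiver_rels \<Rightarrow> nat \<Rightarrow> nat" where
  "nxt \<Lambda> i = i mod nverts \<Lambda> + 1"

text \<open>
  A path is given by its starting vertex and its number of arrows. A path lies in the ideal of
  \<open>kQ\<close> generated by a set \<open>R\<close> of paths iff it has a member of \<open>R\<close> as a subpath.
\<close>

definition path_in_ideal :: "cyclic_quiver_rels \<Rightarrow> (nat \<times> nat) set \<Rightarrow> nat \<times> nat \<Rightarrow> bool" where
  "path_in_ideal \<Lambda> R p \<longleftrightarrow>
     (\<exists>(s, m)\<in>R. \<exists>a. a + m \<le> snd p \<and> (nxt \<Lambda> ^^ a) (fst p) = s)"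

definition rel_path :: "cyclic_quiver_rels \<Rightarrow> nat \<Rightarrow> nat \<times> nat" where
  "rel_path \<Lambda> i = (kidx \<Lambda> (2 * i - 1), rlen \<Lambda> i)"

definition zero_path :: "cyclic_quiver_rels \<Rightarrow> nat \<times> nat \<Rightarrow> bool" where
  "zero_path \<Lambda> p \<longleftrightarrow> path_in_ideal \<Lambda> (rel_path \<Lambda> ` {1..nrels \<Lambda>}) p"

definition cyclic_nakayama :: "cyclic_quiver_rels \<Rightarrow> bool" where
  "cyclic_nakayama \<Lambda> \<longleftrightarrow>
     nverts \<Lambda> \<ge> 3 \<and> nrels \<Lambda> \<ge> 2 \<and>
     (\<forall>f\<in>{1..2 * nrels \<Lambda>}. kidx \<Lambda> f \<in> verts \<Lambda>) \<and>
     (\<forall>i\<in>{1..<nrels \<Lambda>}. kidx \<Lambda> (2 * i - 1) < kidx \<Lambda> (2 * i + 1)) \<and>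
     (\<forall>i\<in>{1..nrels \<Lambda>}. rlen \<Lambda> i \<ge> 2 \<and>
        kidx \<Lambda> (2 * i) = (nxt \<Lambda> ^^ (rlen \<Lambda> i - 1)) (kidx \<Lambda> (2 * i - 1))) \<and>
     (\<forall>i\<in>{1..nrels \<Lambda>}. \<not> path_in_ideal \<Lambda> (rel_path \<Lambda> ` ({1..nrels \<Lambda>} - {i})) (rel_path \<Lambda> i))"

text \<open>
  The spaces of a representation are finite-dimensional subspaces of the infinite-dimensional
  space of functions \<open>\<nat> \<times> \<nat> \<rightarrow> k\<close>, in which every finite-dimensional space embeds. Only the
  restrictions of the linear maps to these subspaces matter; as a linear map on a subspace extends
  to the whole space, taking them to be defined everywhere is no restriction. The space at a number
  that is not a vertex is zero, so that quantifying over all natural numbers \<open>i\<close> amounts to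
  quantifying over the vertices.
\<close>

type_synonym 'k amb = "nat \<times> nat \<Rightarrow> 'k"

definition scal :: "'k::field \<Rightarrow> 'k amb \<Rightarrow> 'k amb" where
  "scal c v = (\<lambda>p. c * v p)"

interpretation amb: vector_space scal
  by unfold_locales (auto simp: scal_def plus_fun_def algebra_simps)

definition unit_vec :: "nat \<times> nat \<Rightarrow> 'k::field amb" where
  "unit_vec p = (\<lambda>q. if q = p then 1 else 0)"

record 'k rep =
  vsp :: "nat \<Rightarrow> 'k amb set"
  arr :: "nat \<Rightarrow> 'k amb \<Rightarrow> 'k amb"

primrec path_map ::
  "cyclic_quiver_rels \<Rightarrow> 'k::field rep \<Rightarrow> nat \<Rightarrow> nat \<Rightarrow> 'k amb \<Rightarrow> 'k amb" where
  "path_map \<Lambda> M i 0 v = v"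
| "path_map \<Lambda> M i (Suc l) v = arr M ((nxt \<Lambda> ^^ l) i) (path_map \<Lambda> M i l v)"

definition modules :: "cyclic_quiver_rels \<Rightarrow> 'k::field rep set" where
  "modules \<Lambda> = {M.
     (\<forall>i. amb.subspace (vsp M i) \<and> (\<exists>B. finite B \<and> vsp M i \<subseteq> amb.span B)) \<and>
     (\<forall>i. i \<notin> verts \<Lambda> \<longrightarrow> vsp M i = {0}) \<and>
     (\<forall>i. Vector_Spaces.linear scal scal (arr M i) \<and> arr M i ` vsp M i \<subseteq> vsp M (nxt \<Lambda> i)) \<and>
     (\<forall>j\<in>{1..nrels \<Lambda>}. \<forall>v\<in>vsp M (kidx \<Lambda> (2 * j - 1)).
        path_map \<Lambda> M (kidx \<Lambda> (2 * j - 1)) (rlen \<Lambda> j) v = 0)}"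

definition homs :: "cyclic_quiver_rels \<Rightarrow> 'k::field rep \<Rightarrow> 'k rep
    \<Rightarrow> (nat \<Rightarrow> 'k amb \<Rightarrow> 'k amb) set" where
  "homs \<Lambda> M N = {h.
     (\<forall>i. Vector_Spaces.linear scal scal (h i) \<and> h i ` vsp M i \<subseteq> vsp N i) \<and>
     (\<forall>i. \<forall>v\<in>vsp M i. h (nxt \<Lambda> i) (arr M i v) = arr N i (h i v))}"

definition rep_epis :: "cyclic_quiver_rels \<Rightarrow> 'k::field rep \<Rightarrow> 'k rep
    \<Rightarrow> (nat \<Rightarrow> 'k amb \<Rightarrow> 'k amb) set" where
  "rep_epis \<Lambda> M N = {h \<in> homs \<Lambda> M N. \<forall>i. h i ` vsp M i = vsp N i}"

definition rep_monos :: "cyclic_quiver_rels \<Rightarrow> 'k::field rep \<Rightarrow> 'k rep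
    \<Rightarrow> (nat \<Rightarrow> 'k amb \<Rightarrow> 'k amb) set" where
  "rep_monos \<Lambda> M N = {h \<in> homs \<Lambda> M N. \<forall>i. inj_on (h i) (vsp M i)}"

definition isomorphic :: "cyclic_quiver_rels \<Rightarrow> 'k::field rep \<Rightarrow> 'k rep \<Rightarrow> bool" where
  "isomorphic \<Lambda> M N \<longleftrightarrow> (\<exists>h\<in>homs \<Lambda> M N. \<forall>i. bij_betw (h i) (vsp M i) (vsp N i))"

definition zero_rep :: "'k::field rep \<Rightarrow> bool" where
  "zero_rep M \<longleftrightarrow> (\<forall>i. vsp M i = {0})"

text \<open>
  Submodules are given by their families of subspaces; the submodule \<open>W\<close> of \<open>M\<close>, as a
  representation, is \<open>M\<lparr>vsp := W\<rparr>\<close>. Inclusion is the pointwise order on families.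
\<close>

definition submodules :: "cyclic_quiver_rels \<Rightarrow> 'k::field rep \<Rightarrow> (nat \<Rightarrow> 'k amb set) set" where
  "submodules \<Lambda> M = {W. \<forall>i. amb.subspace (W i) \<and> W i \<subseteq> vsp M i \<and> arr M i ` W i \<subseteq> W (nxt \<Lambda> i)}"

definition kernel_fam :: "'k::field rep \<Rightarrow> (nat \<Rightarrow> 'k amb \<Rightarrow> 'k amb) \<Rightarrow> nat \<Rightarrow> 'k amb set" where
  "kernel_fam M h = (\<lambda>i. {v \<in> vsp M i. h i v = 0})"

text \<open>
  The maps \<open>merge\<close>, \<open>left_part\<close>, \<open>right_part\<close> identify \<open>amb \<times> amb\<close> with \<open>amb\<close>, by splitting the
  index set according to the parity of the first component.
\<close>

definition merge :: "'k amb \<Rightarrow> 'k amb \<Rightarrow> 'k amb" where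
  "merge a b = (\<lambda>(x, y). if even x then a (x div 2, y) else b (x div 2, y))"

definition left_part :: "'k amb \<Rightarrow> 'k amb" where
  "left_part v = (\<lambda>(x, y). v (2 * x, y))"

definition right_part :: "'k amb \<Rightarrow> 'k amb" where
  "right_part v = (\<lambda>(x, y). v (2 * x + 1, y))"

definition direct_sum :: "'k::field rep \<Rightarrow> 'k rep \<Rightarrow> 'k rep" where
  "direct_sum A B =
     \<lparr>vsp = (\<lambda>i. {merge a b |a b. a \<in> vsp A i \<and> b \<in> vsp B i}),
      arr = (\<lambda>i v. merge (arr A i (left_part v)) (arr B i (right_part v)))\<rparr>"

definition indecomposable :: "cyclic_quiver_rels \<Rightarrow> 'k::field rep \<Rightarrow> bool" where
  "indecomposable \<Lambda> M \<longleftrightarrow> M \<in> modules \<Lambda> \<and> \<not> zero_rep M \<and>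
     (\<forall>A\<in>modules \<Lambda>. \<forall>B\<in>modules \<Lambda>. isomorphic \<Lambda> M (direct_sum A B) \<longrightarrow> zero_rep A \<or> zero_rep B)"

definition is_summand :: "cyclic_quiver_rels \<Rightarrow> 'k::field rep \<Rightarrow> 'k rep \<Rightarrow> bool" where
  "is_summand \<Lambda> X M \<longleftrightarrow>
     X \<in> modules \<Lambda> \<and> (\<exists>Y\<in>modules \<Lambda>. isomorphic \<Lambda> M (direct_sum X Y))"

definition simple_mod :: "cyclic_quiver_rels \<Rightarrow> 'k::field rep \<Rightarrow> bool" where
  "simple_mod \<Lambda> M \<longleftrightarrow> M \<in> modules \<Lambda> \<and> \<not> zero_rep M \<and> submodules \<Lambda> M = {\<lambda>i. {0}, vsp M}"

definition simple_at :: "nat \<Rightarrow> 'k::field rep" where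
  "simple_at i =
     \<lparr>vsp = (\<lambda>j. if j = i then amb.span {unit_vec (0, 0)} else {0}), arr = (\<lambda>j v. 0)\<rparr>"

definition uniserial :: "cyclic_quiver_rels \<Rightarrow> 'k::field rep \<Rightarrow> bool" where
  "uniserial \<Lambda> M \<longleftrightarrow> M \<in> modules \<Lambda> \<and>
     (\<forall>V\<in>submodules \<Lambda> M. \<forall>W\<in>submodules \<Lambda> M. V \<le> W \<or> W \<le> V)"

definition maximal_submodules :: "cyclic_quiver_rels \<Rightarrow> 'k::field rep \<Rightarrow> (nat \<Rightarrow> 'k amb set) set"
  where "maximal_submodules \<Lambda> M = {W \<in> submodules \<Lambda> M. W \<noteq> vsp M \<and>
     (\<forall>V\<in>submodules \<Lambda> M. W \<le> V \<longrightarrow> V = W \<or> V = vsp M)}"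

definition radical :: "cyclic_quiver_rels \<Rightarrow> 'k::field rep \<Rightarrow> nat \<Rightarrow> 'k amb set" where
  "radical \<Lambda> M = (\<lambda>i. vsp M i \<inter> (\<Inter>W\<in>maximal_submodules \<Lambda> M. W i))"

text \<open>\<open>top M = M / rad M\<close> is isomorphic to \<open>S\<close> iff \<open>S\<close> is an image of \<open>M\<close> with kernel \<open>rad M\<close>.\<close>

definition has_top :: "cyclic_quiver_rels \<Rightarrow> 'k::field rep \<Rightarrow> 'k rep \<Rightarrow> bool" where
  "has_top \<Lambda> M S \<longleftrightarrow> (\<exists>h\<in>rep_epis \<Lambda> M S. kernel_fam M h = radical \<Lambda> M)"

definition socle :: "cyclic_quiver_rels \<Rightarrow> 'k::field rep \<Rightarrow> 'k rep" where
  "socle \<Lambda> M = M\<lparr>vsp := (\<lambda>i. amb.span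
     (\<Union>W\<in>{W \<in> submodules \<Lambda> M. simple_mod \<Lambda> (M\<lparr>vsp := W\<rparr>)}. W i))\<rparr>"

definition mod_length :: "cyclic_quiver_rels \<Rightarrow> 'k::field rep \<Rightarrow> enat" where
  "mod_length \<Lambda> M = (SUP n\<in>{n. \<exists>c :: nat \<Rightarrow> nat \<Rightarrow> 'k amb set.
     (\<forall>m\<le>n. c m \<in> submodules \<Lambda> M) \<and> (\<forall>m<n. c m < c (Suc m))}. enat n)"

definition projective :: "cyclic_quiver_rels \<Rightarrow> 'k::field rep \<Rightarrow> bool" where
  "projective \<Lambda> P \<longleftrightarrow> P \<in> modules \<Lambda> \<and>
     (\<forall>M\<in>modules \<Lambda>. \<forall>N\<in>modules \<Lambda>. \<forall>g\<in>rep_epis \<Lambda> M N. \<forall>f\<in>homs \<Lambda> P N.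
        \<exists>h\<in>homs \<Lambda> P M. \<forall>i. \<forall>v\<in>vsp P i. g i (h i v) = f i v)"

definition injective :: "cyclic_quiver_rels \<Rightarrow> 'k::field rep \<Rightarrow> bool" where
  "injective \<Lambda> I \<longleftrightarrow> I \<in> modules \<Lambda> \<and>
     (\<forall>M\<in>modules \<Lambda>. \<forall>N\<in>modules \<Lambda>. \<forall>g\<in>rep_monos \<Lambda> M N. \<forall>f\<in>homs \<Lambda> M I.
        \<exists>h\<in>homs \<Lambda> N I. \<forall>i. \<forall>v\<in>vsp M i. h i (g i v) = f i v)"

text \<open>
  The algebra as a left module over itself: the nonzero paths \<open>(s, l)\<close> form a basis, those ending
  at \<open>i\<close> span the space at \<open>i\<close>, and an arrow acts by prolonging paths, \<open>(s, l) \<mapsto> (s, l + 1)\<close>.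
\<close>

definition regular_rep :: "cyclic_quiver_rels \<Rightarrow> 'k::field rep" where
  "regular_rep \<Lambda> =
     \<lparr>vsp = (\<lambda>i. amb.span {unit_vec (s, l) |s l.
        s \<in> verts \<Lambda> \<and> \<not> zero_path \<Lambda> (s, l) \<and> (nxt \<Lambda> ^^ l) s = i}),
      arr = (\<lambda>i v (s, l). if l > 0 \<and> \<not> zero_path \<Lambda> (s, l) then v (s, l - 1) else 0)\<rparr>"

definition self_injective :: "'k::field itself \<Rightarrow> cyclic_quiver_rels \<Rightarrow> bool" where
  "self_injective T \<Lambda> \<longleftrightarrow> injective \<Lambda> (regular_rep \<Lambda> :: 'k rep)"

text \<open>\<open>proj_res_le \<Lambda> n M\<close>: there is a projective resolution \<open>0 \<rightarrow> P_n \<rightarrow> \<dots> \<rightarrow> P_0 \<rightarrow> M \<rightarrow> 0\<close>.\<close>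

primrec proj_res_le :: "cyclic_quiver_rels \<Rightarrow> nat \<Rightarrow> 'k::field rep \<Rightarrow> bool" where
  "proj_res_le \<Lambda> 0 M \<longleftrightarrow> projective \<Lambda> M"
| "proj_res_le \<Lambda> (Suc n) M \<longleftrightarrow>
     (\<exists>P. projective \<Lambda> P \<and> (\<exists>p\<in>rep_epis \<Lambda> P M. proj_res_le \<Lambda> n (P\<lparr>vsp := kernel_fam P p\<rparr>)))"

definition proj_dim :: "cyclic_quiver_rels \<Rightarrow> 'k::field rep \<Rightarrow> enat" where
  "proj_dim \<Lambda> M = (INF n\<in>{n. proj_res_le \<Lambda> n M}. enat n)"

definition gl_dim :: "'k::field itself \<Rightarrow> cyclic_quiver_rels \<Rightarrow> enat" where
  "gl_dim T \<Lambda> = (SUP M\<in>(modules \<Lambda> :: 'k rep set). proj_dim \<Lambda> M)"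

definition projective_cover :: "cyclic_quiver_rels \<Rightarrow> 'k::field rep
    \<Rightarrow> (nat \<Rightarrow> 'k amb \<Rightarrow> 'k amb) \<Rightarrow> 'k rep \<Rightarrow> bool" where
  "projective_cover \<Lambda> P p M \<longleftrightarrow> projective \<Lambda> P \<and> p \<in> rep_epis \<Lambda> P M \<and>
     (\<forall>W\<in>submodules \<Lambda> P.
        (\<forall>i. {w + u |w u. w \<in> W i \<and> u \<in> kernel_fam P p i} = vsp P i) \<longrightarrow> W = vsp P)"

definition Syz :: "cyclic_quiver_rels \<Rightarrow> 'k::field rep \<Rightarrow> 'k rep" where
  "Syz \<Lambda> M = (SOME K. \<exists>P p. projective_cover \<Lambda> P p M \<and> K = P\<lparr>vsp := kernel_fam P p\<rparr>)"

definition syz_periodic :: "cyclic_quiver_rels \<Rightarrow> 'k::field rep \<Rightarrow> bool" where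
  "syz_periodic \<Lambda> X \<longleftrightarrow> (\<exists>m\<ge>1. isomorphic \<Lambda> ((Syz \<Lambda> ^^ m) X) X)"

text \<open>
  In place of a set of representatives, the class, closed under isomorphism, of all indecomposable
  \<open>\<Omega>\<close>-periodic modules; membership in it is membership up to isomorphism in the former.
\<close>

definition Omega_per :: "cyclic_quiver_rels \<Rightarrow> 'k::field rep set" where
  "Omega_per \<Lambda> = {X. indecomposable \<Lambda> X \<and> syz_periodic \<Lambda> X}"

definition kext :: "cyclic_quiver_rels \<Rightarrow> nat \<Rightarrow> nat" where
  "kext \<Lambda> f = (if f = 0 then kidx \<Lambda> (2 * nrels \<Lambda>) else kidx \<Lambda> f)"

text \<open>\<open>nxt \<Lambda> i\<close> is \<open>i + 1\<close> modulo the number of vertices.\<close>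

definition Delta_candidate :: "cyclic_quiver_rels \<Rightarrow> nat \<Rightarrow> 'k::field rep \<Rightarrow> bool" where
  "Delta_candidate \<Lambda> j M \<longleftrightarrow> indecomposable \<Lambda> M \<and> uniserial \<Lambda> M \<and>
     isomorphic \<Lambda> (socle \<Lambda> M) (simple_at (kext \<Lambda> (2 * j))) \<and>
     has_top \<Lambda> M (simple_at (nxt \<Lambda> (kext \<Lambda> (2 * (j - 1)))))"

definition Delta :: "cyclic_quiver_rels \<Rightarrow> nat \<Rightarrow> 'k::field rep" where
  "Delta \<Lambda> j = arg_min (mod_length \<Lambda>) (Delta_candidate \<Lambda> j)"

definition K0_rels :: "cyclic_quiver_rels \<Rightarrow> ('k::field rep \<Rightarrow>\<^sub>0 int) set" where
  "K0_rels \<Lambda> =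
     {frag_of C - (frag_of A + frag_of B) |A B C.
        A \<in> modules \<Lambda> \<and> B \<in> modules \<Lambda> \<and> C \<in> modules \<Lambda> \<and> isomorphic \<Lambda> C (direct_sum A B)} \<union>
     {frag_of P |P. projective \<Lambda> P}"

definition K0_ker :: "cyclic_quiver_rels \<Rightarrow> ('k::field rep \<Rightarrow>\<^sub>0 int) set" where
  "K0_ker \<Lambda> = generate (free_Abelian_group (modules \<Lambda>)) (K0_rels \<Lambda>)"

definition K0 :: "cyclic_quiver_rels \<Rightarrow> ('k::field rep \<Rightarrow>\<^sub>0 int) set monoid" where
  "K0 \<Lambda> = free_Abelian_group (modules \<Lambda>) Mod K0_ker \<Lambda>"

definition K0_class :: "cyclic_quiver_rels \<Rightarrow> 'k::field rep \<Rightarrow> ('k rep \<Rightarrow>\<^sub>0 int) set" where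
  "K0_class \<Lambda> M = K0_ker \<Lambda> #>\<^bsub>free_Abelian_group (modules \<Lambda>)\<^esub> frag_of M"

definition K0_L :: "cyclic_quiver_rels \<Rightarrow> ('k::field rep \<Rightarrow>\<^sub>0 int) set \<Rightarrow> ('k rep \<Rightarrow>\<^sub>0 int) set" where
  "K0_L \<Lambda> = (SOME L. L \<in> hom (K0 \<Lambda>) (K0 \<Lambda>) \<and>
     (\<forall>M\<in>modules \<Lambda>. L (K0_class \<Lambda> M) = K0_class \<Lambda> (Syz \<Lambda> M)))"

definition add_subgroup :: "cyclic_quiver_rels \<Rightarrow> 'k::field rep \<Rightarrow> ('k rep \<Rightarrow>\<^sub>0 int) set set" where
  "add_subgroup \<Lambda> M =
     generate (K0 \<Lambda>) {K0_class \<Lambda> X |X. indecomposable \<Lambda> X \<and> is_summand \<Lambda> X M}"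

definition int_independent :: "('g, 'm) monoid_scheme \<Rightarrow> 'g set \<Rightarrow> bool" where
  "int_independent G B \<longleftrightarrow> finite B \<and>
     (\<forall>c :: 'g \<Rightarrow> int. finprod G (\<lambda>b. b [^]\<^bsub>G\<^esub> c b) B = \<one>\<^bsub>G\<^esub> \<longrightarrow> (\<forall>b\<in>B. c b = 0))"

definition subgroup_rank :: "('g, 'm) monoid_scheme \<Rightarrow> 'g set \<Rightarrow> enat" where
  "subgroup_rank G H = (SUP B\<in>{B. B \<subseteq> H \<and> int_independent G B}. enat (card B))"

definition phi :: "cyclic_quiver_rels \<Rightarrow> 'k::field rep \<Rightarrow> nat" where
  "phi \<Lambda> M = (LEAST t. \<forall>j\<ge>1.
     subgroup_rank (K0 \<Lambda>) ((K0_L \<Lambda> ^^ t) ` add_subgroup \<Lambda> M) =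
     subgroup_rank (K0 \<Lambda>) ((K0_L \<Lambda> ^^ (t + j)) ` add_subgroup \<Lambda> M))"

definition phi_dim :: "'k::field itself \<Rightarrow> cyclic_quiver_rels \<Rightarrow> enat" where
  "phi_dim T \<Lambda> = (SUP M\<in>(modules \<Lambda> :: 'k rep set). enat (phi \<Lambda> M))"

end

theory Submission
  imports Defs
begin

text \<open>
  Every module is a direct sum of uniserial modules, which are encoded as intervals \<open>[x, y)\<close> of
  positions on the universal cover of the cycle. With \<open>e x\<close> the end of the projective interval
  starting at \<open>x\<close>, one has \<open>\<Omega> [x, y) = [y, e x)\<close> and hence \<open>\<Omega>\<^sup>2 [x, y) = [e x, e y)\<close>, with the empty
  interval as the zero module. The nonprojective intervals are a basis of \<open>K\<^sub>0\<close>, so that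
  \<open>\<phi>dim \<le> t\<close> iff every \<open>\<Omega>\<^sup>t [x, y)\<close> is projective, zero or periodic.

  The algebra is self-injective iff \<open>e\<close> is injective. If it is not, there is some \<open>y\<close> in the image
  \<open>E\<close> of \<open>e\<close> with \<open>y - 1 \<notin> E\<close>; then \<open>[y - 1, y)\<close> is a nonprojective syzygy, and it is not periodic
  since the end points of periodic intervals lie in \<open>E\<close>. Hence \<open>\<phi>dim \<ge> 2\<close>. Finally, the \<open>\<Delta>\<^sub>j\<close> are the
  intervals between consecutive points of \<open>E\<close>. If they are periodic, then \<open>e\<close> is strictly
  increasing on \<open>E\<close>, so that \<open>\<Omega>\<^sup>2\<close> permutes the finitely many nonprojective intervals with end
  points in \<open>E\<close>, and these comprise all nonprojective second syzygies.
\<close>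

text \<open>Intervals may wind around the cycle, so that several of their positions lie over one
  vertex. This is why the spaces at a vertex need not be one-dimensional, why arguments about
  submodules and retractions work with leading coordinates, and why the combinatorics moves to the
  integers, where \<open>e\<close> is monotone and commutes with translation by the number of
  vertices.

  The role of the Krull-Schmidt theorem is taken by counting: the ranks of path maps are additive
  isomorphism invariants, and an alternating sum of four of them is 1 on one interval and 0 on all
  others. These sums show that intervals are indecomposable. For nonprojective intervals they vanish
  on projectives and so descend to coordinate functions on \<open>K0\<close>.

  Infinite global dimension excludes the case that all second syzygies are projective. In that case
  a condition on the periodicity of second syzygies is vacuous and says nothing about the modules
  \<Delta>_j.\<close>

interpretation lp: vector_space_pair "scal :: 'k::field \<Rightarrow> _" scal
  by unfold_locales

lemma vector_space_field: "vector_space ((*) :: 'k::field \<Rightarrow> 'k \<Rightarrow> 'k)"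
  by unfold_locales (auto simp: algebra_simps)

interpretation lf: vector_space_pair "scal :: 'k::field \<Rightarrow> _" "(*)"
  by (intro vector_space_pair.intro vector_space_field) unfold_locales

section \<open>Linear maps and coordinate subspaces of the ambient space\<close>

abbreviation lin :: "('k::field amb \<Rightarrow> 'k amb) \<Rightarrow> bool" where
  "lin \<equiv> Vector_Spaces.linear scal scal"

lemma lin_iff: "lin f \<longleftrightarrow> (\<forall>x y. f (x + y) = f x + f y) \<and> (\<forall>c x. f (scal c x) = scal c (f x))"
  unfolding Vector_Spaces.linear_iff using amb.vector_space_axioms by blast

lemma linI:
  assumes "\<And>x y. f (x + y) = f x + f y" "\<And>c x. f (scal c x) = scal c (f x)"
  shows "lin f"
  using assms by (simp add: lin_iff)

lemma lin_add: "lin f \<Longrightarrow> f (x + y) = f x + f y"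
  and lin_scal: "lin f \<Longrightarrow> f (scal c x) = scal c (f x)"
  by (simp_all add: lin_iff)

lemma lin_0: "lin f \<Longrightarrow> f 0 = 0"
  by (rule lp.linear_0)

lemma lin_diff: "lin f \<Longrightarrow> f (x - y) = f x - f y"
  by (rule lp.linear_diff)

lemma lin_sum: "lin f \<Longrightarrow> f (\<Sum>a\<in>A. g a) = (\<Sum>a\<in>A. f (g a))"
  by (rule lp.linear_sum)

lemma lin_comp: "lin f \<Longrightarrow> lin g \<Longrightarrow> lin (\<lambda>x. f (g x))"
  by (simp add: lin_iff)

lemma lin_id: "lin (\<lambda>x. x)"
  by (simp add: lin_iff)

lemma lin_zero: "lin (\<lambda>x. 0)"
  by (simp add: lin_iff)

lemma lin_plus: "lin f \<Longrightarrow> lin g \<Longrightarrow> lin (\<lambda>x. f x + g x)"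
  by (simp add: lin_iff algebra_simps amb.scale_right_distrib)

lemma lin_minus: "lin f \<Longrightarrow> lin g \<Longrightarrow> lin (\<lambda>x. f x - g x)"
  by (simp add: lin_iff algebra_simps amb.scale_right_diff_distrib)

lemma lin_setsum: "(\<And>a. a \<in> A \<Longrightarrow> lin (f a)) \<Longrightarrow> lin (\<lambda>x. \<Sum>a\<in>A. f a x)"
proof (induction A rule: infinite_finite_induct)
  case (insert a A)
  then have "lin (\<lambda>x. f a x + (\<Sum>a\<in>A. f a x))"
    by (intro lin_plus) auto
  then show ?case by (simp only: sum.insert[OF insert.hyps])
qed (simp_all only: sum.empty sum.infinite if_False lin_zero not_False_eq_True)

lemma scal_apply: "scal c v p = c * v p"
  by (simp add: scal_def)

lemma lin_coord_scal: "lin (\<lambda>x :: 'a::field amb. scal (x p) v)"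
proof (rule linI)
  show "scal ((x + y) p) v = scal (x p) v + scal (y p) v" for x y :: "'a amb"
    by (simp only: plus_fun_apply amb.scale_left_distrib)
  show "scal ((scal c x) p) v = scal c (scal (x p) v)" for c and x :: "'a amb"
    by (simp only: scal_apply amb.scale_scale)
qed

text \<open>The spaces of intervals and of the regular module are all of this form, which turns
  membership into a condition on coordinates and the dimension into a cardinality.\<close>

definition supp :: "(nat \<times> nat) set \<Rightarrow> 'k::field amb set" where
  "supp S = {v. \<forall>p. v p \<noteq> 0 \<longrightarrow> p \<in> S}"

lemma subspace_supp: "amb.subspace (supp S)"
proof (rule amb.subspaceI)
  fix x y :: "'a amb" assume "x \<in> supp S" "y \<in> supp S"
  moreover have "(x + y) p \<noteq> 0 \<Longrightarrow> x p \<noteq> 0 \<or> y p \<noteq> 0" for p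
    by auto
  ultimately show "x + y \<in> supp S"
    unfolding supp_def by blast
qed (auto simp: supp_def scal_apply)

lemma unit_vec_in_supp [simp]: "unit_vec p \<in> supp S \<longleftrightarrow> p \<in> S"
  by (cases p) (auto simp: supp_def unit_vec_def)

lemma unit_vec_apply: "unit_vec p q = (if q = p then 1 else 0)"
  by (simp add: unit_vec_def)

lemma unit_vec_nonzero [simp]: "unit_vec p \<noteq> 0"
  by (metis unit_vec_apply zero_fun_apply zero_neq_one)

lemma inj_unit_vec: "inj (unit_vec :: _ \<Rightarrow> 'k::field amb)"
proof (rule injI)
  fix p q :: "nat \<times> nat" assume "unit_vec p = (unit_vec q :: 'k amb)"
  then have "(1 :: 'k) = (if p = q then 1 else 0)"
    by (metis unit_vec_apply)
  then show "p = q" by (metis zero_neq_one)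
qed

lemma sum_fun_apply: "(\<Sum>a\<in>A. f a) p = (\<Sum>a\<in>A. (f a :: 'k::field amb) p)"
  by (induction A rule: infinite_finite_induct) auto

lemma supp_expand:
  assumes "finite S" "v \<in> supp S"
  shows "v = (\<Sum>p\<in>S. scal (v p) (unit_vec p))"
proof
  fix q
  have "(\<Sum>p\<in>S. scal (v p) (unit_vec p)) q = (\<Sum>p\<in>S. if q = p then v p else 0)"
    unfolding sum_fun_apply by (rule sum.cong) (auto simp: unit_vec_apply scal_apply)
  also have "\<dots> = v q"
    using assms by (cases q) (force simp: supp_def)
  finally show "v q = (\<Sum>p\<in>S. scal (v p) (unit_vec p)) q" ..
qed

lemma span_unit_vec: "finite S \<Longrightarrow> amb.span (unit_vec ` S) = (supp S :: 'k::field amb set)"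
proof (rule amb.span_subspace)
  assume "finite S"
  show "supp S \<subseteq> amb.span (unit_vec ` S :: 'k amb set)"
  proof
    fix v :: "'k amb" assume "v \<in> supp S"
    then have "v = (\<Sum>p\<in>S. scal (v p) (unit_vec p))"
      using \<open>finite S\<close> supp_expand by blast
    moreover have "\<dots> \<in> amb.span (unit_vec ` S)"
      by (intro amb.span_sum amb.span_scale amb.span_base) auto
    ultimately show "v \<in> amb.span (unit_vec ` S)" by simp
  qed
qed (auto simp: subspace_supp)

lemma independent_unit_vec:
  assumes "finite S"
  shows "amb.independent (unit_vec ` S :: 'k::field amb set)"
proof (rule amb.independent_if_scalars_zero)
  fix f :: "'k amb \<Rightarrow> 'k" and x :: "'k amb"
  assume s: "(\<Sum>x\<in>unit_vec ` S. scal (f x) x) = 0" and x: "x \<in> unit_vec ` S"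
  then obtain q where q: "q \<in> S" "x = unit_vec q" by blast
  have "0 = (\<Sum>x\<in>unit_vec ` S. scal (f x) x) q" by (simp add: s)
  also have "\<dots> = (\<Sum>p\<in>S. (scal (f (unit_vec p)) (unit_vec p)) q)"
    by (subst sum.reindex) (auto simp: sum_fun_apply intro: inj_on_subset[OF inj_unit_vec])
  also have "\<dots> = (\<Sum>p\<in>S. if q = p then f (unit_vec p) else 0)"
    by (rule sum.cong) (auto simp: unit_vec_apply scal_apply)
  also have "\<dots> = f x"
    using assms q by simp
  finally show "f x = 0" ..
qed (use assms in auto)

lemma dim_supp: "finite S \<Longrightarrow> amb.dim (supp S :: 'k::field amb set) = card S"
  by (metis amb.dim_span_eq_card_independent card_image inj_unit_vec inj_on_subset subset_UNIV
      independent_unit_vec span_unit_vec)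

lemma supp_empty [simp]: "supp {} = {0}"
  by (auto simp: supp_def)

lemma supp_mono: "S \<subseteq> T \<Longrightarrow> supp S \<subseteq> supp T"
  by (auto simp: supp_def)

lemma lin_eq_on_supp:
  assumes "lin f" "lin g" "finite S" "v \<in> supp S" "\<And>p. p \<in> S \<Longrightarrow> f (unit_vec p) = g (unit_vec p)"
  shows "f v = g v"
  by (rule lp.linear_eq_on[where B = "unit_vec ` S"]) (use assms in \<open>auto simp only: span_unit_vec\<close>)

section \<open>Representations\<close>

lemma module_subspace: "M \<in> modules \<Lambda> \<Longrightarrow> amb.subspace (vsp M i)"
  and module_fin: "M \<in> modules \<Lambda> \<Longrightarrow> \<exists>B. finite B \<and> vsp M i \<subseteq> amb.span B"
  and module_outside: "M \<in> modules \<Lambda> \<Longrightarrow> i \<notin> verts \<Lambda> \<Longrightarrow> vsp M i = {0}"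
  and module_lin: "M \<in> modules \<Lambda> \<Longrightarrow> lin (arr M i)"
  and module_closed: "M \<in> modules \<Lambda> \<Longrightarrow> v \<in> vsp M i \<Longrightarrow> arr M i v \<in> vsp M (nxt \<Lambda> i)"
  and module_rel: "M \<in> modules \<Lambda> \<Longrightarrow> j \<in> {1..nrels \<Lambda>} \<Longrightarrow> v \<in> vsp M (kidx \<Lambda> (2 * j - 1)) \<Longrightarrow>
    path_map \<Lambda> M (kidx \<Lambda> (2 * j - 1)) (rlen \<Lambda> j) v = 0"
  by (auto simp: modules_def image_subset_iff)

lemma module_0: "M \<in> modules \<Lambda> \<Longrightarrow> 0 \<in> vsp M i"
  using amb.subspace_0 module_subspace by blast

lemma moduleI:
  assumes "\<And>i. amb.subspace (vsp M i)" "\<And>i. \<exists>B. finite B \<and> vsp M i \<subseteq> amb.span B"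
    "\<And>i. i \<notin> verts \<Lambda> \<Longrightarrow> vsp M i = {0}" "\<And>i. lin (arr M i)"
    "\<And>i v. v \<in> vsp M i \<Longrightarrow> arr M i v \<in> vsp M (nxt \<Lambda> i)"
    "\<And>j v. j \<in> {1..nrels \<Lambda>} \<Longrightarrow> v \<in> vsp M (kidx \<Lambda> (2 * j - 1)) \<Longrightarrow>
      path_map \<Lambda> M (kidx \<Lambda> (2 * j - 1)) (rlen \<Lambda> j) v = 0"
  shows "M \<in> modules \<Lambda>"
  unfolding modules_def using assms by auto

lemma path_map_lin: "(\<And>i. lin (arr M i)) \<Longrightarrow> lin (path_map \<Lambda> M i l)"
proof (induction l)
  case 0
  then show ?case by (simp add: lin_iff)
next
  case (Suc l)
  then show ?case using lin_comp[of "arr M _" "path_map \<Lambda> M i l"]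
    by (simp add: lin_iff)
qed

lemma module_path_lin: "M \<in> modules \<Lambda> \<Longrightarrow> lin (path_map \<Lambda> M i l)"
  by (simp add: path_map_lin module_lin)

lemma path_map_closed: "M \<in> modules \<Lambda> \<Longrightarrow> v \<in> vsp M i \<Longrightarrow> path_map \<Lambda> M i l v \<in> vsp M ((nxt \<Lambda> ^^ l) i)"
  by (induction l) (auto simp: module_closed)

lemma path_map_add:
  "path_map \<Lambda> M i (l + m) v = path_map \<Lambda> M ((nxt \<Lambda> ^^ l) i) m (path_map \<Lambda> M i l v)"
proof (induction m)
  case (Suc m)
  have "(nxt \<Lambda> ^^ (l + m)) i = (nxt \<Lambda> ^^ m) ((nxt \<Lambda> ^^ l) i)"
    by (metis add.commute comp_apply funpow_add)
  with Suc show ?case by simp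
qed simp

lemma path_map_Suc_left: "path_map \<Lambda> M i (Suc l) v = path_map \<Lambda> M (nxt \<Lambda> i) l (arr M i v)"
  using path_map_add[of \<Lambda> M i 1 l v] by simp

lemma path_map_vsp [simp]: "path_map \<Lambda> (M\<lparr>vsp := W\<rparr>) i l v = path_map \<Lambda> M i l v"
  by (induction l) auto

lemma path_map_zero_path:
  assumes M: "M \<in> modules \<Lambda>" and z: "zero_path \<Lambda> (i, l)" and v: "v \<in> vsp M i"
  shows "path_map \<Lambda> M i l v = 0"
proof -
  obtain j a where j: "j \<in> {1..nrels \<Lambda>}" and a: "a + rlen \<Lambda> j \<le> l"
    "(nxt \<Lambda> ^^ a) i = kidx \<Lambda> (2 * j - 1)"
    using z by (auto simp: zero_path_def path_in_ideal_def rel_path_def)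
  then obtain b where l: "l = a + (rlen \<Lambda> j + b)" by (metis le_Suc_ex add.assoc)
  have "path_map \<Lambda> M (kidx \<Lambda> (2 * j - 1)) (rlen \<Lambda> j) (path_map \<Lambda> M i a v) = 0"
    by (rule module_rel[OF M j]) (use path_map_closed[OF M v, of a] a in simp)
  then show ?thesis
    unfolding l path_map_add a using lin_0[OF module_path_lin[OF M]] by simp
qed

lemma homs_lin: "h \<in> homs \<Lambda> M N \<Longrightarrow> lin (h i)"
  and homs_closed: "h \<in> homs \<Lambda> M N \<Longrightarrow> v \<in> vsp M i \<Longrightarrow> h i v \<in> vsp N i"
  and homs_arr: "h \<in> homs \<Lambda> M N \<Longrightarrow> v \<in> vsp M i \<Longrightarrow> h (nxt \<Lambda> i) (arr M i v) = arr N i (h i v)"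
  by (auto simp: homs_def)

lemma homsI:
  assumes "\<And>i. lin (h i)" "\<And>i v. v \<in> vsp M i \<Longrightarrow> h i v \<in> vsp N i"
    "\<And>i v. v \<in> vsp M i \<Longrightarrow> h (nxt \<Lambda> i) (arr M i v) = arr N i (h i v)"
  shows "h \<in> homs \<Lambda> M N"
  unfolding homs_def using assms by auto

lemma homs_path:
  assumes "M \<in> modules \<Lambda>" "h \<in> homs \<Lambda> M N" "v \<in> vsp M i"
  shows "h ((nxt \<Lambda> ^^ l) i) (path_map \<Lambda> M i l v) = path_map \<Lambda> N i l (h i v)"
  by (induction l) (use assms in \<open>auto simp: homs_arr path_map_closed\<close>)

lemma homs_comp:
  assumes "f \<in> homs \<Lambda> M N" "g \<in> homs \<Lambda> N K"
  shows "(\<lambda>i v. g i (f i v)) \<in> homs \<Lambda> M K"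
  by (rule homsI) (use assms in \<open>auto simp: homs_lin homs_closed homs_arr intro: lin_comp\<close>)

lemma homs_id: "(\<lambda>i v. v) \<in> homs \<Lambda> M M"
  by (rule homsI) (auto simp: lin_id)

definition iso_pair :: "cyclic_quiver_rels \<Rightarrow> 'k::field rep \<Rightarrow> 'k rep \<Rightarrow>
    (nat \<Rightarrow> 'k amb \<Rightarrow> 'k amb) \<Rightarrow> (nat \<Rightarrow> 'k amb \<Rightarrow> 'k amb) \<Rightarrow> bool" where
  "iso_pair \<Lambda> M N f g \<longleftrightarrow> f \<in> homs \<Lambda> M N \<and> g \<in> homs \<Lambda> N M \<and>
     (\<forall>i. \<forall>v\<in>vsp M i. g i (f i v) = v) \<and> (\<forall>i. \<forall>w\<in>vsp N i. f i (g i w) = w)"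

lemma isomorphicI: "iso_pair \<Lambda> M N f g \<Longrightarrow> isomorphic \<Lambda> M N"
  unfolding isomorphic_def
proof (intro bexI[of _ f] allI)
  fix i assume fg: "iso_pair \<Lambda> M N f g"
  then show "bij_betw (f i) (vsp M i) (vsp N i)"
    by (intro bij_betw_byWitness[where f' = "g i"]) (auto simp: iso_pair_def homs_closed)
qed (simp add: iso_pair_def)

text \<open>The inverse of \<open>h i\<close> lives on \<open>vsp N i\<close> only, whereas the
  components of a morphism are linear maps of the whole ambient space. A linear left inverse of
  \<open>h i\<close> on \<open>vsp M i\<close> provides the extension.\<close>

lemma bij_hom_iso_pair:
  assumes M: "M \<in> modules \<Lambda>" and h: "h \<in> homs \<Lambda> M N"
    and bij: "\<And>i. bij_betw (h i) (vsp M i) (vsp N i)"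
  obtains g where "iso_pair \<Lambda> M N h g"
proof -
  have "\<exists>g. lin g \<and> (\<forall>v\<in>vsp M i. g (h i v) = v)" for i
    using lp.linear_exists_left_inverse_on[OF homs_lin[OF h] module_subspace[OF M]
        bij_betw_imp_inj_on[OF bij]] by blast
  then obtain g where g: "\<And>i. lin (g i)" "\<And>i v. v \<in> vsp M i \<Longrightarrow> g i (h i v) = v" by metis
  have surj: "\<exists>v\<in>vsp M i. w = h i v" if "w \<in> vsp N i" for i w
    using bij[of i] that by (auto simp: bij_betw_def)
  have "g \<in> homs \<Lambda> N M"
  proof (rule homsI)
    fix i w assume w: "w \<in> vsp N i"
    then obtain v where v: "v \<in> vsp M i" "w = h i v" using surj by blast
    show "g i w \<in> vsp M i" using v g by simp
    show "g (nxt \<Lambda> i) (arr N i w) = arr M i (g i w)"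
      using v g h M by (simp add: homs_arr[symmetric] module_closed)
  qed (use g in auto)
  then have "iso_pair \<Lambda> M N h g"
    unfolding iso_pair_def using g h surj by metis
  then show thesis by (rule that)
qed

lemma isomorphicE:
  assumes "isomorphic \<Lambda> M N" "M \<in> modules \<Lambda>"
  obtains f g where "iso_pair \<Lambda> M N f g"
  using assms bij_hom_iso_pair unfolding isomorphic_def by metis

lemma iso_pair_sym: "iso_pair \<Lambda> M N f g \<Longrightarrow> iso_pair \<Lambda> N M g f"
  by (simp add: iso_pair_def)

lemma isomorphic_refl: "isomorphic \<Lambda> M M"
  by (rule isomorphicI[of _ _ _ "\<lambda>i v. v" "\<lambda>i v. v"]) (simp add: iso_pair_def homs_id)

lemma isomorphic_sym: "isomorphic \<Lambda> M N \<Longrightarrow> M \<in> modules \<Lambda> \<Longrightarrow> isomorphic \<Lambda> N M"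
  by (metis isomorphicE isomorphicI iso_pair_sym)

lemma isomorphic_trans:
  assumes "isomorphic \<Lambda> M N" "isomorphic \<Lambda> N K"
  shows "isomorphic \<Lambda> M K"
proof -
  obtain f g where f: "f \<in> homs \<Lambda> M N" "\<And>i. bij_betw (f i) (vsp M i) (vsp N i)"
    and g: "g \<in> homs \<Lambda> N K" "\<And>i. bij_betw (g i) (vsp N i) (vsp K i)"
    using assms unfolding isomorphic_def by blast
  show ?thesis unfolding isomorphic_def
    using homs_comp[OF f(1) g(1)] bij_betw_trans[OF f(2) g(2)]
    by (intro bexI[of _ "\<lambda>i v. g i (f i v)"]) (auto simp: comp_def)
qed

lemma submodule_module:
  assumes M: "M \<in> modules \<Lambda>" and W: "W \<in> submodules \<Lambda> M"
  shows "M\<lparr>vsp := W\<rparr> \<in> modules \<Lambda>"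
proof (rule moduleI)
  have W': "\<And>i. amb.subspace (W i)" "\<And>i. W i \<subseteq> vsp M i" "\<And>i. arr M i ` W i \<subseteq> W (nxt \<Lambda> i)"
    using W by (auto simp: submodules_def)
  fix i
  show "\<exists>B. finite B \<and> vsp (M\<lparr>vsp := W\<rparr>) i \<subseteq> amb.span B"
    using module_fin[OF M, of i] W'(2) by fastforce
  show "vsp (M\<lparr>vsp := W\<rparr>) i = {0}" if "i \<notin> verts \<Lambda>"
    using W'(2)[of i] module_outside[OF M that] amb.subspace_0[OF W'(1)[of i]] by auto
  show "arr (M\<lparr>vsp := W\<rparr>) i v \<in> vsp (M\<lparr>vsp := W\<rparr>) (nxt \<Lambda> i)" if "v \<in> vsp (M\<lparr>vsp := W\<rparr>) i" for v
    using that W'(3)[of i] by auto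
  show "amb.subspace (vsp (M\<lparr>vsp := W\<rparr>) i)" using W' by simp
  show "lin (arr (M\<lparr>vsp := W\<rparr>) i)" using M by (simp add: module_lin)
  show "path_map \<Lambda> (M\<lparr>vsp := W\<rparr>) (kidx \<Lambda> (2 * j - 1)) (rlen \<Lambda> j) v = 0"
    if "j \<in> {1..nrels \<Lambda>}" "v \<in> vsp (M\<lparr>vsp := W\<rparr>) (kidx \<Lambda> (2 * j - 1))" for j v
    using that module_rel[OF M] W'(2) by auto
qed

lemma kernel_submodule:
  assumes M: "M \<in> modules \<Lambda>" and N: "N \<in> modules \<Lambda>" and h: "h \<in> homs \<Lambda> M N"
  shows "kernel_fam M h \<in> submodules \<Lambda> M"
proof -
  have "amb.subspace (kernel_fam M h i)" for i
    unfolding kernel_fam_def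
    using amb.subspace_inter[OF module_subspace[OF M, of i] lp.linear_subspace_kernel[OF homs_lin[OF h, of i]]]
    by (simp add: Int_def)
  moreover have "arr M i v \<in> kernel_fam M h (nxt \<Lambda> i)"
    if "v \<in> kernel_fam M h i" for i v
    using that homs_arr[OF h, of v i] module_closed[OF M, of v i] lin_0[OF module_lin[OF N, of i]]
    by (auto simp: kernel_fam_def)
  ultimately show ?thesis
    by (auto simp: submodules_def kernel_fam_def)
qed

section \<open>Direct sums\<close>

lemma left_part_merge [simp]: "left_part (merge a b) = a"
  and right_part_merge [simp]: "right_part (merge a b) = b"
  and merge_parts [simp]: "merge (left_part v) (right_part v) = v"
  by (auto simp: left_part_def right_part_def merge_def fun_eq_iff)

lemma merge_add: "merge (a + c) (b + d) = merge a b + (merge c d :: 'k::field amb)"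
  and merge_scal: "merge (scal r a) (scal r b) = scal r (merge a b :: 'k::field amb)"
  and merge_0 [simp]: "merge 0 0 = (0 :: 'k::field amb)"
  by (auto simp: merge_def scal_def fun_eq_iff)

lemma merge_eq_0: "merge a b = (0 :: 'k::field amb) \<longleftrightarrow> a = 0 \<and> b = 0"
  by (metis left_part_merge merge_0 right_part_merge)

lemma lin_left_part: "lin (left_part :: 'k::field amb \<Rightarrow> _)"
  and lin_right_part: "lin (right_part :: 'k::field amb \<Rightarrow> _)"
  by (auto intro!: linI simp: left_part_def right_part_def scal_def fun_eq_iff)

lemma lin_merge:
  assumes "lin f" "lin g"
  shows "lin (\<lambda>x. merge (f x) (g x))"
proof (rule linI)
  show "merge (f (x + y)) (g (x + y)) = merge (f x) (g x) + merge (f y) (g y)" for x y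
    by (simp only: lin_add[OF assms(1)] lin_add[OF assms(2)] merge_add)
  show "merge (f (scal c x)) (g (scal c x)) = scal c (merge (f x) (g x))" for c x
    by (simp only: lin_scal[OF assms(1)] lin_scal[OF assms(2)] merge_scal)
qed

lemma vsp_direct_sum: "v \<in> vsp (direct_sum A B) i \<longleftrightarrow> left_part v \<in> vsp A i \<and> right_part v \<in> vsp B i"
proof -
  have "\<exists>a b. v = merge a b \<and> a \<in> vsp A i \<and> b \<in> vsp B i"
    if "left_part v \<in> vsp A i \<and> right_part v \<in> vsp B i"
    using that by (intro exI[of _ "left_part v"] exI[of _ "right_part v"]) simp
  then show ?thesis by (auto simp: direct_sum_def)
qed

lemma arr_direct_sum: "arr (direct_sum A B) i v = merge (arr A i (left_part v)) (arr B i (right_part v))"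
  by (simp add: direct_sum_def)

lemma path_direct_sum:
  "path_map \<Lambda> (direct_sum A B) i l v =
     merge (path_map \<Lambda> A i l (left_part v)) (path_map \<Lambda> B i l (right_part v))"
  by (induction l) (auto simp: arr_direct_sum)

lemma direct_sum_module:
  assumes A: "A \<in> modules \<Lambda>" and B: "B \<in> modules \<Lambda>"
  shows "direct_sum A B \<in> modules \<Lambda>"
proof (rule moduleI)
  fix i
  show "amb.subspace (vsp (direct_sum A B) i)"
  proof -
    have "vsp (direct_sum A B) i = {v. left_part v \<in> vsp A i} \<inter> {v. right_part v \<in> vsp B i}"
      by (auto simp: vsp_direct_sum)
    also have "amb.subspace \<dots>"
      by (intro amb.subspace_inter lp.linear_subspace_linear_preimage lin_left_part lin_right_part
          module_subspace[OF A] module_subspace[OF B])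
    finally show ?thesis .
  qed
  obtain S T where S: "finite S" "vsp A i \<subseteq> amb.span S" and T: "finite T" "vsp B i \<subseteq> amb.span T"
    using module_fin[OF A] module_fin[OF B] by meson
  show "\<exists>B'. finite B' \<and> vsp (direct_sum A B) i \<subseteq> amb.span B'"
  proof (intro exI[of _ "(\<lambda>a. merge a 0) ` S \<union> merge 0 ` T"] conjI subsetI)
    fix v assume "v \<in> vsp (direct_sum A B) i"
    then have v: "left_part v \<in> amb.span S" "right_part v \<in> amb.span T"
      using S T by (auto simp: vsp_direct_sum)
    have "merge (left_part v) 0 \<in> amb.span ((\<lambda>a. merge a 0) ` S)"
      using v lp.linear_span_image[OF lin_merge[OF lin_id lin_zero], of S] by auto
    moreover have "merge 0 (right_part v) \<in> amb.span (merge 0 ` T)"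
      using v lp.linear_span_image[OF lin_merge[OF lin_zero lin_id], of T] by auto
    ultimately have "merge (left_part v) 0 + merge 0 (right_part v)
        \<in> amb.span ((\<lambda>a. merge a 0) ` S \<union> merge 0 ` T)"
      by (meson amb.span_add amb.span_mono Un_upper1 Un_upper2 subsetD)
    then show "v \<in> amb.span ((\<lambda>a. merge a 0) ` S \<union> merge 0 ` T)"
      by (simp add: merge_add[symmetric] del: plus_fun_apply)
  qed (use S T in auto)
  show "vsp (direct_sum A B) i = {0}" if "i \<notin> verts \<Lambda>"
  proof -
    have "v = 0" if "left_part v = 0" "right_part v = 0" for v :: "'a amb"
      using merge_parts[of v] that by simp
    moreover have "left_part 0 = (0 :: 'a amb)" "right_part 0 = (0 :: 'a amb)"
      by (auto simp: left_part_def right_part_def fun_eq_iff)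
    ultimately show ?thesis
      by (auto simp: vsp_direct_sum module_outside[OF A that] module_outside[OF B that])
  qed
  show "lin (arr (direct_sum A B) i)"
    unfolding arr_direct_sum[abs_def]
    by (intro lin_merge lin_comp[OF _ lin_left_part] lin_comp[OF _ lin_right_part] module_lin[OF A] module_lin[OF B])
  show "arr (direct_sum A B) i v \<in> vsp (direct_sum A B) (nxt \<Lambda> i)" if "v \<in> vsp (direct_sum A B) i" for v
    using that A B by (simp add: vsp_direct_sum arr_direct_sum module_closed)
  show "path_map \<Lambda> (direct_sum A B) (kidx \<Lambda> (2 * j - 1)) (rlen \<Lambda> j) v = 0"
    if "j \<in> {1..nrels \<Lambda>}" "v \<in> vsp (direct_sum A B) (kidx \<Lambda> (2 * j - 1))" for j v
    using module_rel[OF A that(1)] module_rel[OF B that(1)] that(2)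
    unfolding path_direct_sum merge_eq_0 vsp_direct_sum by blast
qed

lemma direct_sum_homs:
  assumes "f \<in> homs \<Lambda> A C" "g \<in> homs \<Lambda> B D"
  shows "(\<lambda>i v. merge (f i (left_part v)) (g i (right_part v))) \<in> homs \<Lambda> (direct_sum A B) (direct_sum C D)"
  by (rule homsI) (auto simp: vsp_direct_sum arr_direct_sum homs_arr[OF assms(1)] homs_arr[OF assms(2)]
      homs_closed[OF assms(1)] homs_closed[OF assms(2)]
      intro!: lin_merge lin_comp[OF _ lin_left_part] lin_comp[OF _ lin_right_part] homs_lin[OF assms(1)] homs_lin[OF assms(2)])

lemma left_part_hom: "(\<lambda>i. left_part) \<in> homs \<Lambda> (direct_sum A B) A"
  and right_part_hom: "(\<lambda>i. right_part) \<in> homs \<Lambda> (direct_sum A B) B"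
  by (auto intro!: homsI simp: vsp_direct_sum arr_direct_sum lin_left_part lin_right_part)

lemma pair_hom:
  assumes "f \<in> homs \<Lambda> M A" "g \<in> homs \<Lambda> M B"
  shows "(\<lambda>i v. merge (f i v) (g i v)) \<in> homs \<Lambda> M (direct_sum A B)"
  by (rule homsI) (auto simp: vsp_direct_sum arr_direct_sum homs_arr[OF assms(1)] homs_arr[OF assms(2)]
      homs_closed[OF assms(1)] homs_closed[OF assms(2)]
      intro!: lin_merge homs_lin[OF assms(1)] homs_lin[OF assms(2)])

lemma copair_hom:
  assumes f: "f \<in> homs \<Lambda> A M" and g: "g \<in> homs \<Lambda> B M" and M: "M \<in> modules \<Lambda>"
  shows "(\<lambda>i v. f i (left_part v) + g i (right_part v)) \<in> homs \<Lambda> (direct_sum A B) M"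
proof (rule homsI)
  fix i
  show "lin (\<lambda>v. f i (left_part v) + g i (right_part v))"
    by (intro lin_plus lin_comp[OF homs_lin[OF f] lin_left_part] lin_comp[OF homs_lin[OF g] lin_right_part])
  fix v assume "v \<in> vsp (direct_sum A B) i"
  then have v: "left_part v \<in> vsp A i" "right_part v \<in> vsp B i" by (auto simp: vsp_direct_sum)
  show "f i (left_part v) + g i (right_part v) \<in> vsp M i"
    by (intro amb.subspace_add[OF module_subspace[OF M]] homs_closed[OF f] homs_closed[OF g] v)
  show "f (nxt \<Lambda> i) (left_part (arr (direct_sum A B) i v)) + g (nxt \<Lambda> i) (right_part (arr (direct_sum A B) i v))
      = arr M i (f i (left_part v) + g i (right_part v))"
    by (simp only: arr_direct_sum left_part_merge right_part_merge homs_arr[OF f v(1)] homs_arr[OF g v(2)]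
        lin_add[OF module_lin[OF M]])
qed

lemma zero_hom: "B \<in> modules \<Lambda> \<Longrightarrow> (\<lambda>i v. 0) \<in> homs \<Lambda> A B"
  by (rule homsI) (auto simp: lin_zero module_0 lin_0[OF module_lin])

lemma iso_pair_direct_sum:
  assumes "iso_pair \<Lambda> A C f g" "iso_pair \<Lambda> B D f' g'"
  shows "iso_pair \<Lambda> (direct_sum A B) (direct_sum C D)
    (\<lambda>i v. merge (f i (left_part v)) (f' i (right_part v)))
    (\<lambda>i v. merge (g i (left_part v)) (g' i (right_part v)))"
  using assms unfolding iso_pair_def by (auto simp: direct_sum_homs vsp_direct_sum)

lemma isomorphic_direct_sum:
  assumes "isomorphic \<Lambda> A C" "isomorphic \<Lambda> B D" "A \<in> modules \<Lambda>" "B \<in> modules \<Lambda>"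
  shows "isomorphic \<Lambda> (direct_sum A B) (direct_sum C D)"
  using isomorphicE[OF assms(1,3)] isomorphicE[OF assms(2,4)] isomorphicI[OF iso_pair_direct_sum] by metis

lemma isomorphic_direct_sum_comm: "isomorphic \<Lambda> (direct_sum A B) (direct_sum B A)"
  by (rule isomorphicI[where f = "\<lambda>i v. merge (right_part v) (left_part v)"
        and g = "\<lambda>i v. merge (right_part v) (left_part v)"])
    (auto simp: iso_pair_def vsp_direct_sum intro!: pair_hom left_part_hom right_part_hom)

lemma isomorphic_direct_sum_zero:
  assumes A: "A \<in> modules \<Lambda>" and B: "B \<in> modules \<Lambda>" and z: "zero_rep B"
  shows "isomorphic \<Lambda> (direct_sum A B) A"
proof (rule isomorphicI)
  have "merge (left_part v) 0 = v" if "right_part v = 0" for v :: "'a amb"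
    using merge_parts[of v] that by simp
  then show "iso_pair \<Lambda> (direct_sum A B) A (\<lambda>i. left_part) (\<lambda>i v. merge v 0)"
    using z unfolding zero_rep_def
    by (auto simp: iso_pair_def vsp_direct_sum left_part_hom intro!: pair_hom homs_id zero_hom B)
qed

text \<open>A retraction splits: the component of v in the kernel is \<open>v - g i (f i v)\<close>,
  and adding the two parts inverts the decomposition.\<close>

lemma split_isomorphic:
  assumes M: "M \<in> modules \<Lambda>" and A: "A \<in> modules \<Lambda>"
    and f: "f \<in> homs \<Lambda> M A" and g: "g \<in> homs \<Lambda> A M"
    and fg: "\<And>i v. v \<in> vsp A i \<Longrightarrow> f i (g i v) = v"
  shows "isomorphic \<Lambda> M (direct_sum A (M\<lparr>vsp := kernel_fam M f\<rparr>))"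
proof (rule isomorphicI)
  let ?K = "M\<lparr>vsp := kernel_fam M f\<rparr>"
  have K: "?K \<in> modules \<Lambda>"
    by (intro submodule_module kernel_submodule[OF _ A f] M)
  have gf: "g i (f i v) \<in> vsp M i" if "v \<in> vsp M i" for i v
    using that f g by (simp add: homs_closed)
  have "(\<lambda>i v. v - g i (f i v)) \<in> homs \<Lambda> M ?K"
  proof (rule homsI)
    fix i
    show "lin (\<lambda>v. v - g i (f i v))"
      by (intro lin_minus lin_id lin_comp[OF homs_lin[OF g] homs_lin[OF f]])
    fix v assume v: "v \<in> vsp M i"
    show "v - g i (f i v) \<in> vsp ?K i"
      using amb.subspace_diff[OF module_subspace[OF M] v gf[OF v]] v f
      by (simp add: kernel_fam_def lin_diff[OF homs_lin[OF f]] fg homs_closed del: minus_apply)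
    show "arr M i v - g (nxt \<Lambda> i) (f (nxt \<Lambda> i) (arr M i v)) = arr ?K i (v - g i (f i v))"
      using v f g by (simp add: homs_arr homs_closed lin_diff[OF module_lin[OF M]] del: minus_apply)
  qed
  then have p: "(\<lambda>i v. merge (f i v) (v - g i (f i v))) \<in> homs \<Lambda> M (direct_sum A ?K)"
    by (rule pair_hom[OF f])
  have "(\<lambda>i v. v) \<in> homs \<Lambda> ?K M"
    by (rule homsI) (auto simp: lin_id kernel_fam_def)
  then have q: "(\<lambda>i v. g i (left_part v) + right_part v) \<in> homs \<Lambda> (direct_sum A ?K) M"
    by (rule copair_hom[OF g _ M])
  show "iso_pair \<Lambda> M (direct_sum A ?K) (\<lambda>i v. merge (f i v) (v - g i (f i v)))
      (\<lambda>i v. g i (left_part v) + right_part v)"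
    unfolding iso_pair_def
  proof (intro conjI allI ballI p q)
    fix i w assume w: "w \<in> vsp (direct_sum A ?K) i"
    then have "f i (g i (left_part w) + right_part w) = left_part w"
      by (simp add: lin_add[OF homs_lin[OF f]] vsp_direct_sum kernel_fam_def fg del: plus_fun_apply)
    then show "merge (f i (g i (left_part w) + right_part w))
        (g i (left_part w) + right_part w - g i (f i (g i (left_part w) + right_part w))) = w"
      by (simp del: plus_fun_apply minus_apply)
  qed simp
qed

section \<open>Intervals\<close>

locale nakayama =
  fixes \<Lambda> :: cyclic_quiver_rels
  assumes cyclic: "cyclic_nakayama \<Lambda>"
begin

section \<open>Vertices as residues of integer positions\<close>

abbreviation "\<N> \<equiv> nverts \<Lambda>"

lemma nverts_ge: "\<N> \<ge> 3" and nrels_ge: "nrels \<Lambda> \<ge> 2"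
  using cyclic by (auto simp: cyclic_nakayama_def)

text \<open>Position x lies over vertex x + 1 modulo the number of vertices, since vertices are
  numbered from 1; vertex a thus lies below position a - 1.\<close>

definition vt :: "int \<Rightarrow> nat" where "vt x = nat (x mod int \<N>) + 1"

lemma vt_verts [simp]: "vt x \<in> verts \<Lambda>"
proof -
  have "0 \<le> x mod int \<N>" "x mod int \<N> < int \<N>" using nverts_ge by auto
  then show ?thesis unfolding vt_def verts_def by auto
qed

lemma vt_eq_iff: "vt x = vt y \<longleftrightarrow> x mod int \<N> = y mod int \<N>"
  using nverts_ge unfolding vt_def by (simp add: nat_eq_iff)

lemma nxt_vt: "nxt \<Lambda> (vt x) = vt (x + 1)"
proof -
  have "int (vt x) mod int \<N> = (x + 1) mod int \<N>"
    using nverts_ge by (simp add: vt_def mod_simps add.commute)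
  then show ?thesis unfolding nxt_def vt_def[of "x + 1"] by (metis nat_int zmod_int)
qed

lemma vt_surj: "a \<in> verts \<Lambda> \<Longrightarrow> a = vt (int a - 1)"
  by (auto simp: verts_def vt_def)

lemma nxt_pow_vt: "(nxt \<Lambda> ^^ l) (vt x) = vt (x + int l)"
  by (induction l) (auto simp: nxt_vt algebra_simps)

lemma nxt_verts [simp]: "nxt \<Lambda> i \<in> verts \<Lambda>"
  using nverts_ge by (auto simp: nxt_def verts_def Suc_le_eq)

lemma nxt_pow_verts [simp]: "a \<in> verts \<Lambda> \<Longrightarrow> (nxt \<Lambda> ^^ l) a \<in> verts \<Lambda>"
  by (cases l) auto

lemma nxt_inj: "i \<in> verts \<Lambda> \<Longrightarrow> j \<in> verts \<Lambda> \<Longrightarrow> nxt \<Lambda> i = nxt \<Lambda> j \<longleftrightarrow> i = j"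
proof -
  assume "i \<in> verts \<Lambda>" "j \<in> verts \<Lambda>"
  then obtain x y where xy: "i = vt x" "j = vt y" using vt_surj by blast
  have "x mod int \<N> = y mod int \<N>" if "(x + 1) mod int \<N> = (y + 1) mod int \<N>"
    using mod_diff_cong[OF that refl, of 1] by simp
  moreover have "(x + 1) mod int \<N> = (y + 1) mod int \<N>" if "x mod int \<N> = y mod int \<N>"
    using mod_add_cong[OF that refl] .
  ultimately show ?thesis by (auto simp: xy nxt_vt vt_eq_iff)
qed

lemma nxt_surj:
  assumes "i \<in> verts \<Lambda>" obtains j where "j \<in> verts \<Lambda>" "nxt \<Lambda> j = i"
proof
  show "nxt \<Lambda> (vt (int i - 2)) = i"
    using vt_surj[OF assms] by (simp add: nxt_vt)
qed auto

lemma nxt_pow_reach: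
  assumes "a \<in> verts \<Lambda>" "b \<in> verts \<Lambda>" obtains l where "(nxt \<Lambda> ^^ l) a = b"
proof -
  have "(nxt \<Lambda> ^^ nat ((int b - int a) mod int \<N>)) a = b"
    using assms nverts_ge
    by (subst (1) vt_surj[OF assms(1)], subst (2) vt_surj[OF assms(2)])
      (simp add: nxt_pow_vt vt_eq_iff mod_simps)
  then show thesis by (rule that)
qed

section \<open>Zero paths and the lengths of the projectives\<close>

lemma rel_facts:
  assumes "j \<in> {1..nrels \<Lambda>}"
  shows "rlen \<Lambda> j \<ge> 2" "kidx \<Lambda> (2 * j - 1) \<in> verts \<Lambda>"
    "kidx \<Lambda> (2 * j) = (nxt \<Lambda> ^^ (rlen \<Lambda> j - 1)) (kidx \<Lambda> (2 * j - 1))"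
proof -
  have "2 * j - 1 \<in> {1..2 * nrels \<Lambda>}" using assms by auto
  then show "rlen \<Lambda> j \<ge> 2" "kidx \<Lambda> (2 * j - 1) \<in> verts \<Lambda>"
    "kidx \<Lambda> (2 * j) = (nxt \<Lambda> ^^ (rlen \<Lambda> j - 1)) (kidx \<Lambda> (2 * j - 1))"
    using assms cyclic unfolding cyclic_nakayama_def by blast+
qed

lemma zero_path_iff: "zero_path \<Lambda> (a, l) \<longleftrightarrow>
  (\<exists>j\<in>{1..nrels \<Lambda>}. \<exists>x. x + rlen \<Lambda> j \<le> l \<and> (nxt \<Lambda> ^^ x) a = kidx \<Lambda> (2 * j - 1))"
  by (auto simp: zero_path_def path_in_ideal_def rel_path_def)

text \<open>The length of the shortest zero path from a, which is the length of the indecomposable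
  projective with top at a.\<close>

definition plen :: "nat \<Rightarrow> nat" where "plen a = (LEAST l. zero_path \<Lambda> (a, l))"

text \<open>Some zero path exists at every vertex: walk to the start of the first relation and
  follow it. Prolonging a zero path keeps it zero, so the shortest one decides.\<close>

lemma zero_path_plen:
  assumes "a \<in> verts \<Lambda>" shows "zero_path \<Lambda> (a, l) \<longleftrightarrow> plen a \<le> l"
proof -
  have one: "1 \<in> {1..nrels \<Lambda>}" using nrels_ge by auto
  obtain x where "(nxt \<Lambda> ^^ x) a = kidx \<Lambda> (2 * 1 - 1)"
    using nxt_pow_reach[OF assms rel_facts(2)[OF one]] .
  then have "zero_path \<Lambda> (a, x + rlen \<Lambda> 1)"
    unfolding zero_path_iff using one by blast
  then have "zero_path \<Lambda> (a, plen a)"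
    unfolding plen_def by (rule LeastI)
  then have "zero_path \<Lambda> (a, l)" if "plen a \<le> l"
    using that unfolding zero_path_iff by (meson order_trans)
  moreover have "plen a \<le> l" if "zero_path \<Lambda> (a, l)"
    using that unfolding plen_def by (rule Least_le)
  ultimately show ?thesis by blast
qed

lemma plen_ge: "a \<in> verts \<Lambda> \<Longrightarrow> plen a \<ge> 2"
  using zero_path_plen[of a "plen a"] rel_facts(1) by (fastforce simp: zero_path_iff)

lemma zero_path_nxt: "zero_path \<Lambda> (nxt \<Lambda> a, l) \<Longrightarrow> zero_path \<Lambda> (a, Suc l)"
  unfolding zero_path_iff by (metis Suc_le_mono add_Suc funpow_Suc_right comp_apply)

text \<open>A zero path remains zero when an arrow is put in front of it. On the universal cover
  this becomes the monotonicity of \<open>e\<close>.\<close>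

lemma plen_nxt: "a \<in> verts \<Lambda> \<Longrightarrow> plen a \<le> Suc (plen (nxt \<Lambda> a))"
  using zero_path_nxt[of a "plen (nxt \<Lambda> a)"] zero_path_plen by simp

section \<open>Interval modules and their morphisms\<close>

definition ivs :: "nat \<Rightarrow> nat \<Rightarrow> nat \<Rightarrow> (nat \<times> nat) set" where
  "ivs a n i = {(0, l) |l. l < n \<and> (nxt \<Lambda> ^^ l) a = i}"

text \<open>The basis vector \<open>unit_vec (0, l)\<close> sits at the vertex l steps after a. The
  arrow maps shift by one and need not look at the vertex, since the subspaces already separate the
  coordinates by vertex.\<close>

definition Ivl :: "nat \<Rightarrow> nat \<Rightarrow> 'k::field rep" where
  "Ivl a n = \<lparr>vsp = (\<lambda>i. supp (ivs a n i)),
     arr = (\<lambda>i v (x, l). if x = 0 \<and> 0 < l \<and> l < n then v (0, l - 1) else 0)\<rparr>"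

lemma finite_ivs [simp]: "finite (ivs a n i)"
  by (rule finite_subset[of _ "{0} \<times> {..<n}"]) (auto simp: ivs_def)

lemma mem_ivs [simp]: "(x, l) \<in> ivs a n i \<longleftrightarrow> x = 0 \<and> l < n \<and> (nxt \<Lambda> ^^ l) a = i"
  by (auto simp: ivs_def)

lemma vsp_Ivl: "vsp (Ivl a n) i = supp (ivs a n i)"
  by (simp add: Ivl_def)

lemma arr_Ivl: "arr (Ivl a n) i v (x, l) = (if x = 0 \<and> 0 < l \<and> l < n then v (0, l - 1) else 0)"
  by (simp add: Ivl_def)

lemma lin_arr_Ivl: "lin (arr (Ivl a n) i)"
  by (rule linI) (auto simp: fun_eq_iff arr_Ivl scal_apply)

lemma path_Ivl:
  assumes "v \<in> supp ({0} \<times> {..<n})"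
  shows "path_map \<Lambda> (Ivl a n) i k v (x, l) = (if x = 0 \<and> k \<le> l \<and> l < n then v (0, l - k) else 0)"
proof (induction k arbitrary: l)
  case 0
  then show ?case using assms by (auto simp: supp_def)
next
  case (Suc k)
  then show ?case by (auto simp: arr_Ivl)
qed

lemma vsp_Ivl_supp: "v \<in> vsp (Ivl a n) i \<Longrightarrow> v \<in> supp ({0} \<times> {..<n})"
  unfolding vsp_Ivl by (rule subsetD[OF supp_mono]) auto

lemma supp_mem: "v \<in> supp S \<Longrightarrow> v p \<noteq> 0 \<Longrightarrow> p \<in> S"
  by (cases p) (simp add: supp_def)

lemma suppI: "(\<And>x l. v (x, l) \<noteq> 0 \<Longrightarrow> (x, l) \<in> S) \<Longrightarrow> v \<in> supp S"
  by (auto simp: supp_def)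

lemma path_Ivl_unit:
  assumes "l < n"
  shows "path_map \<Lambda> (Ivl a n) i k (unit_vec (0, l) :: 'k::field amb) = (if l + k < n then unit_vec (0, l + k) else 0)"
proof (rule ext)
  fix p :: "nat \<times> nat"
  obtain x m where p: "p = (x, m)" by (cases p)
  have "(unit_vec (0, l) :: 'k amb) \<in> supp ({0} \<times> {..<n})" using assms by auto
  from path_Ivl[OF this]
  show "path_map \<Lambda> (Ivl a n) i k (unit_vec (0, l) :: 'k amb) p = (if l + k < n then unit_vec (0, l + k) else 0) p"
    unfolding p by (auto simp: unit_vec_apply)
qed

lemma arr_Ivl_unit:
  assumes "l < n"
  shows "arr (Ivl a n) i (unit_vec (0, l) :: 'k::field amb) = (if Suc l < n then unit_vec (0, Suc l) else 0)"
proof -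
  have "arr (Ivl a n) i (unit_vec (0, l) :: 'k amb) = path_map \<Lambda> (Ivl a n) i 1 (unit_vec (0, l))" by simp
  then show ?thesis unfolding path_Ivl_unit[OF assms] by simp
qed

lemma Ivl_module:
  assumes a: "a \<in> verts \<Lambda>" and n: "n \<le> plen a"
  shows "Ivl a n \<in> modules \<Lambda>"
proof (rule moduleI)
  fix i
  show "amb.subspace (vsp (Ivl a n) i)" by (simp add: vsp_Ivl subspace_supp)
  show "\<exists>B. finite B \<and> vsp (Ivl a n) i \<subseteq> amb.span B"
    unfolding vsp_Ivl by (intro exI[of _ "unit_vec ` ivs a n i"]) (simp add: span_unit_vec)
  show "vsp (Ivl a n) i = {0}" if "i \<notin> verts \<Lambda>"
  proof -
    have "ivs a n i = {}" using a that by (auto simp: ivs_def)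
    then show ?thesis by (simp add: vsp_Ivl)
  qed
  show "lin (arr (Ivl a n) i)" by (rule lin_arr_Ivl)
  show "arr (Ivl a n) i v \<in> vsp (Ivl a n) (nxt \<Lambda> i)" if "v \<in> vsp (Ivl a n) i" for v
    unfolding vsp_Ivl
  proof (rule suppI)
    fix x l assume "arr (Ivl a n) i v (x, l) \<noteq> 0"
    then have *: "x = 0" "0 < l" "l < n" "v (0, l - 1) \<noteq> 0" by (auto simp: arr_Ivl split: if_splits)
    then have "(nxt \<Lambda> ^^ (l - 1)) a = i" using that supp_mem[of v] unfolding vsp_Ivl by fastforce
    then have "(nxt \<Lambda> ^^ Suc (l - 1)) a = nxt \<Lambda> i" by simp
    then show "(x, l) \<in> ivs a n (nxt \<Lambda> i)" using * by simp
  qed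
  show "path_map \<Lambda> (Ivl a n) (kidx \<Lambda> (2 * j - 1)) (rlen \<Lambda> j) v = 0"
    if j: "j \<in> {1..nrels \<Lambda>}" and v: "v \<in> vsp (Ivl a n) (kidx \<Lambda> (2 * j - 1))" for j v
  proof (rule ext)
    fix p :: "nat \<times> nat"
    obtain x l where p: "p = (x, l)" by (cases p)
    \<comment> \<open>A nonzero coordinate would place the relation inside the path of length l from
      a, although l < plen a.\<close>
    have "v (0, l - rlen \<Lambda> j) = 0" if "rlen \<Lambda> j \<le> l" "l < n"
    proof (rule ccontr)
      assume "v (0, l - rlen \<Lambda> j) \<noteq> 0"
      then have "(nxt \<Lambda> ^^ (l - rlen \<Lambda> j)) a = kidx \<Lambda> (2 * j - 1)"
        using v supp_mem[of v] unfolding vsp_Ivl by fastforce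
      then have "zero_path \<Lambda> (a, l)"
        unfolding zero_path_iff using j that(1)
        by (intro bexI[of _ j] exI[of _ "l - rlen \<Lambda> j"]) auto
      then show False using zero_path_plen[OF a] n that(2) by simp
    qed
    then show "path_map \<Lambda> (Ivl a n) (kidx \<Lambda> (2 * j - 1)) (rlen \<Lambda> j) v p = 0 p"
      unfolding p path_Ivl[OF vsp_Ivl_supp[OF v]] by simp
  qed
qed

text \<open>The morphism from the interval that sends the generator \<open>unit_vec (0, 0)\<close>
  to v, and hence the l-th basis vector to the image of v under the path of length l.\<close>

definition gen_hom :: "'k::field rep \<Rightarrow> nat \<Rightarrow> nat \<Rightarrow> 'k amb \<Rightarrow> nat \<Rightarrow> 'k amb \<Rightarrow> 'k amb" where
  "gen_hom M a n v i w = (\<Sum>l<n. scal (w (0, l)) (path_map \<Lambda> M a l v))"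

lemma lin_gen_hom: "lin (gen_hom M a n v i)"
  unfolding gen_hom_def[abs_def] by (intro lin_setsum lin_coord_scal)

lemma gen_hom_unit: "l < n \<Longrightarrow> gen_hom M a n v i (unit_vec (0, l)) = path_map \<Lambda> M a l v"
proof -
  assume l: "l < n"
  have "gen_hom M a n v i (unit_vec (0, l)) = (\<Sum>m<n. if l = m then path_map \<Lambda> M a m v else 0)"
    unfolding gen_hom_def by (rule sum.cong) (auto simp: unit_vec_apply)
  then show ?thesis using l by simp
qed

text \<open>An interval is generated by its top, with the single defining relation that the path of
  length n vanishes on it.\<close>

lemma gen_hom:
  fixes M :: "'k::field rep"
  assumes M: "M \<in> modules \<Lambda>" and v: "v \<in> vsp M a" and z: "path_map \<Lambda> M a n v = 0"
  shows "gen_hom M a n v \<in> homs \<Lambda> (Ivl a n) M"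
proof (rule homsI)
  fix i
  show "lin (gen_hom M a n v i)" by (rule lin_gen_hom)
  fix w :: "'k amb" assume w: "w \<in> vsp (Ivl a n) i"
  show "gen_hom M a n v i w \<in> vsp M i"
    unfolding gen_hom_def
  proof (rule amb.subspace_sum[OF module_subspace[OF M]])
    fix l assume "l \<in> {..<n}"
    show "scal (w (0, l)) (path_map \<Lambda> M a l v) \<in> vsp M i"
    proof (cases "w (0, l) = 0")
      case False
      then have "(nxt \<Lambda> ^^ l) a = i" using w supp_mem[of w] unfolding vsp_Ivl by fastforce
      then show ?thesis
        using amb.subspace_scale[OF module_subspace[OF M]] path_map_closed[OF M v, of l] by simp
    qed (simp add: module_0[OF M])
  qed
  show "gen_hom M a n v (nxt \<Lambda> i) (arr (Ivl a n) i w) = arr M i (gen_hom M a n v i w)"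
  proof (rule lin_eq_on_supp[of "\<lambda>w. gen_hom M a n v (nxt \<Lambda> i) (arr (Ivl a n) i w)" _ "ivs a n i" w])
    show "lin (\<lambda>w. gen_hom M a n v (nxt \<Lambda> i) (arr (Ivl a n) i w))"
      by (rule lin_comp[OF lin_gen_hom lin_arr_Ivl])
    show "lin (\<lambda>w. arr M i (gen_hom M a n v i w))"
      by (rule lin_comp[OF module_lin[OF M] lin_gen_hom])
    fix p assume "p \<in> ivs a n i"
    then obtain l where p: "p = (0, l)" "l < n" "(nxt \<Lambda> ^^ l) a = i" by (auto simp: ivs_def)
    have "gen_hom M a n v (nxt \<Lambda> i) 0 = 0" by (rule lin_0[OF lin_gen_hom])
    \<comment> \<open>The last basis vector is where the hypothesis on the path of length n
      enters.\<close>
    moreover have "arr M i (path_map \<Lambda> M a l v) = 0" if "\<not> Suc l < n"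
    proof -
      have "Suc l = n" using that p by simp
      then show ?thesis using z p(3) by auto
    qed
    ultimately show "gen_hom M a n v (nxt \<Lambda> i) (arr (Ivl a n) i (unit_vec p)) = arr M i (gen_hom M a n v i (unit_vec p))"
      using p z by (auto simp: arr_Ivl_unit gen_hom_unit)
  qed (use w in \<open>auto simp: vsp_Ivl\<close>)
qed

lemma hom_Ivl_unit:
  assumes a: "a \<in> verts \<Lambda>" "n \<le> plen a" and h: "h \<in> homs \<Lambda> (Ivl a n) M" and l: "l < n"
  shows "h ((nxt \<Lambda> ^^ l) a) (unit_vec (0, l)) = path_map \<Lambda> M a l (h a (unit_vec (0, 0)))"
proof -
  have "unit_vec (0, 0) \<in> vsp (Ivl a n) a" using l by (simp add: vsp_Ivl)
  from homs_path[OF Ivl_module[OF a] h this, of l] show ?thesis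
    using l by (simp add: path_Ivl_unit)
qed

lemma hom_Ivl_eqI:
  assumes lin: "\<And>i. lin (f i)" "\<And>i. lin (g i)" and w: "w \<in> vsp (Ivl a n) i"
    and eq: "\<And>l. l < n \<Longrightarrow> f ((nxt \<Lambda> ^^ l) a) (unit_vec (0, l)) = g ((nxt \<Lambda> ^^ l) a) (unit_vec (0, l))"
  shows "f i w = g i w"
  by (rule lin_eq_on_supp[OF lin, of "ivs a n i"]) (use w eq in \<open>auto simp: ivs_def vsp_Ivl\<close>)

text \<open>Dual to \<open>gen_hom\<close>: the l-th coordinate of the image is found by following
  the n - 1 - l arrows left to the socle and applying the functional u there.\<close>

definition cogen_hom :: "'k::field rep \<Rightarrow> nat \<Rightarrow> nat \<Rightarrow> ('k amb \<Rightarrow> 'k) \<Rightarrow> nat \<Rightarrow> 'k amb \<Rightarrow> 'k amb" where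
  "cogen_hom M a n u i v = (\<lambda>(x, l). if x = 0 \<and> l < n \<and> (nxt \<Lambda> ^^ l) a = i
     then u (path_map \<Lambda> M i (n - 1 - l) v) else 0)"

lemma cogen_hom:
  assumes a: "a \<in> verts \<Lambda>" and M: "M \<in> modules \<Lambda>" and u: "Vector_Spaces.linear scal (*) u"
    and z: "\<And>i v. v \<in> vsp M i \<Longrightarrow> path_map \<Lambda> M i n v = 0"
  shows "cogen_hom M a n u \<in> homs \<Lambda> M (Ivl a n)"
proof (rule homsI)
  fix i
  have pl: "lin (path_map \<Lambda> M i l)" for l by (rule module_path_lin[OF M])
  show "lin (cogen_hom M a n u i)"
  proof (rule linI; rule ext)
    fix x y :: "'a amb" and c and p :: "nat \<times> nat"
    show "cogen_hom M a n u i (x + y) p = (cogen_hom M a n u i x + cogen_hom M a n u i y) p"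
      unfolding cogen_hom_def plus_fun_apply lin_add[OF pl] lf.linear_add[OF u] by (cases p) simp
    show "cogen_hom M a n u i (scal c x) p = (scal c (cogen_hom M a n u i x)) p"
      unfolding cogen_hom_def scal_apply lin_scal[OF pl] lf.linear_scale[OF u] by (cases p) simp
  qed
  fix v assume v: "v \<in> vsp M i"
  show "cogen_hom M a n u i v \<in> vsp (Ivl a n) i"
    unfolding vsp_Ivl by (rule suppI) (auto simp: cogen_hom_def split: if_splits)
  show "cogen_hom M a n u (nxt \<Lambda> i) (arr M i v) = arr (Ivl a n) i (cogen_hom M a n u i v)"
  proof (cases "i \<in> verts \<Lambda>")
    case False
    then have "v = 0" using v module_outside[OF M] by auto
    have "cogen_hom M a n u j 0 = 0" for j
      unfolding cogen_hom_def lin_0[OF module_path_lin[OF M]] lf.linear_0[OF u] by (auto simp: fun_eq_iff)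
    with \<open>v = 0\<close> show ?thesis
      by (simp only: lin_0[OF module_lin[OF M]] lin_0[OF lin_arr_Ivl])
  next
    case i: True
    show ?thesis
    proof (rule ext)
      fix p :: "nat \<times> nat"
      obtain x l where p: "p = (x, l)" by (cases p)
      show "cogen_hom M a n u (nxt \<Lambda> i) (arr M i v) p = arr (Ivl a n) i (cogen_hom M a n u i v) p"
      proof (cases l)
        case 0
        \<comment> \<open>The image of an arrow of the interval has no coordinate 0; on the other
          side that coordinate is u of a path of length n, which vanishes by
          \<open>z\<close>.\<close>
        have "path_map \<Lambda> M (nxt \<Lambda> i) (n - 1) (arr M i v) = 0" if "n > 0"
          using z[OF v] that path_map_Suc_left[of \<Lambda> M i "n - 1" v] by simp
        then show ?thesis unfolding p 0 by (auto simp: cogen_hom_def arr_Ivl lf.linear_0[OF u])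
      next
        case (Suc m)
        have "path_map \<Lambda> M (nxt \<Lambda> i) (n - 1 - l) (arr M i v) = path_map \<Lambda> M i (n - 1 - m) v" if "l < n"
          using that Suc path_map_Suc_left[of \<Lambda> M i "n - 1 - l" v] by (simp add: Suc_diff_Suc)
        moreover have "(nxt \<Lambda> ^^ l) a = nxt \<Lambda> i \<longleftrightarrow> (nxt \<Lambda> ^^ m) a = i"
          using Suc i a by (simp add: nxt_inj)
        ultimately show ?thesis
          unfolding p using Suc by (auto simp: cogen_hom_def arr_Ivl)
      qed
    qed
  qed
qed

end

section \<open>Rank functions\<close>

lemma dim_inj_image:
  assumes f: "lin f" and V: "amb.subspace V" and inj: "inj_on f V"
  shows "amb.dim (f ` V) = amb.dim V"
proof -
  obtain B where B: "B \<subseteq> V" "amb.independent B" "V \<subseteq> amb.span B" "card B = amb.dim V"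
    using amb.basis_exists by blast
  have sp: "amb.span B = V" using B V by (simp add: amb.span_subspace)
  have "amb.independent (f ` B)"
    using lp.linear_independent_injective_image[OF f B(2)] inj sp by simp
  moreover have "amb.span (f ` B) = f ` V"
    using lp.linear_span_image[OF f, of B] sp by simp
  ultimately have "amb.dim (f ` V) = card (f ` B)"
    by (metis amb.dim_span_eq_card_independent)
  then show ?thesis using B card_image inj_on_subset[OF inj B(1)] by metis
qed

lemma finite_basis:
  assumes "amb.subspace V" "finite S" "V \<subseteq> amb.span S"
  obtains B where "finite B" "amb.independent B" "amb.span B = V" "card B = amb.dim V"
proof -
  obtain B where B: "B \<subseteq> V" "amb.independent B" "V \<subseteq> amb.span B" "card B = amb.dim V"
    using amb.basis_exists by blast
  then have "finite B" using amb.independent_span_bound[OF assms(2)] assms(3) by blast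
  then show thesis using that B assms(1) by (metis amb.span_subspace)
qed

text \<open>This is behind the additivity of ranks: bases of V and W, embedded into the two halves
  of the index set, together form a basis.\<close>

lemma dim_merge:
  fixes V W :: "'k::field amb set"
  assumes V: "amb.subspace V" "finite S" "V \<subseteq> amb.span S"
    and W: "amb.subspace W" "finite T" "W \<subseteq> amb.span T"
  shows "amb.dim {merge a b |a b. a \<in> V \<and> b \<in> W} = amb.dim V + amb.dim W"
proof -
  obtain B where B: "finite B" "amb.independent B" "amb.span B = V" "card B = amb.dim V"
    using finite_basis[OF V] .
  obtain C where C: "finite C" "amb.independent C" "amb.span C = W" "card C = amb.dim W"
    using finite_basis[OF W] .
  define l r where "l = (\<lambda>a :: 'k amb. merge a 0)" and "r = (\<lambda>b :: 'k amb. merge 0 b)"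
  have lin: "lin l" "lin r" unfolding l_def r_def by (intro lin_merge lin_id lin_zero)+
  have inj: "inj l" "inj r"
    unfolding l_def r_def by (metis injI left_part_merge) (metis injI right_part_merge)
  have disj: "l ` B \<inter> r ` C = {}"
  proof -
    have "a = 0" if "l a = r b" for a b
      using arg_cong[OF that, of left_part] by (simp add: l_def r_def)
    moreover have "0 \<notin> B" using B(2) amb.dependent_zero by blast
    ultimately show ?thesis by auto
  qed
  have ind: "amb.independent (l ` B \<union> r ` C)"
  proof (rule amb.independent_if_scalars_zero)
    fix f :: "'k amb \<Rightarrow> 'k" and x
    assume s: "(\<Sum>x\<in>l ` B \<union> r ` C. scal (f x) x) = 0" and x: "x \<in> l ` B \<union> r ` C"
    have "(\<Sum>x\<in>l ` B \<union> r ` C. scal (f x) x) = (\<Sum>x\<in>l ` B. scal (f x) x) + (\<Sum>x\<in>r ` C. scal (f x) x)"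
      using B C disj by (simp add: sum.union_disjoint del: plus_fun_apply)
    also have "(\<Sum>x\<in>l ` B. scal (f x) x) = (\<Sum>b\<in>B. scal (f (l b)) (l b))"
      by (simp add: sum.reindex inj_on_subset[OF inj(1)])
    also have "\<dots> = l (\<Sum>b\<in>B. scal (f (l b)) b)"
      by (simp add: lin_sum[OF lin(1)] lin_scal[OF lin(1)])
    also have "(\<Sum>x\<in>r ` C. scal (f x) x) = (\<Sum>b\<in>C. scal (f (r b)) (r b))"
      by (simp add: sum.reindex inj_on_subset[OF inj(2)])
    also have "\<dots> = r (\<Sum>b\<in>C. scal (f (r b)) b)"
      by (simp add: lin_sum[OF lin(2)] lin_scal[OF lin(2)])
    finally have "merge (\<Sum>b\<in>B. scal (f (l b)) b) (\<Sum>b\<in>C. scal (f (r b)) b) = 0"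
      using s by (simp add: l_def r_def merge_add[symmetric] del: plus_fun_apply)
    then have "(\<Sum>b\<in>B. scal (f (l b)) b) = 0" "(\<Sum>b\<in>C. scal (f (r b)) b) = 0"
      by (auto simp: merge_eq_0)
    then have "\<forall>b\<in>B. f (l b) = 0" "\<forall>b\<in>C. f (r b) = 0"
      using amb.independentD[OF B(2) B(1) subset_refl, of "\<lambda>b. f (l b)"]
        amb.independentD[OF C(2) C(1) subset_refl, of "\<lambda>b. f (r b)"] by blast+
    then show "f x = 0" using x by auto
  qed (use B C in auto)
  have "amb.span (l ` B \<union> r ` C) = {x + y |x y. x \<in> l ` V \<and> y \<in> r ` W}"
    unfolding amb.span_Un lp.linear_span_image[OF lin(1)] lp.linear_span_image[OF lin(2)] B C ..
  also have "\<dots> = {merge a b |a b. a \<in> V \<and> b \<in> W}"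
  proof -
    have "l a + r b = merge a b" for a b
      by (simp add: l_def r_def merge_add[symmetric] del: plus_fun_apply)
    then show ?thesis by (auto simp del: plus_fun_apply) (metis imageI)
  qed
  finally have "amb.dim {merge a b |a b. a \<in> V \<and> b \<in> W} = card (l ` B \<union> r ` C)"
    using amb.dim_span_eq_card_independent[OF ind] by simp
  also have "\<dots> = card B + card C"
    using B C disj by (simp add: card_Un_disjoint card_image inj_on_subset[OF inj(1)] inj_on_subset[OF inj(2)])
  finally show ?thesis using B C by simp
qed

text \<open>The rank of the path of length l from s on M. These ranks are isomorphism invariants,
  add up over direct sums, and suffice to count the interval summands of M.\<close>

definition rk :: "cyclic_quiver_rels \<Rightarrow> nat \<Rightarrow> nat \<Rightarrow> 'k::field rep \<Rightarrow> nat" where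
  "rk \<Lambda> s l M = amb.dim (path_map \<Lambda> M s l ` vsp M s)"

lemma path_image_subspace:
  "M \<in> modules \<Lambda> \<Longrightarrow> amb.subspace (path_map \<Lambda> M s l ` vsp M s)"
  by (rule lp.linear_subspace_image[OF module_path_lin module_subspace])

lemma path_image_closed:
  "M \<in> modules \<Lambda> \<Longrightarrow> path_map \<Lambda> M s l ` vsp M s \<subseteq> vsp M ((nxt \<Lambda> ^^ l) s)"
  using path_map_closed by blast

lemma rk_iso:
  assumes M: "M \<in> modules \<Lambda>" and i: "isomorphic \<Lambda> M N"
  shows "rk \<Lambda> s l M = rk \<Lambda> s l N"
proof -
  obtain f where f: "f \<in> homs \<Lambda> M N" "\<And>i. bij_betw (f i) (vsp M i) (vsp N i)"
    using i by (auto simp: isomorphic_def)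
  let ?t = "(nxt \<Lambda> ^^ l) s"
  have "path_map \<Lambda> N s l ` vsp N s = path_map \<Lambda> N s l ` f s ` vsp M s"
    using f(2)[of s] by (simp add: bij_betw_def)
  also have "\<dots> = f ?t ` path_map \<Lambda> M s l ` vsp M s"
    unfolding image_image by (rule image_cong) (simp_all add: homs_path[OF M f(1)])
  finally have eq: "path_map \<Lambda> N s l ` vsp N s = f ?t ` path_map \<Lambda> M s l ` vsp M s" .
  have inj: "inj_on (f ?t) (path_map \<Lambda> M s l ` vsp M s)"
    using f(2)[of ?t] path_image_closed[OF M] by (meson bij_betw_def inj_on_subset)
  show ?thesis
    unfolding rk_def eq using dim_inj_image[OF homs_lin[OF f(1)] path_image_subspace[OF M] inj] by simp
qed

lemma rk_direct_sum:
  assumes A: "A \<in> modules \<Lambda>" and B: "B \<in> modules \<Lambda>"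
  shows "rk \<Lambda> s l (direct_sum A B) = rk \<Lambda> s l A + rk \<Lambda> s l B"
proof -
  let ?V = "path_map \<Lambda> A s l ` vsp A s" and ?W = "path_map \<Lambda> B s l ` vsp B s"
  have "path_map \<Lambda> (direct_sum A B) s l ` vsp (direct_sum A B) s = {merge a b |a b. a \<in> ?V \<and> b \<in> ?W}"
  proof (intro equalityI subsetI)
    fix v assume "v \<in> {merge a b |a b. a \<in> ?V \<and> b \<in> ?W}"
    then obtain x y where xy: "x \<in> vsp A s" "y \<in> vsp B s" "v = merge (path_map \<Lambda> A s l x) (path_map \<Lambda> B s l y)"
      by blast
    then show "v \<in> path_map \<Lambda> (direct_sum A B) s l ` vsp (direct_sum A B) s"
      by (intro image_eqI[of _ _ "merge x y"]) (auto simp: path_direct_sum vsp_direct_sum)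
  next
    fix v assume "v \<in> path_map \<Lambda> (direct_sum A B) s l ` vsp (direct_sum A B) s"
    then obtain x where x: "left_part x \<in> vsp A s" "right_part x \<in> vsp B s"
      and v: "v = merge (path_map \<Lambda> A s l (left_part x)) (path_map \<Lambda> B s l (right_part x))"
      by (auto simp: path_direct_sum vsp_direct_sum)
    show "v \<in> {merge a b |a b. a \<in> ?V \<and> b \<in> ?W}"
      unfolding v
      by (rule CollectI, rule exI[of _ "path_map \<Lambda> A s l (left_part x)"],
          rule exI[of _ "path_map \<Lambda> B s l (right_part x)"]) (simp add: x)
  qed
  moreover obtain S where S: "finite S" "vsp A ((nxt \<Lambda> ^^ l) s) \<subseteq> amb.span S" using module_fin[OF A] by meson
  moreover obtain T where T: "finite T" "vsp B ((nxt \<Lambda> ^^ l) s) \<subseteq> amb.span T" using module_fin[OF B] by meson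
  ultimately show ?thesis
    unfolding rk_def
    using dim_merge[OF path_image_subspace[OF A] S(1) _ path_image_subspace[OF B] T(1), of s l s l]
      path_image_closed[OF A, of s l] path_image_closed[OF B, of s l]
    by (metis (no_types, lifting) order_trans)
qed

lemma submodule_path:
  "W \<in> submodules \<Lambda> M \<Longrightarrow> v \<in> W i \<Longrightarrow> path_map \<Lambda> M i l v \<in> W ((nxt \<Lambda> ^^ l) i)"
  by (induction l) (auto simp: submodules_def image_subset_iff)

section \<open>Submodules of intervals, ranks of paths and multiplicities\<close>

context nakayama
begin

lemma Ivl_mem: "v \<in> vsp (Ivl a n) i \<Longrightarrow> v (x, l) \<noteq> 0 \<Longrightarrow> x = 0 \<and> l < n \<and> (nxt \<Lambda> ^^ l) a = i"
  unfolding vsp_Ivl using supp_mem[of v "ivs a n i" "(x, l)"] by simp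

text \<open>This is what makes intervals uniserial: a vector with leading coordinate k generates
  everything from k on. Since a winding interval has several coordinates at one vertex, a single
  shift does not isolate a basis vector, and the higher terms are removed by induction from the
  socle upwards.\<close>

lemma Ivl_submodule:
  fixes W :: "nat \<Rightarrow> 'k::field amb set"
  assumes a: "a \<in> verts \<Lambda>" "n \<le> plen a"
    and W: "W \<in> submodules \<Lambda> (Ivl a n)" and w: "w \<in> W i" "w (0, k) \<noteq> 0" "\<And>l. l < k \<Longrightarrow> w (0, l) = 0"
    and x: "x \<in> vsp (Ivl a n) j" "\<And>l. l < k \<Longrightarrow> x (0, l) = 0"
  shows "x \<in> W j"
proof -
  have sub: "amb.subspace (W i)" and le: "W i \<subseteq> vsp (Ivl a n) i" for i
    using W by (auto simp: submodules_def)
  have wv: "w \<in> vsp (Ivl a n) i" using w le by blast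
  then have k: "k < n" "(nxt \<Lambda> ^^ k) a = i"
    using Ivl_mem w(2) by blast+
  have span: "y \<in> W t" if "y \<in> vsp (Ivl a n) t" "\<And>m. y (0, m) \<noteq> 0 \<Longrightarrow> (unit_vec (0, m) :: 'k amb) \<in> W t"
    for y t
  proof -
    have "y = (\<Sum>p\<in>ivs a n t. scal (y p) (unit_vec p))"
      using that(1) by (intro supp_expand) (auto simp: vsp_Ivl)
    moreover have "scal (y p) (unit_vec p) \<in> W t" if "p \<in> ivs a n t" for p
    proof (cases "y p = 0")
      case True
      then show ?thesis using amb.subspace_0[OF sub] by simp
    next
      case False
      then show ?thesis
        using that(1) \<open>\<And>m. y (0, m) \<noteq> 0 \<Longrightarrow> (unit_vec (0, m) :: 'k amb) \<in> W t\<close>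
        by (auto simp: ivs_def intro!: amb.subspace_scale[OF sub])
    qed
    ultimately show ?thesis by (metis (no_types, lifting) amb.subspace_sum[OF sub])
  qed
  have unit: "(unit_vec (0, l) :: 'k amb) \<in> W ((nxt \<Lambda> ^^ l) a)" if "k \<le> l" "l < n" for l
    using that
  proof (induction "n - l" arbitrary: l rule: less_induct)
    case less
    \<comment> \<open>Following l - k arrows moves the leading coordinate from k to l; the remainder
      \<open>z\<close> below involves only positions beyond l, which the induction hypothesis
      settles.\<close>
    define y where "y = path_map \<Lambda> (Ivl a n) i (l - k) w"
    have t: "(nxt \<Lambda> ^^ (l - k)) i = (nxt \<Lambda> ^^ l) a"
      using less.prems k(2) by (metis comp_apply funpow_add le_add_diff_inverse2)
    have yW: "y \<in> W ((nxt \<Lambda> ^^ l) a)"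
      using submodule_path[OF W w(1), of "l - k"] by (simp add: y_def t)
    have y: "y (0, m) = (if l - k \<le> m \<and> m < n then w (0, m - (l - k)) else 0)" for m
      unfolding y_def by (subst path_Ivl[OF vsp_Ivl_supp[OF wv]]) auto
    have yl: "y (0, l) = w (0, k)" using less.prems by (simp add: y)
    have y0: "y (0, m) = 0" if "m < l" for m
    proof -
      have "m - (l - k) < k" if "l - k \<le> m" using that \<open>m < l\<close> less.prems by linarith
      then show ?thesis by (auto simp: y w(3))
    qed
    define z where "z = y - scal (w (0, k)) (unit_vec (0, l))"
    have u: "(unit_vec (0, l) :: 'k amb) \<in> vsp (Ivl a n) ((nxt \<Lambda> ^^ l) a)"
      using less.prems by (simp add: vsp_Ivl)
    have zv: "z \<in> vsp (Ivl a n) ((nxt \<Lambda> ^^ l) a)"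
      unfolding z_def vsp_Ivl
      by (intro amb.subspace_diff[OF subspace_supp] amb.subspace_scale[OF subspace_supp])
        (use yW le u in \<open>auto simp: vsp_Ivl\<close>)
    have "z \<in> W ((nxt \<Lambda> ^^ l) a)"
    proof (rule span[OF zv])
      fix m assume m: "z (0, m) \<noteq> 0"
      then have "m > l" using y0[of m] yl
        by (cases m l rule: linorder_cases) (auto simp: z_def unit_vec_apply scal_apply)
      moreover have "m < n" "(nxt \<Lambda> ^^ m) a = (nxt \<Lambda> ^^ l) a"
        using Ivl_mem[OF zv m] by blast+
      ultimately show "(unit_vec (0, m) :: 'k amb) \<in> W ((nxt \<Lambda> ^^ l) a)"
        using less.hyps[of m] less.prems by simp
    qed
    then have "y - z \<in> W ((nxt \<Lambda> ^^ l) a)" by (rule amb.subspace_diff[OF sub yW])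
    then have "scal (w (0, k)) (unit_vec (0, l)) \<in> W ((nxt \<Lambda> ^^ l) a)" by (simp add: z_def)
    from amb.subspace_scale[OF sub this, of "1 / w (0, k)"] show ?case using w(2) by simp
  qed
  show ?thesis
  proof (rule span[OF x(1)])
    fix m assume m: "x (0, m) \<noteq> 0"
    then have "k \<le> m" using x(2) not_less by blast
    moreover have "m < n" "(nxt \<Lambda> ^^ m) a = j"
      using Ivl_mem[OF x(1) m] by blast+
    ultimately show "(unit_vec (0, m) :: 'k amb) \<in> W j" using unit[of m] by simp
  qed
qed

lemma Ivl_least:
  assumes "w \<in> vsp (Ivl a n) i" "w \<noteq> 0"
  obtains k where "w (0, k) \<noteq> 0" "\<And>l. l < k \<Longrightarrow> w (0, l) = 0" "k < n" "(nxt \<Lambda> ^^ k) a = i"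
proof -
  obtain x m where "w (x, m) \<noteq> 0" using assms(2) by (auto simp: fun_eq_iff)
  then have "w (0, m) \<noteq> 0" using Ivl_mem[OF assms(1)] by metis
  then have *: "w (0, LEAST k. w (0, k) \<noteq> 0) \<noteq> 0" by (rule LeastI)
  show thesis
  proof (rule that[OF *])
    show "w (0, l) = 0" if "l < (LEAST k. w (0, k) \<noteq> 0)" for l
      using not_less_Least[OF that] by simp
    show "(LEAST k. w (0, k) \<noteq> 0) < n" "(nxt \<Lambda> ^^ (LEAST k. w (0, k) \<noteq> 0)) a = i"
      using Ivl_mem[OF assms(1) *] by blast+
  qed
qed

text \<open>The leading coordinate of a nonzero vector is at most n - 1, so every nonzero submodule
  reaches the socle.\<close>

lemma Ivl_submodule_socle:
  fixes W :: "nat \<Rightarrow> 'k::field amb set"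
  assumes a: "a \<in> verts \<Lambda>" "n \<le> plen a"
    and W: "W \<in> submodules \<Lambda> (Ivl a n)" and w: "w \<in> W i" "w \<noteq> 0"
  shows "unit_vec (0, n - 1) \<in> W ((nxt \<Lambda> ^^ (n - 1)) a)"
proof -
  have "w \<in> vsp (Ivl a n) i" using W w by (auto simp: submodules_def)
  then obtain k where k: "w (0, k) \<noteq> 0" "\<And>l. l < k \<Longrightarrow> w (0, l) = 0" "k < n"
    using Ivl_least w(2) by blast
  show ?thesis
    by (rule Ivl_submodule[OF a W w(1) k(1,2)]) (use k in \<open>auto simp: vsp_Ivl unit_vec_apply\<close>)
qed

text \<open>A nonzero kernel would contain the socle, where g does not vanish.\<close>

lemma Ivl_hom_inj:
  fixes M :: "'k::field rep"
  assumes a: "a \<in> verts \<Lambda>" "n \<le> plen a" and M: "M \<in> modules \<Lambda>"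
    and g: "g \<in> homs \<Lambda> (Ivl a n) M" and nz: "g ((nxt \<Lambda> ^^ (n - 1)) a) (unit_vec (0, n - 1)) \<noteq> 0"
  shows "inj_on (g i) (vsp (Ivl a n) i)"
proof -
  have K: "kernel_fam (Ivl a n) g \<in> submodules \<Lambda> (Ivl a n)"
    by (rule kernel_submodule[OF Ivl_module[OF a] M g])
  have "v = 0" if "v \<in> vsp (Ivl a n) i" "g i v = 0" for v
  proof (rule ccontr)
    assume "v \<noteq> 0"
    from Ivl_submodule_socle[OF a K _ this] that nz show False
      by (auto simp: kernel_fam_def)
  qed
  then show ?thesis
    using lp.linear_inj_on_iff_eq_0[OF homs_lin[OF g] module_subspace[OF Ivl_module[OF a]]] by blast
qed

definition cnt :: "nat \<Rightarrow> nat \<Rightarrow> nat \<Rightarrow> nat \<Rightarrow> nat" where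
  "cnt a n s l = card {y. y + l < n \<and> (nxt \<Lambda> ^^ y) a = s}"

text \<open>The path map sends basis vectors to distinct basis vectors or to zero, so that its image
  is again a coordinate subspace.\<close>

lemma rk_Ivl: "rk \<Lambda> s l (Ivl a n :: 'k::field rep) = cnt a n s l"
proof -
  let ?S = "(\<lambda>y. (0 :: nat, y + l)) ` {y. y + l < n \<and> (nxt \<Lambda> ^^ y) a = s}"
  have fin: "finite {y. y + l < n \<and> (nxt \<Lambda> ^^ y) a = s}"
    by (rule finite_subset[of _ "{..<n}"]) auto
  have "path_map \<Lambda> (Ivl a n) s l ` vsp (Ivl a n) s = (supp ?S :: 'k amb set)"
  proof (intro equalityI subsetI)
    fix v :: "'k amb" assume "v \<in> path_map \<Lambda> (Ivl a n) s l ` vsp (Ivl a n) s"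
    then obtain w where w: "w \<in> vsp (Ivl a n) s" and v: "v = path_map \<Lambda> (Ivl a n) s l w" by blast
    show "v \<in> supp ?S"
    proof (rule suppI)
      fix x m assume "v (x, m) \<noteq> 0"
      then have *: "x = 0" "l \<le> m" "m < n" "w (0, m - l) \<noteq> 0"
        unfolding v path_Ivl[OF vsp_Ivl_supp[OF w]] by (auto split: if_splits)
      then have "(nxt \<Lambda> ^^ (m - l)) a = s" using Ivl_mem[OF w] by blast
      then show "(x, m) \<in> ?S" using * by (intro image_eqI[of _ _ "m - l"]) auto
    qed
  next
    fix v :: "'k amb" assume v: "v \<in> supp ?S"
    define w :: "'k amb" where "w = (\<lambda>(x, m). if x = 0 then v (0, m + l) else 0)"
    have w: "w \<in> vsp (Ivl a n) s"
      unfolding vsp_Ivl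
    proof (rule suppI)
      fix x m assume "w (x, m) \<noteq> 0"
      then show "(x, m) \<in> ivs a n s"
        using supp_mem[OF v, of "(0, m + l)"] by (auto simp: w_def split: if_splits)
    qed
    have "path_map \<Lambda> (Ivl a n) s l w = v"
    proof (rule ext)
      fix p :: "nat \<times> nat"
      obtain x m where p: "p = (x, m)" by (cases p)
      show "path_map \<Lambda> (Ivl a n) s l w p = v p"
        unfolding p path_Ivl[OF vsp_Ivl_supp[OF w]]
        using supp_mem[OF v, of "(x, m)"] by (cases "v (x, m) = 0") (auto simp: w_def)
    qed
    then show "v \<in> path_map \<Lambda> (Ivl a n) s l ` vsp (Ivl a n) s" using w by blast
  qed
  then have "rk \<Lambda> s l (Ivl a n :: 'k rep) = card ?S"
    unfolding rk_def using fin by (simp add: dim_supp)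
  also have "\<dots> = cnt a n s l" unfolding cnt_def by (rule card_image) (auto simp: inj_on_def)
  finally show ?thesis .
qed

text \<open>The only occurrence of s lost when one more arrow is demanded is the one with exactly l
  arrows left to the socle.\<close>

lemma cnt_Suc: "cnt a n s l = cnt a n s (Suc l) + (if l < n \<and> (nxt \<Lambda> ^^ (n - 1 - l)) a = s then 1 else 0)"
proof -
  have fin: "finite {y. y + Suc l < n \<and> (nxt \<Lambda> ^^ y) a = s}"
    by (rule finite_subset[of _ "{..<n}"]) auto
  have iff: "y + l < n \<longleftrightarrow> y + Suc l < n \<or> (l < n \<and> y = n - 1 - l)" for y by auto
  have "{y. y + l < n \<and> (nxt \<Lambda> ^^ y) a = s} = (if l < n \<and> (nxt \<Lambda> ^^ (n - 1 - l)) a = s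
     then insert (n - 1 - l) {y. y + Suc l < n \<and> (nxt \<Lambda> ^^ y) a = s}
     else {y. y + Suc l < n \<and> (nxt \<Lambda> ^^ y) a = s})"
    unfolding iff by auto
  then show ?thesis unfolding cnt_def using fin by auto
qed

text \<open>Vertex a lies below position a - 1, hence its predecessor below a - 2.\<close>

definition prv :: "nat \<Rightarrow> nat" where "prv a = vt (int a - 2)"

lemma prv: "a \<in> verts \<Lambda> \<Longrightarrow> nxt \<Lambda> (prv a) = a" "prv a \<in> verts \<Lambda>"
  using vt_surj[of a] by (auto simp: prv_def nxt_vt)

text \<open>The multiplicity of an interval as a direct summand, by inclusion and exclusion over the
  paths that prolong it by one arrow on either side.\<close>

definition mult :: "nat \<times> nat \<Rightarrow> 'k::field rep \<Rightarrow> int" where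
  "mult c M = (let a = fst c; m = snd c in
     int (rk \<Lambda> a (m - 1) M) - int (rk \<Lambda> a m M) - int (rk \<Lambda> (prv a) m M) + int (rk \<Lambda> (prv a) (m + 1) M))"

lemma mult_iso: "M \<in> modules \<Lambda> \<Longrightarrow> isomorphic \<Lambda> M N \<Longrightarrow> mult c M = mult c N"
  by (simp add: mult_def rk_iso[of M _ N])

lemma mult_direct_sum:
  "A \<in> modules \<Lambda> \<Longrightarrow> B \<in> modules \<Lambda> \<Longrightarrow> mult c (direct_sum A B) = mult c A + mult c B"
  by (simp add: mult_def rk_direct_sum Let_def)

text \<open>Each difference of consecutive ranks detects one occurrence at a fixed distance from the
  socle. For m < n the occurrence of a at distance m - 1 and that of \<open>prv a\<close> at
  distance m come together and cancel; for m = n nothing precedes the top, and only the first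
  remains.\<close>

lemma mult_Ivl:
  assumes a: "a \<in> verts \<Lambda>" "0 < m" and b: "b \<in> verts \<Lambda>"
  shows "mult (a, m) (Ivl b n) = (if a = b \<and> m = n then 1 else 0)"
proof -
  have "(nxt \<Lambda> ^^ (n - m)) b = a \<longleftrightarrow> (nxt \<Lambda> ^^ (n - 1 - m)) b = prv a" if "m < n"
  proof -
    have "n - m = Suc (n - 1 - m)" using that by simp
    then show ?thesis
      using nxt_inj[of "(nxt \<Lambda> ^^ (n - 1 - m)) b" "prv a"] prv(1)[OF a(1)] prv(2)[of a] b by simp
  qed
  moreover have "cnt b n a (m - 1) = cnt b n a m + (if m \<le> n \<and> (nxt \<Lambda> ^^ (n - m)) b = a then 1 else 0)"
    using cnt_Suc[of b n a "m - 1"] a(2) by auto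
  moreover have "cnt b n (prv a) m = cnt b n (prv a) (m + 1) + (if m < n \<and> (nxt \<Lambda> ^^ (n - 1 - m)) b = prv a then 1 else 0)"
    using cnt_Suc[of b n "prv a" m] by simp
  ultimately show ?thesis
    unfolding mult_def rk_Ivl by (cases m n rule: linorder_cases) (auto simp: Let_def)
qed

section \<open>The decomposition theorem\<close>

text \<open>The pair \<open>(a, n)\<close> encodes the uniserial module of length \<open>n\<close> with top \<open>S\<^sub>a\<close>; for \<open>n = 0\<close> this
  is the zero module.\<close>

definition codes :: "(nat \<times> nat) set" where
  "codes = {(a, n). a \<in> verts \<Lambda> \<and> n \<le> plen a}"

definition IC :: "nat \<times> nat \<Rightarrow> 'k::field rep" where
  "IC c = Ivl (fst c) (snd c)"

primrec dsum :: "(nat \<times> nat) list \<Rightarrow> 'k::field rep" where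
  "dsum [] = Ivl 1 0"
| "dsum (c # cs) = direct_sum (IC c) (dsum cs)"

lemma IC_module: "c \<in> codes \<Longrightarrow> IC c \<in> modules \<Lambda>"
  by (auto simp: codes_def IC_def Ivl_module)

lemma one_verts: "1 \<in> verts \<Lambda>"
  using nverts_ge by (simp add: verts_def)

lemma dsum_module: "set cs \<subseteq> codes \<Longrightarrow> dsum cs \<in> modules \<Lambda>"
  by (induction cs) (auto intro!: direct_sum_module IC_module Ivl_module one_verts simp del: One_nat_def)

lemma zero_rep_Ivl: "zero_rep (Ivl a n :: 'k::field rep) \<longleftrightarrow> n = 0"
proof -
  have "unit_vec (0, 0) \<in> vsp (Ivl a n :: 'k rep) a" if "n > 0" using that by (simp add: vsp_Ivl)
  then have "n = 0" if "zero_rep (Ivl a n :: 'k rep)"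
    using that unfolding zero_rep_def by (metis neq0_conv singletonD unit_vec_nonzero)
  moreover have "ivs a 0 i = {}" for i by (auto simp: ivs_def)
  ultimately show ?thesis by (auto simp: zero_rep_def vsp_Ivl)
qed

lemma isomorphic_zero:
  assumes "A \<in> modules \<Lambda>" "B \<in> modules \<Lambda>" "zero_rep A" "zero_rep B"
  shows "isomorphic \<Lambda> A B"
  by (rule isomorphicI[where f = "\<lambda>i v. 0" and g = "\<lambda>i v. 0"])
    (use assms in \<open>simp add: iso_pair_def zero_hom zero_rep_def\<close>)

text \<open>An interval \<open>I\<close> given by a longest nonzero path embeds into \<open>M\<close>, and a linear functional on
  \<open>M\<close> that reads off the socle coordinate of \<open>I\<close> provides a retraction.\<close>

lemma split_longest:
  fixes M :: "'k::field rep"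
  assumes M: "M \<in> modules \<Lambda>" and nz: "\<not> zero_rep M"
  obtains a n f where "a \<in> verts \<Lambda>" "0 < n" "n \<le> plen a" "f \<in> homs \<Lambda> M (Ivl a n)"
    "isomorphic \<Lambda> M (direct_sum (Ivl a n) (M\<lparr>vsp := kernel_fam M f\<rparr>))"
proof -
  define L where "L = {l. \<exists>i. \<exists>v\<in>vsp M i. path_map \<Lambda> M i l v \<noteq> 0}"
  have vert: "i \<in> verts \<Lambda>" if "v \<in> vsp M i" "path_map \<Lambda> M i l v \<noteq> 0" for i l v
  proof (rule ccontr)
    assume "i \<notin> verts \<Lambda>"
    then have "v = 0" using module_outside[OF M] that(1) by auto
    then show False using that(2) lin_0[OF module_path_lin[OF M]] by blast
  qed
  have short: "l < plen i" if "v \<in> vsp M i" "path_map \<Lambda> M i l v \<noteq> 0" for i l v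
    using path_map_zero_path[OF M _ that(1)] that zero_path_plen[OF vert[OF that]] not_less by blast
  have finL: "finite L"
  proof (rule finite_subset)
    show "L \<subseteq> (\<Union>i\<in>verts \<Lambda>. {..<plen i})"
    proof
      fix l assume "l \<in> L"
      then obtain i v where "v \<in> vsp M i" "path_map \<Lambda> M i l v \<noteq> 0" unfolding L_def by blast
      from vert[OF this] short[OF this] show "l \<in> (\<Union>i\<in>verts \<Lambda>. {..<plen i})" by blast
    qed
  qed (auto simp: verts_def)
  obtain i0 v0 where "v0 \<in> vsp M i0" "v0 \<noteq> 0"
    using nz module_0[OF M] unfolding zero_rep_def by blast
  then have "0 \<in> L" unfolding L_def by (metis (mono_tags, lifting) mem_Collect_eq path_map.simps(1))
  \<comment> \<open>A longest nonzero path has n - 1 arrows, so an interval of length n is needed to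
    carry it.\<close>
  define n where "n = Suc (Max L)"
  have "n - 1 \<in> L" unfolding n_def using Max_in[OF finL] \<open>0 \<in> L\<close> by auto
  then obtain a v where v: "v \<in> vsp M a" "path_map \<Lambda> M a (n - 1) v \<noteq> 0" unfolding L_def by blast
  have zero: "path_map \<Lambda> M i l w = 0" if "w \<in> vsp M i" "n \<le> l" for i l w
  proof (rule ccontr)
    assume "path_map \<Lambda> M i l w \<noteq> 0"
    then have "l \<in> L" unfolding L_def using that by blast
    then show False using that Max_ge[OF finL, of l] by (simp add: n_def)
  qed
  have n: "n > 0" "n \<le> plen a" using short[OF v] by (simp_all add: n_def)
  have a: "a \<in> verts \<Lambda>" using vert[OF v] .
  let ?I = "Ivl a n :: 'k rep" and ?t = "(nxt \<Lambda> ^^ (n - 1)) a"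
  define g where "g = gen_hom M a n v"
  have g: "g \<in> homs \<Lambda> ?I M" unfolding g_def by (rule gen_hom[OF M v(1) zero[OF v(1)]]) simp
  have gu: "g i (unit_vec (0, l)) = path_map \<Lambda> M a l v" if "l < n" for i l
    using that by (simp add: g_def gen_hom_unit)
  have "inj_on (g ?t) (vsp ?I ?t)"
    by (rule Ivl_hom_inj[OF a n(2) M g]) (use gu n v in auto)
  \<comment> \<open>A left inverse of g is needed at the socle vertex only: its coordinate n - 1 is
    the functional that \<open>cogen_hom\<close> spreads over the whole interval.\<close>
  then obtain q where q: "lin q" "\<And>w. w \<in> vsp ?I ?t \<Longrightarrow> q (g ?t w) = w"
    using lp.linear_exists_left_inverse_on[OF homs_lin[OF g] module_subspace[OF Ivl_module[OF a n(2)]]] by metis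
  define u where "u = (\<lambda>m. q m (0, n - 1))"
  have u: "Vector_Spaces.linear scal (*) u"
    unfolding u_def Vector_Spaces.linear_iff
    using vector_space_field amb.vector_space_axioms by (simp add: lin_add[OF q(1)] lin_scal[OF q(1)] scal_apply)
  define f where "f = cogen_hom M a n u"
  have f: "f \<in> homs \<Lambda> M ?I" unfolding f_def by (rule cogen_hom[OF a M u]) (simp add: zero)
  have fg: "f ((nxt \<Lambda> ^^ l) a) (g ((nxt \<Lambda> ^^ l) a) (unit_vec (0, l))) = unit_vec (0, l)" if l: "l < n" for l
  proof (rule ext)
    fix p :: "nat \<times> nat"
    obtain x m where p: "p = (x, m)" by (cases p)
    \<comment> \<open>Coordinate m of the image of basis vector l is read off after l + (n - 1 - m)
      arrows from a. This is the socle position iff l = m; a smaller number has socle coordinate 0,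
      and a larger one belongs to a vanishing path.\<close>
    have "u (path_map \<Lambda> M ((nxt \<Lambda> ^^ l) a) (n - 1 - m) (path_map \<Lambda> M a l v)) = (if l = m then 1 else 0)"
      if m: "m < n" "(nxt \<Lambda> ^^ m) a = (nxt \<Lambda> ^^ l) a"
    proof -
      have e: "path_map \<Lambda> M ((nxt \<Lambda> ^^ l) a) (n - 1 - m) (path_map \<Lambda> M a l v) = path_map \<Lambda> M a (l + (n - 1 - m)) v"
        by (rule path_map_add[symmetric])
      show ?thesis
      proof (cases "l + (n - 1 - m) < n")
        case True
        have "(nxt \<Lambda> ^^ (l + (n - 1 - m))) a = (nxt \<Lambda> ^^ (n - 1 - m)) ((nxt \<Lambda> ^^ l) a)"
          by (metis add.commute comp_apply funpow_add)
        also have "\<dots> = (nxt \<Lambda> ^^ (n - 1 - m + m)) a"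
          unfolding m(2)[symmetric] by (metis comp_apply funpow_add)
        also have "n - 1 - m + m = n - 1" using m by simp
        finally have "(nxt \<Lambda> ^^ (l + (n - 1 - m))) a = ?t" .
        then have "(unit_vec (0, l + (n - 1 - m)) :: 'k amb) \<in> vsp ?I ?t" using True by (simp add: vsp_Ivl)
        from q(2)[OF this] have "u (path_map \<Lambda> M a (l + (n - 1 - m)) v) = unit_vec (0, l + (n - 1 - m)) (0, n - 1)"
          using gu[OF True] by (simp add: u_def)
        then show ?thesis unfolding e using m l by (auto simp: unit_vec_apply)
      next
        case False
        then show ?thesis
          unfolding e using zero[OF v(1), of "l + (n - 1 - m)"] m l by (auto simp: lf.linear_0[OF u])
      qed
    qed
    then show "f ((nxt \<Lambda> ^^ l) a) (g ((nxt \<Lambda> ^^ l) a) (unit_vec (0, l))) p = (unit_vec (0, l) :: 'k amb) p"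
      unfolding gu[OF l] f_def cogen_hom_def p by (auto simp: unit_vec_apply l)
  qed
  have "isomorphic \<Lambda> M (direct_sum ?I (M\<lparr>vsp := kernel_fam M f\<rparr>))"
  proof (rule split_isomorphic[OF M Ivl_module[OF a n(2)] f g])
    show "f i (g i w) = w" if "w \<in> vsp ?I i" for i w
      by (rule hom_Ivl_eqI[OF _ _ that, where g = "\<lambda>i w. w"])
        (use fg in \<open>auto intro!: lin_comp[OF homs_lin[OF f] homs_lin[OF g]] lin_id\<close>)
  qed
  then show thesis using that a n f by blast
qed

text \<open>The total dimension of M, expressed through paths of length 0 so that its additivity is
  a case of that of ranks.\<close>

definition tdim :: "'k::field rep \<Rightarrow> nat" where
  "tdim M = (\<Sum>i\<in>verts \<Lambda>. rk \<Lambda> i 0 M)"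

text \<open>Splitting off the interval of a longest nonzero path lowers the total dimension.\<close>

theorem decomposition:
  assumes "M \<in> modules \<Lambda>"
  obtains cs where "set cs \<subseteq> {c \<in> codes. 0 < snd c}" "isomorphic \<Lambda> M (dsum cs)"
proof -
  have "\<exists>cs. set cs \<subseteq> {c \<in> codes. 0 < snd c} \<and> isomorphic \<Lambda> M (dsum cs)"
    using assms
  proof (induction "tdim M" arbitrary: M rule: less_induct)
    case less
    show ?case
    proof (cases "zero_rep M")
      case True
      have "isomorphic \<Lambda> M (dsum [])"
        using True less.prems dsum_module[of "[]"] zero_rep_Ivl[of 1 0] by (intro isomorphic_zero) auto
      then show ?thesis by (intro exI[of _ "[]"]) auto
    next
      case False
      then obtain a n f where a: "a \<in> verts \<Lambda>" "0 < n" "n \<le> plen a" and f: "f \<in> homs \<Lambda> M (Ivl a n)"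
        and iso: "isomorphic \<Lambda> M (direct_sum (Ivl a n) (M\<lparr>vsp := kernel_fam M f\<rparr>))"
        using split_longest[OF less.prems] by metis
      let ?K = "M\<lparr>vsp := kernel_fam M f\<rparr>"
      note I = Ivl_module[OF a(1,3)]
      have K: "?K \<in> modules \<Lambda>"
        by (rule submodule_module[OF less.prems kernel_submodule[OF less.prems I f]])
      have "rk \<Lambda> i 0 M = rk \<Lambda> i 0 (Ivl a n :: 'a rep) + rk \<Lambda> i 0 ?K" for i
        using rk_iso[OF less.prems iso] rk_direct_sum[OF I K] by metis
      then have "tdim M = tdim (Ivl a n :: 'a rep) + tdim ?K" by (simp add: tdim_def sum.distrib)
      moreover have "tdim (Ivl a n :: 'a rep) > 0"
      proof -
        have "0 \<in> {y. y + 0 < n \<and> (nxt \<Lambda> ^^ y) a = a}" using a by simp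
        moreover have "finite {y. y + 0 < n \<and> (nxt \<Lambda> ^^ y) a = a}" by simp
        ultimately have "cnt a n a 0 > 0" unfolding cnt_def using card_gt_0_iff by blast
        moreover have "finite (verts \<Lambda>)" by (simp add: verts_def)
        ultimately show ?thesis unfolding tdim_def rk_Ivl using a(1) by (simp add: sum_pos2)
      qed
      ultimately obtain cs where cs: "set cs \<subseteq> {c \<in> codes. 0 < snd c}" "isomorphic \<Lambda> ?K (dsum cs)"
        using less.hyps[OF _ K] by auto
      have "isomorphic \<Lambda> (direct_sum (Ivl a n) ?K) (dsum ((a, n) # cs))"
        using isomorphic_direct_sum[OF isomorphic_refl cs(2) I K] by (simp add: IC_def)
      then have "isomorphic \<Lambda> M (dsum ((a, n) # cs))" by (rule isomorphic_trans[OF iso])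
      moreover have "set ((a, n) # cs) \<subseteq> {c \<in> codes. 0 < snd c}" using a cs by (auto simp: codes_def)
      ultimately show ?thesis by blast
    qed
  qed
  then show thesis using that by blast
qed

section \<open>Uniqueness of codes and indecomposability of intervals\<close>

lemma mult_IC:
  assumes "c \<in> codes" "d \<in> codes" "0 < snd c"
  shows "mult c (IC d) = (if c = d then 1 else 0)"
proof -
  obtain a m b n where "c = (a, m)" "d = (b, n)" by (cases c, cases d)
  then show ?thesis using assms by (simp add: codes_def IC_def mult_Ivl)
qed

lemma mult_dsum:
  assumes "set cs \<subseteq> codes" "c \<in> codes" "0 < snd c"
  shows "mult c (dsum cs) = int (count_list cs c)"
  using assms(1)
proof (induction cs)
  case Nil
  obtain a m where "c = (a, m)" by (cases c)
  then show ?case using assms mult_Ivl[of a m 1 0] one_verts by (simp add: codes_def)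
next
  case (Cons d ds)
  then show ?case
    using assms by (simp add: mult_direct_sum IC_module dsum_module mult_IC)
qed

lemma mult_nonneg:
  fixes M :: "'k::field rep"
  assumes "M \<in> modules \<Lambda>" "c \<in> codes" "0 < snd c"
  shows "mult c M \<ge> 0"
proof -
  obtain cs where "set cs \<subseteq> {c \<in> codes. 0 < snd c}" "isomorphic \<Lambda> M (dsum cs)"
    using decomposition[OF assms(1)] .
  then have "set cs \<subseteq> codes" "mult c M = mult c (dsum cs :: 'k rep)"
    using mult_iso[OF assms(1), of _ c] by auto
  then show ?thesis using assms by (simp add: mult_dsum)
qed

lemma IC_iso_iff:
  assumes "c \<in> codes" "d \<in> codes" "0 < snd c"
  shows "isomorphic \<Lambda> (IC c :: 'k::field rep) (IC d) \<longleftrightarrow> c = d"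
proof
  assume "isomorphic \<Lambda> (IC c :: 'k rep) (IC d)"
  then have "mult c (IC c :: 'k rep) = mult c (IC d :: 'k rep)"
    using mult_iso IC_module assms by blast
  then show "c = d"
    using assms by (simp add: mult_IC split: if_splits)
qed (simp add: isomorphic_refl)

text \<open>By the decomposition theorem a nonzero summand has some positive multiplicity, but the
  multiplicities of the interval are 1 at its own code and 0 elsewhere. They cannot be shared by two
  nonzero summands.\<close>

lemma indecomposable_IC:
  assumes c: "c \<in> codes" "0 < snd c"
  shows "indecomposable \<Lambda> (IC c :: 'k::field rep)"
  unfolding indecomposable_def
proof (intro conjI ballI impI)
  show "IC c \<in> modules \<Lambda>" by (rule IC_module[OF c(1)])
  show "\<not> zero_rep (IC c :: 'k rep)" using c by (simp add: IC_def zero_rep_Ivl)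
  fix A B :: "'k rep" assume A: "A \<in> modules \<Lambda>" and B: "B \<in> modules \<Lambda>"
    and iso: "isomorphic \<Lambda> (IC c) (direct_sum A B)"
  have m: "mult d (IC c :: 'k rep) = (if d = c then 1 else 0)" if "d \<in> codes" "0 < snd d" for d
    using that c by (simp add: mult_IC)
  have s: "mult d (IC c :: 'k rep) = mult d A + mult d B" for d
    using mult_iso[OF IC_module[OF c(1)] iso] mult_direct_sum[OF A B] by metis
  have nz: "mult c A \<ge> 1" if A: "A \<in> modules \<Lambda>" and B: "B \<in> modules \<Lambda>"
    and s: "\<And>d. mult d (IC c :: 'k rep) = mult d A + mult d B" and "\<not> zero_rep A" for A B :: "'k rep"
  proof -
    obtain cs where cs: "set cs \<subseteq> {c \<in> codes. 0 < snd c}" "isomorphic \<Lambda> A (dsum cs)"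
      using decomposition[OF A] .
    have "cs \<noteq> []"
    proof
      assume "cs = []"
      then have iz: "isomorphic \<Lambda> A (Ivl 1 0)" using cs by simp
      have "vsp A i = {0}" for i
      proof -
        obtain f where "f \<in> homs \<Lambda> A (Ivl 1 0)" "bij_betw (f i) (vsp A i) (vsp (Ivl 1 0) i)"
          using iz by (auto simp: isomorphic_def)
        then have "inj_on (f i) (vsp A i)" "f i ` vsp A i = {0}"
          using zero_rep_Ivl[of 1 0, where ?'k = 'k] by (auto simp: bij_betw_def zero_rep_def)
        then have "v = 0" if "v \<in> vsp A i" for v
          using that module_0[OF A, of i] inj_onD[of "f i" "vsp A i" v 0] by (metis image_eqI singletonD)
        then show ?thesis using module_0[OF A, of i] by blast
      qed
      then show False using that by (simp add: zero_rep_def)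
    qed
    then obtain d where d: "d \<in> set cs" by (cases cs) auto
    then have d': "d \<in> codes" "0 < snd d" using cs by auto
    have "mult d A = int (count_list cs d)"
      unfolding mult_iso[OF A cs(2)] by (rule mult_dsum[OF _ d']) (use cs in auto)
    then have "mult d A \<ge> 1" using d by (metis Suc_leI count_list_0_iff neq0_conv of_nat_1 of_nat_le_iff One_nat_def)
    moreover have "mult d B \<ge> 0" by (rule mult_nonneg[OF B d'])
    ultimately have "d = c" using s[of d] m[OF d'] by (auto split: if_splits)
    then show ?thesis using \<open>mult d A \<ge> 1\<close> by simp
  qed
  show "zero_rep A \<or> zero_rep B"
  proof (rule ccontr)
    assume "\<not> (zero_rep A \<or> zero_rep B)"
    then have "mult c A \<ge> 1" "mult c B \<ge> 1"
      using nz[OF A B s] nz[OF B A] s by (auto simp: add.commute)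
    then show False using s[of c] m[OF c] by simp
  qed
qed

lemma indecomposable_cases:
  assumes "indecomposable \<Lambda> M"
  obtains c where "c \<in> codes" "0 < snd c" "isomorphic \<Lambda> M (IC c)"
proof -
  have M: "M \<in> modules \<Lambda>" "\<not> zero_rep M" using assms by (auto simp: indecomposable_def)
  obtain a n f where a: "a \<in> verts \<Lambda>" "0 < n" "n \<le> plen a" and f: "f \<in> homs \<Lambda> M (Ivl a n)"
    and iso: "isomorphic \<Lambda> M (direct_sum (Ivl a n) (M\<lparr>vsp := kernel_fam M f\<rparr>))"
    using split_longest[OF M] by metis
  let ?K = "M\<lparr>vsp := kernel_fam M f\<rparr>"
  note I = Ivl_module[OF a(1,3)]
  have K: "?K \<in> modules \<Lambda>" by (rule submodule_module[OF M(1) kernel_submodule[OF M(1) I f]])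
  have "zero_rep ?K"
    using assms iso I K a zero_rep_Ivl[of a n] unfolding indecomposable_def by blast
  then have "isomorphic \<Lambda> M (Ivl a n)"
    using isomorphic_trans[OF iso isomorphic_direct_sum_zero[OF I K]] by blast
  then show thesis using that[of "(a, n)"] a by (simp add: codes_def IC_def)
qed

end

section \<open>Projective modules and syzygies\<close>

lemma projective_module: "projective \<Lambda> P \<Longrightarrow> P \<in> modules \<Lambda>"
  by (simp add: projective_def)

lemma projective_lift:
  assumes "projective \<Lambda> P" "M \<in> modules \<Lambda>" "N \<in> modules \<Lambda>" "g \<in> rep_epis \<Lambda> M N" "f \<in> homs \<Lambda> P N"
  obtains h where "h \<in> homs \<Lambda> P M" "\<And>i v. v \<in> vsp P i \<Longrightarrow> g i (h i v) = f i v"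
  using assms unfolding projective_def by blast

lemma projective_iso:
  assumes P: "projective \<Lambda> P" and Q: "Q \<in> modules \<Lambda>" and iso: "isomorphic \<Lambda> P Q"
  shows "projective \<Lambda> Q"
  unfolding projective_def
proof (intro conjI Q ballI)
  obtain s t where st: "iso_pair \<Lambda> P Q s t" using isomorphicE[OF iso projective_module[OF P]] .
  then have s: "s \<in> homs \<Lambda> P Q" and t: "t \<in> homs \<Lambda> Q P" and inv: "\<And>i w. w \<in> vsp Q i \<Longrightarrow> s i (t i w) = w"
    by (auto simp: iso_pair_def)
  fix M N g f assume M: "M \<in> modules \<Lambda>" "N \<in> modules \<Lambda>" "g \<in> rep_epis \<Lambda> M N" and f: "f \<in> homs \<Lambda> Q N"
  obtain h where h: "h \<in> homs \<Lambda> P M" "\<And>i v. v \<in> vsp P i \<Longrightarrow> g i (h i v) = f i (s i v)"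
    using projective_lift[OF P M homs_comp[OF s f]] by metis
  show "\<exists>h\<in>homs \<Lambda> Q M. \<forall>i. \<forall>v\<in>vsp Q i. g i (h i v) = f i v"
    using homs_comp[OF t h(1)] by (rule bexI[rotated]) (simp add: h(2) homs_closed[OF t] inv)
qed

lemma inl_hom: "B \<in> modules \<Lambda> \<Longrightarrow> (\<lambda>i a. merge a 0) \<in> homs \<Lambda> A (direct_sum A B)"
  by (rule pair_hom[OF homs_id zero_hom])

lemma inr_hom: "A \<in> modules \<Lambda> \<Longrightarrow> (\<lambda>i b. merge 0 b) \<in> homs \<Lambda> B (direct_sum A B)"
  by (rule pair_hom[OF zero_hom homs_id])

lemma merge_split: "merge a b = merge a 0 + merge 0 (b :: 'k::field amb)"
  by (simp add: merge_add[symmetric] del: plus_fun_apply)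

lemma projective_direct_sum:
  assumes A: "projective \<Lambda> A" and B: "projective \<Lambda> B"
  shows "projective \<Lambda> (direct_sum A B)"
  unfolding projective_def
proof (intro conjI ballI)
  note mods = projective_module[OF A] projective_module[OF B]
  show "direct_sum A B \<in> modules \<Lambda>" by (intro direct_sum_module mods)
  fix M N g f assume M: "M \<in> modules \<Lambda>" "N \<in> modules \<Lambda>" "g \<in> rep_epis \<Lambda> M N"
    and f: "f \<in> homs \<Lambda> (direct_sum A B) N"
  have g: "lin (g i)" for i using M(3) by (auto simp: rep_epis_def homs_lin)
  obtain h where h: "h \<in> homs \<Lambda> A M" "\<And>i v. v \<in> vsp A i \<Longrightarrow> g i (h i v) = f i (merge v 0)"
    using projective_lift[OF A M homs_comp[OF inl_hom[OF mods(2)] f]] by metis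
  obtain h' where h': "h' \<in> homs \<Lambda> B M" "\<And>i v. v \<in> vsp B i \<Longrightarrow> g i (h' i v) = f i (merge 0 v)"
    using projective_lift[OF B M homs_comp[OF inr_hom[OF mods(1)] f]] by metis
  show "\<exists>h\<in>homs \<Lambda> (direct_sum A B) M. \<forall>i. \<forall>v\<in>vsp (direct_sum A B) i. g i (h i v) = f i v"
  proof (intro bexI[OF _ copair_hom[OF h(1) h'(1) M(1)]] allI ballI)
    fix i v assume v: "v \<in> vsp (direct_sum A B) i"
    have "g i (h i (left_part v) + h' i (right_part v)) = f i (merge (left_part v) 0) + f i (merge 0 (right_part v))"
      using v by (simp only: lin_add[OF g] h h' vsp_direct_sum)
    also have "\<dots> = f i v"
      by (simp only: lin_add[OF homs_lin[OF f], symmetric] merge_split[symmetric] merge_parts)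
    finally show "g i (h i (left_part v) + h' i (right_part v)) = f i v" .
  qed
qed

lemma projective_summand:
  assumes P: "projective \<Lambda> (direct_sum A B)" and A: "A \<in> modules \<Lambda>" and B: "B \<in> modules \<Lambda>"
  shows "projective \<Lambda> A"
  unfolding projective_def
proof (intro conjI A ballI)
  fix M N g f assume M: "M \<in> modules \<Lambda>" "N \<in> modules \<Lambda>" "g \<in> rep_epis \<Lambda> M N" and f: "f \<in> homs \<Lambda> A N"
  obtain h where h: "h \<in> homs \<Lambda> (direct_sum A B) M"
    "\<And>i v. v \<in> vsp (direct_sum A B) i \<Longrightarrow> g i (h i v) = f i (left_part v)"
    using projective_lift[OF P M homs_comp[OF left_part_hom f]] by metis
  show "\<exists>h\<in>homs \<Lambda> A M. \<forall>i. \<forall>v\<in>vsp A i. g i (h i v) = f i v"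
    using homs_comp[OF inl_hom[OF B] h(1)]
    by (rule bexI[rotated]) (simp add: h(2) vsp_direct_sum module_0[OF B])
qed

lemma projective_section:
  assumes "projective \<Lambda> P" "M \<in> modules \<Lambda>" "g \<in> rep_epis \<Lambda> M P"
  obtains s where "s \<in> homs \<Lambda> P M" "\<And>i v. v \<in> vsp P i \<Longrightarrow> g i (s i v) = v"
  using projective_lift[OF assms(1,2) projective_module[OF assms(1)] assms(3) homs_id] by metis

lemma image_submodule:
  assumes "P \<in> modules \<Lambda>" "h \<in> homs \<Lambda> P Q"
  shows "(\<lambda>i. h i ` vsp P i) \<in> submodules \<Lambda> Q"
proof -
  have "arr Q i (h i v) \<in> h (nxt \<Lambda> i) ` vsp P (nxt \<Lambda> i)" if "v \<in> vsp P i" for i v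
    using homs_arr[OF assms(2) that] module_closed[OF assms(1) that] by (metis imageI)
  then show ?thesis
    unfolding submodules_def
    using lp.linear_subspace_image[OF homs_lin[OF assms(2)] module_subspace[OF assms(1)]] homs_closed[OF assms(2)]
    by auto
qed

lemma projective_cover_superfluous:
  assumes "projective_cover \<Lambda> P p M" "W \<in> submodules \<Lambda> P"
    "\<And>i. {w + u |w u. w \<in> W i \<and> u \<in> kernel_fam P p i} = vsp P i"
  shows "W = vsp P"
  using assms by (simp add: projective_cover_def)

lemma projective_cover_kernel_iso:
  assumes P: "projective_cover \<Lambda> P p M" and P': "projective_cover \<Lambda> P' p' M'"
    and M: "M \<in> modules \<Lambda>" and M': "M' \<in> modules \<Lambda>" and iso: "isomorphic \<Lambda> M M'"
  shows "isomorphic \<Lambda> (P\<lparr>vsp := kernel_fam P p\<rparr>) (P'\<lparr>vsp := kernel_fam P' p'\<rparr>)"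
proof -
  have pP: "projective \<Lambda> P" and pe: "p \<in> rep_epis \<Lambda> P M" and pP': "projective \<Lambda> P'" and pe': "p' \<in> rep_epis \<Lambda> P' M'"
    using P P' by (auto simp: projective_cover_def)
  then have p: "p \<in> homs \<Lambda> P M" "\<And>i. p i ` vsp P i = vsp M i" and p': "p' \<in> homs \<Lambda> P' M'"
    by (auto simp: rep_epis_def)
  note PM = projective_module[OF pP] and PM' = projective_module[OF pP']
  obtain f g where fg: "iso_pair \<Lambda> M M' f g" using isomorphicE[OF iso M] .
  then have f: "f \<in> homs \<Lambda> M M'" and g: "g \<in> homs \<Lambda> M' M" and gf: "\<And>i v. v \<in> vsp M i \<Longrightarrow> g i (f i v) = v"
    and fg: "\<And>i v. v \<in> vsp M' i \<Longrightarrow> f i (g i v) = v"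
    by (auto simp: iso_pair_def)
  obtain h where h: "h \<in> homs \<Lambda> P P'" "\<And>i v. v \<in> vsp P i \<Longrightarrow> p' i (h i v) = f i (p i v)"
    using projective_lift[OF pP PM' M' pe' homs_comp[OF p(1) f]] by metis
  have "(\<lambda>i. h i ` vsp P i) = vsp P'"
  proof -
    have "{w + u |w u. w \<in> h i ` vsp P i \<and> u \<in> kernel_fam P' p' i} = vsp P' i" for i
    proof (intro equalityI subsetI)
      fix y assume y: "y \<in> vsp P' i"
      have "g i (p' i y) \<in> p i ` vsp P i" using y p' g p(2) by (simp add: homs_closed)
      then obtain x where x: "x \<in> vsp P i" "g i (p' i y) = p i x" by blast
      have hx: "h i x \<in> vsp P' i" using h(1) x(1) by (rule homs_closed)
      have "p' i (h i x) = p' i y" using h(2)[OF x(1)] x(2) fg[OF homs_closed[OF p' y]] by simp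
      then have "y - h i x \<in> kernel_fam P' p' i"
        using amb.subspace_diff[OF module_subspace[OF PM'] y hx]
        by (simp add: kernel_fam_def lin_diff[OF homs_lin[OF p']] del: minus_apply)
      moreover have "y = h i x + (y - h i x)" by simp
      ultimately show "y \<in> {w + u |w u. w \<in> h i ` vsp P i \<and> u \<in> kernel_fam P' p' i}"
        using imageI[OF x(1), of "h i"] by blast
    next
      fix y assume "y \<in> {w + u |w u. w \<in> h i ` vsp P i \<and> u \<in> kernel_fam P' p' i}"
      then show "y \<in> vsp P' i"
        using amb.subspace_add[OF module_subspace[OF PM']] homs_closed[OF h(1)] by (auto simp: kernel_fam_def)
    qed
    then show ?thesis
      using projective_cover_superfluous[OF P' image_submodule[OF PM h(1)]] by blast
  qed
  then have "h \<in> rep_epis \<Lambda> P P'" using h(1) by (auto simp: rep_epis_def dest: fun_cong)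
  then obtain s where s: "s \<in> homs \<Lambda> P' P" "\<And>i v. v \<in> vsp P' i \<Longrightarrow> h i (s i v) = v"
    using projective_section[OF pP' PM] by metis
  have "(\<lambda>i. s i ` vsp P' i) = vsp P"
  proof -
    have "{w + u |w u. w \<in> s i ` vsp P' i \<and> u \<in> kernel_fam P p i} = vsp P i" for i
    proof (intro equalityI subsetI)
      fix x assume x: "x \<in> vsp P i"
      have hx: "h i x \<in> vsp P' i" using h(1) x by (rule homs_closed)
      have sx: "s i (h i x) \<in> vsp P i" using s(1) hx by (rule homs_closed)
      have "f i (p i (s i (h i x))) = f i (p i x)"
        using h(2)[OF sx] s(2)[OF hx] h(2)[OF x] by simp
      then have "p i (s i (h i x)) = p i x"
        using gf[OF homs_closed[OF p(1) sx]] gf[OF homs_closed[OF p(1) x]] by metis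
      then have "x - s i (h i x) \<in> kernel_fam P p i"
        using amb.subspace_diff[OF module_subspace[OF PM] x sx]
        by (simp add: kernel_fam_def lin_diff[OF homs_lin[OF p(1)]] del: minus_apply)
      moreover have "x = s i (h i x) + (x - s i (h i x))" by simp
      ultimately show "x \<in> {w + u |w u. w \<in> s i ` vsp P' i \<and> u \<in> kernel_fam P p i}"
        using imageI[OF hx, of "s i"] by blast
    next
      fix y assume "y \<in> {w + u |w u. w \<in> s i ` vsp P' i \<and> u \<in> kernel_fam P p i}"
      then show "y \<in> vsp P i"
        using amb.subspace_add[OF module_subspace[OF PM]] homs_closed[OF s(1)] by (auto simp: kernel_fam_def)
    qed
    then show ?thesis
      using projective_cover_superfluous[OF P image_submodule[OF PM' s(1)]] by blast
  qed
  then have sh: "s i (h i x) = x" if "x \<in> vsp P i" for i x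
  proof -
    have "x \<in> s i ` vsp P' i" using that fun_cong[OF \<open>(\<lambda>i. s i ` vsp P' i) = vsp P\<close>, of i] by simp
    then show ?thesis using s(2) by auto
  qed
  have h0: "h i x \<in> kernel_fam P' p' i" if "x \<in> kernel_fam P p i" for i x
    using that h homs_closed[OF h(1)] lin_0[OF homs_lin[OF f]] by (auto simp: kernel_fam_def)
  have s0: "s i y \<in> kernel_fam P p i" if y: "y \<in> kernel_fam P' p' i" for i y
  proof -
    have yv: "y \<in> vsp P' i" "p' i y = 0" using y by (auto simp: kernel_fam_def)
    have sy: "s i y \<in> vsp P i" using s(1) yv(1) by (rule homs_closed)
    have "f i (p i (s i y)) = 0" using h(2)[OF sy] s(2)[OF yv(1)] yv(2) by simp
    then have "p i (s i y) = 0"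
      using gf[OF homs_closed[OF p(1) sy]] lin_0[OF homs_lin[OF g]] by simp
    then show ?thesis using sy by (simp add: kernel_fam_def)
  qed
  show ?thesis
  proof (rule isomorphicI)
    show "iso_pair \<Lambda> (P\<lparr>vsp := kernel_fam P p\<rparr>) (P'\<lparr>vsp := kernel_fam P' p'\<rparr>) h s"
      unfolding iso_pair_def
    proof (intro conjI allI ballI)
      show "h \<in> homs \<Lambda> (P\<lparr>vsp := kernel_fam P p\<rparr>) (P'\<lparr>vsp := kernel_fam P' p'\<rparr>)"
        by (rule homsI) (use h0 homs_arr[OF h(1)] homs_lin[OF h(1)] in \<open>auto simp: kernel_fam_def\<close>)
      show "s \<in> homs \<Lambda> (P'\<lparr>vsp := kernel_fam P' p'\<rparr>) (P\<lparr>vsp := kernel_fam P p\<rparr>)"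
        by (rule homsI) (use s0 homs_arr[OF s(1)] homs_lin[OF s(1)] in \<open>auto simp: kernel_fam_def\<close>)
    qed (use sh s(2) in \<open>auto simp: kernel_fam_def\<close>)
  qed
qed

section \<open>Syzygies of intervals\<close>

context nakayama
begin

lemma plen_nxt_pow: "a \<in> verts \<Lambda> \<Longrightarrow> plen a \<le> l + plen ((nxt \<Lambda> ^^ l) a)"
proof (induction l)
  case (Suc l)
  then show ?case using plen_nxt[of "(nxt \<Lambda> ^^ l) a"] by simp
qed simp

text \<open>The syzygy on codes: the kernel of the projective cover begins where the interval ends
  and takes up the rest of the projective. Codes of length 0 are fixed, as zero covers
  itself.\<close>

definition om :: "nat \<times> nat \<Rightarrow> nat \<times> nat" where
  "om c = (if snd c = 0 then c else ((nxt \<Lambda> ^^ snd c) (fst c), plen (fst c) - snd c))"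

text \<open>The codes of the intervals that are neither zero nor projective, that is, of those with
  a nontrivial class in \<open>K0\<close>.\<close>

definition live :: "nat \<times> nat \<Rightarrow> bool" where
  "live c \<longleftrightarrow> c \<in> codes \<and> 0 < snd c \<and> snd c < plen (fst c)"

lemma om_codes: "c \<in> codes \<Longrightarrow> om c \<in> codes"
  using plen_nxt_pow[of "fst c" "snd c"] by (auto simp: om_def codes_def)

lemma om_pow_codes: "c \<in> codes \<Longrightarrow> (om ^^ m) c \<in> codes"
  by (induction m) (auto simp: om_codes)

lemma finite_codes: "finite codes"
proof (rule finite_subset)
  show "codes \<subseteq> (SIGMA a:verts \<Lambda>. {..plen a})" by (auto simp: codes_def)
qed (auto simp: verts_def)

lemma projective_zero: "Z \<in> modules \<Lambda> \<Longrightarrow> zero_rep Z \<Longrightarrow> projective \<Lambda> Z"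
  unfolding projective_def
proof (intro conjI ballI)
  fix M N g f assume Z: "zero_rep Z" and M: "M \<in> modules \<Lambda>" and g: "g \<in> rep_epis \<Lambda> M N" and f: "f \<in> homs \<Lambda> Z N"
  then have "g i 0 = 0" "f i 0 = 0" for i by (auto simp: rep_epis_def lin_0[OF homs_lin])
  then show "\<exists>h\<in>homs \<Lambda> Z M. \<forall>i. \<forall>v\<in>vsp Z i. g i (h i v) = f i v"
    using Z by (intro bexI[OF _ zero_hom[OF M]]) (auto simp: zero_rep_def)
qed

text \<open>The relation imposed on the generator is a zero path, so it holds for every vector at a
  in every module. Hence any preimage of the image of the generator defines a lift.\<close>

lemma projective_Ivl:
  assumes a: "a \<in> verts \<Lambda>"
  shows "projective \<Lambda> (Ivl a (plen a) :: 'k::field rep)"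
  unfolding projective_def
proof (intro conjI ballI)
  note I = Ivl_module[OF a order_refl]
  show "Ivl a (plen a) \<in> modules \<Lambda>" by (rule I)
  fix M N :: "'k rep" and g f
  assume M: "M \<in> modules \<Lambda>" and N: "N \<in> modules \<Lambda>" and g: "g \<in> rep_epis \<Lambda> M N"
    and f: "f \<in> homs \<Lambda> (Ivl a (plen a)) N"
  have g': "g \<in> homs \<Lambda> M N" "\<And>i. g i ` vsp M i = vsp N i" using g by (auto simp: rep_epis_def)
  have "(unit_vec (0, 0) :: 'k amb) \<in> vsp (Ivl a (plen a)) a"
    using plen_ge[OF a] by (simp add: vsp_Ivl)
  then obtain w where w: "w \<in> vsp M a" "g a w = f a (unit_vec (0, 0))"
    using homs_closed[OF f] g'(2)[of a] by (metis imageE)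
  define h where "h = gen_hom M a (plen a) w"
  have h: "h \<in> homs \<Lambda> (Ivl a (plen a)) M"
    unfolding h_def by (rule gen_hom[OF M w(1) path_map_zero_path[OF M _ w(1)]]) (simp add: zero_path_plen[OF a])
  have "g i (h i v) = f i v" if "v \<in> vsp (Ivl a (plen a)) i" for i v
  proof (rule hom_Ivl_eqI[OF _ homs_lin[OF f] that])
    show "lin (\<lambda>v. g i (h i v))" for i by (rule lin_comp[OF homs_lin[OF g'(1)] homs_lin[OF h]])
    fix l assume l: "l < plen a"
    show "g ((nxt \<Lambda> ^^ l) a) (h ((nxt \<Lambda> ^^ l) a) (unit_vec (0, l))) = f ((nxt \<Lambda> ^^ l) a) (unit_vec (0, l))"
      using l homs_path[OF M g'(1) w(1), of l] hom_Ivl_unit[OF a order_refl f l] w(2)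
      by (simp add: h_def gen_hom_unit)
  qed
  then show "\<exists>h\<in>homs \<Lambda> (Ivl a (plen a)) M. \<forall>i. \<forall>v\<in>vsp (Ivl a (plen a)) i. g i (h i v) = f i v"
    using h by blast
qed

definition trunc :: "nat \<Rightarrow> 'k::field amb \<Rightarrow> 'k amb" where
  "trunc n w = (\<lambda>(x, l). if x = 0 \<and> l < n then w (x, l) else 0)"

lemma trunc_epi:
  assumes "n \<le> m"
  shows "(\<lambda>i. trunc n) \<in> rep_epis \<Lambda> (Ivl a m) (Ivl a n :: 'k::field rep)"
proof -
  have "(\<lambda>i. trunc n) \<in> homs \<Lambda> (Ivl a m) (Ivl a n :: 'k rep)"
  proof (rule homsI)
    show "lin (trunc n)" by (rule linI) (auto simp: trunc_def fun_eq_iff scal_apply)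
    fix i and v :: "'k amb" assume v: "v \<in> vsp (Ivl a m) i"
    show "trunc n v \<in> vsp (Ivl a n) i"
      unfolding vsp_Ivl by (rule suppI) (use Ivl_mem[OF v] in \<open>auto simp: trunc_def split: if_splits\<close>)
    show "trunc n (arr (Ivl a m) i v) = arr (Ivl a n) i (trunc n v)"
      using assms by (auto simp: fun_eq_iff trunc_def arr_Ivl)
  qed
  moreover have "trunc n ` vsp (Ivl a m) i = vsp (Ivl a n :: 'k rep) i" for i
  proof (intro equalityI subsetI)
    fix v :: "'k amb" assume v: "v \<in> vsp (Ivl a n) i"
    have "v \<in> vsp (Ivl a m) i"
      unfolding vsp_Ivl by (rule suppI) (use Ivl_mem[OF v] assms in fastforce)
    moreover have "v = trunc n v" using Ivl_mem[OF v] by (fastforce simp: fun_eq_iff trunc_def)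
    ultimately show "v \<in> trunc n ` vsp (Ivl a m) i" by blast
  next
    fix v :: "'k amb" assume "v \<in> trunc n ` vsp (Ivl a m) i"
    then show "v \<in> vsp (Ivl a n) i" using homs_closed[OF calculation] by blast
  qed
  ultimately show ?thesis by (simp add: rep_epis_def)
qed

text \<open>A section of the truncation from the projective interval would send the generator to a
  vector with coordinate 0 equal to 1. The path of length n kills the generator but, when n < plen
  a, not this vector.\<close>

lemma projective_IC_iff:
  assumes c: "c \<in> codes"
  shows "projective \<Lambda> (IC c :: 'k::field rep) \<longleftrightarrow> \<not> live c"
proof
  obtain a n where an: "c = (a, n)" "a \<in> verts \<Lambda>" "n \<le> plen a" using c by (auto simp: codes_def)
  show "projective \<Lambda> (IC c :: 'k rep)" if "\<not> live c"
  proof (cases "n = 0")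
    case True
    then show ?thesis
      using an IC_module[OF c] by (intro projective_zero) (auto simp: IC_def zero_rep_Ivl)
  next
    case False
    then show ?thesis using that c an projective_Ivl[OF an(2)] by (auto simp: IC_def live_def)
  qed
  show "\<not> live c" if P: "projective \<Lambda> (IC c :: 'k rep)"
  proof
    assume "live c"
    then have n: "0 < n" "n < plen a" using an by (auto simp: live_def)
    obtain s where s: "s \<in> homs \<Lambda> (Ivl a n) (Ivl a (plen a) :: 'k rep)"
      "\<And>i v. v \<in> vsp (Ivl a n) i \<Longrightarrow> trunc n (s i v) = v"
      using projective_section[OF _ Ivl_module[OF an(2) order_refl] trunc_epi[OF an(3)]] P
      by (auto simp: IC_def an)
    have u: "(unit_vec (0, 0) :: 'k amb) \<in> vsp (Ivl a n) a" using n by (simp add: vsp_Ivl)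
    define y where "y = s a (unit_vec (0, 0))"
    have yv: "y \<in> vsp (Ivl a (plen a)) a" unfolding y_def using s(1) u by (rule homs_closed)
    have "y (0, 0) = 1" using fun_cong[OF s(2)[OF u], of "(0, 0)"] n by (simp add: y_def trunc_def unit_vec_apply)
    moreover have "path_map \<Lambda> (Ivl a (plen a)) a n y = 0"
      using homs_path[OF Ivl_module[OF an(2,3)] s(1) u, of n] n lin_0[OF homs_lin[OF s(1)]]
      by (simp add: y_def path_Ivl_unit)
    ultimately show False
      using path_Ivl[OF vsp_Ivl_supp[OF yv], of a a n 0 n] n by simp
  qed
qed

lemma projective_dsum:
  assumes "set cs \<subseteq> codes" "\<And>c. c \<in> set cs \<Longrightarrow> \<not> live c"
  shows "projective \<Lambda> (dsum cs :: 'k::field rep)"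
  using assms
proof (induction cs)
  case Nil
  then show ?case using Ivl_module[OF one_verts, of 0] by (auto intro!: projective_zero simp: zero_rep_Ivl)
next
  case (Cons c cs)
  then have "projective \<Lambda> (IC c :: 'k rep)" "projective \<Lambda> (dsum cs :: 'k rep)"
    using projective_IC_iff[of c] by (meson list.set_intros subsetD subset_trans set_subset_Cons)+
  then show ?case by (simp add: projective_direct_sum)
qed

lemma dsum_projectiveD:
  assumes "set cs \<subseteq> codes" "projective \<Lambda> (dsum cs :: 'k::field rep)" "c \<in> set cs"
  shows "projective \<Lambda> (IC c :: 'k rep)"
  using assms
proof (induction cs)
  case (Cons d cs)
  have m: "IC d \<in> modules \<Lambda>" "dsum cs \<in> modules \<Lambda>" using Cons.prems by (auto intro: IC_module dsum_module)
  have 1: "projective \<Lambda> (IC d :: 'k rep)" using projective_summand[OF _ m] Cons.prems by simp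
  have "projective \<Lambda> (direct_sum (dsum cs) (IC d) :: 'k rep)"
    using projective_iso[OF _ direct_sum_module[OF m(2,1)] isomorphic_direct_sum_comm] Cons.prems by simp
  then have "projective \<Lambda> (dsum cs :: 'k rep)" by (rule projective_summand[OF _ m(2,1)])
  then show ?case using 1 Cons by auto
qed simp

text \<open>Together with additivity this lets the multiplicity of a live code descend to
  \<open>K0\<close>.\<close>

lemma mult_projective:
  assumes P: "projective \<Lambda> (P :: 'k::field rep)" and c: "live c"
  shows "mult c P = 0"
proof -
  note M = projective_module[OF P]
  obtain cs where cs: "set cs \<subseteq> {c \<in> codes. 0 < snd c}" "isomorphic \<Lambda> P (dsum cs)"
    using decomposition[OF M] .
  have cs': "set cs \<subseteq> codes" using cs by auto
  have c': "c \<in> codes" "0 < snd c" using c by (auto simp: live_def)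
  have "projective \<Lambda> (dsum cs :: 'k rep)" by (rule projective_iso[OF P dsum_module[OF cs'] cs(2)])
  then have "c \<notin> set cs" using dsum_projectiveD[OF cs'] projective_IC_iff[OF c'(1)] c by blast
  then have "count_list cs c = 0" by (simp add: count_list_0_iff)
  then show ?thesis using mult_iso[OF M cs(2)] mult_dsum[OF cs' c'] by simp
qed

text \<open>By nilpotency of the radical, an epimorphism whose kernel lies in the radical is a cover.\<close>

definition good_cover :: "'k::field rep \<Rightarrow> (nat \<Rightarrow> 'k amb \<Rightarrow> 'k amb) \<Rightarrow> 'k rep \<Rightarrow> bool" where
  "good_cover P p M \<longleftrightarrow> projective \<Lambda> P \<and> p \<in> rep_epis \<Lambda> P M \<and>
     (\<forall>i\<in>verts \<Lambda>. kernel_fam P p (nxt \<Lambda> i) \<subseteq> arr P i ` vsp P i)"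

text \<open>Nakayama's lemma: rewriting the second summand again and again replaces it by images of
  ever longer paths, and sufficiently long paths vanish.\<close>

lemma submodule_plus_radical:
  assumes P: "P \<in> modules \<Lambda>" and W: "W \<in> submodules \<Lambda> P"
    and cover: "\<And>i v. i \<in> verts \<Lambda> \<Longrightarrow> v \<in> vsp P (nxt \<Lambda> i) \<Longrightarrow>
      \<exists>w\<in>W (nxt \<Lambda> i). \<exists>u\<in>vsp P i. v = w + arr P i u"
  shows "W = vsp P"
proof -
  have sub: "amb.subspace (W i)" and le: "W i \<subseteq> vsp P i" for i
    using W by (auto simp: submodules_def)
  have step: "\<exists>w\<in>W i. \<exists>j\<in>verts \<Lambda>. \<exists>u\<in>vsp P j. (nxt \<Lambda> ^^ l) j = i \<and> v = w + path_map \<Lambda> P j l u"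
    if "i \<in> verts \<Lambda>" "v \<in> vsp P i" for i v l
    using that
  proof (induction l arbitrary: i v)
    case 0
    then show ?case
      by (intro bexI[of _ 0] bexI[of _ i] bexI[of _ v]) (auto simp: amb.subspace_0[OF sub])
  next
    case (Suc l)
    obtain i' where i': "i' \<in> verts \<Lambda>" "nxt \<Lambda> i' = i" using nxt_surj[OF Suc.prems(1)] .
    obtain w u where w: "w \<in> W i" and u: "u \<in> vsp P i'" "v = w + arr P i' u"
      using cover[OF i'(1)] Suc.prems(2) i'(2) by blast
    obtain w' j u' where w': "w' \<in> W i'" and j: "j \<in> verts \<Lambda>" "u' \<in> vsp P j" "(nxt \<Lambda> ^^ l) j = i'"
      "u = w' + path_map \<Lambda> P j l u'"
      using Suc.IH[OF i'(1) u(1)] by blast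
    have "arr P i' w' \<in> W i" using W w' i'(2) by (auto simp: submodules_def)
    then have "w + arr P i' w' \<in> W i" by (rule amb.subspace_add[OF sub w])
    moreover have "v = (w + arr P i' w') + path_map \<Lambda> P j (Suc l) u'"
      unfolding u(2) j(4) using j(3) by (simp add: lin_add[OF module_lin[OF P]] add.assoc del: plus_fun_apply)
    moreover have "(nxt \<Lambda> ^^ Suc l) j = i" using j(3) i'(2) by simp
    ultimately show ?case using j(1,2) by blast
  qed
  have "v \<in> W i" if v: "v \<in> vsp P i" for i v
  proof (cases "i \<in> verts \<Lambda>")
    case True
    \<comment> \<open>The length of the longest projective: all paths of this length are
      zero.\<close>
    define l where "l = Max (plen ` verts \<Lambda>)"
    have l: "plen j \<le> l" if "j \<in> verts \<Lambda>" for j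
      unfolding l_def using that by (intro Max_ge) (auto simp: verts_def)
    obtain w j u where w: "w \<in> W i" "j \<in> verts \<Lambda>" "u \<in> vsp P j" "v = w + path_map \<Lambda> P j l u"
      using step[OF True v] by blast
    have "path_map \<Lambda> P j l u = 0"
      using path_map_zero_path[OF P _ w(3)] zero_path_plen[OF w(2)] l[OF w(2)] by blast
    then show ?thesis using w by simp
  next
    case False
    then show ?thesis using v module_outside[OF P] amb.subspace_0[OF sub] by auto
  qed
  then show ?thesis using le by (intro ext equalityI subsetI) auto
qed

lemma good_cover_projective_cover:
  assumes "good_cover P p M"
  shows "projective_cover \<Lambda> P p M"
  unfolding projective_cover_def
proof (intro conjI ballI impI)
  show P: "projective \<Lambda> P" and "p \<in> rep_epis \<Lambda> P M" using assms by (auto simp: good_cover_def)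
  fix W assume W: "W \<in> submodules \<Lambda> P"
    and s: "\<forall>i. {w + u |w u. w \<in> W i \<and> u \<in> kernel_fam P p i} = vsp P i"
  show "W = vsp P"
  proof (rule submodule_plus_radical[OF projective_module[OF P] W])
    fix i v assume i: "i \<in> verts \<Lambda>" and v: "v \<in> vsp P (nxt \<Lambda> i)"
    then obtain w k where "w \<in> W (nxt \<Lambda> i)" "k \<in> kernel_fam P p (nxt \<Lambda> i)" "v = w + k"
      using s by blast
    moreover have "kernel_fam P p (nxt \<Lambda> i) \<subseteq> arr P i ` vsp P i" using assms i by (auto simp: good_cover_def)
    ultimately show "\<exists>w\<in>W (nxt \<Lambda> i). \<exists>u\<in>vsp P i. v = w + arr P i u" by blast
  qed
qed

lemma good_cover_module: "good_cover P p M \<Longrightarrow> M \<in> modules \<Lambda> \<Longrightarrow> P\<lparr>vsp := kernel_fam P p\<rparr> \<in> modules \<Lambda>"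
  unfolding good_cover_def rep_epis_def
  using submodule_module[OF projective_module kernel_submodule[OF projective_module]] by blast

lemma kernel_direct_sum:
  "(direct_sum P P')\<lparr>vsp := kernel_fam (direct_sum P P') (\<lambda>i v. merge (p i (left_part v)) (p' i (right_part v)))\<rparr>
    = direct_sum (P\<lparr>vsp := kernel_fam P p\<rparr>) (P'\<lparr>vsp := kernel_fam P' p'\<rparr>)"
proof -
  have "kernel_fam (direct_sum P P') (\<lambda>i v. merge (p i (left_part v)) (p' i (right_part v)))
    = vsp (direct_sum (P\<lparr>vsp := kernel_fam P p\<rparr>) (P'\<lparr>vsp := kernel_fam P' p'\<rparr>))"
    by (intro ext set_eqI) (auto simp: kernel_fam_def vsp_direct_sum merge_eq_0)
  then show ?thesis by (simp add: direct_sum_def)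
qed

lemma good_cover_direct_sum:
  assumes g: "good_cover P p M" "good_cover P' p' M'"
  shows "good_cover (direct_sum P P') (\<lambda>i v. merge (p i (left_part v)) (p' i (right_part v))) (direct_sum M M')"
  unfolding good_cover_def
proof (intro conjI ballI subsetI)
  have P: "projective \<Lambda> P" "p \<in> homs \<Lambda> P M" "\<And>i. p i ` vsp P i = vsp M i"
    "\<And>i. i \<in> verts \<Lambda> \<Longrightarrow> kernel_fam P p (nxt \<Lambda> i) \<subseteq> arr P i ` vsp P i"
    using g by (auto simp: good_cover_def rep_epis_def)
  have P': "projective \<Lambda> P'" "p' \<in> homs \<Lambda> P' M'" "\<And>i. p' i ` vsp P' i = vsp M' i"
    "\<And>i. i \<in> verts \<Lambda> \<Longrightarrow> kernel_fam P' p' (nxt \<Lambda> i) \<subseteq> arr P' i ` vsp P' i"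
    using g by (auto simp: good_cover_def rep_epis_def)
  show "projective \<Lambda> (direct_sum P P')" using P P' by (simp add: projective_direct_sum)
  let ?p = "\<lambda>i v. merge (p i (left_part v)) (p' i (right_part v))"
  have h: "?p \<in> homs \<Lambda> (direct_sum P P') (direct_sum M M')"
    by (rule direct_sum_homs[OF P(2) P'(2)])
  have "v \<in> ?p i ` vsp (direct_sum P P') i" if "v \<in> vsp (direct_sum M M') i" for i v
  proof -
    have v: "left_part v \<in> vsp M i" "right_part v \<in> vsp M' i" using that by (auto simp: vsp_direct_sum)
    obtain x where x: "x \<in> vsp P i" "p i x = left_part v" using v P(3)[of i] by force
    obtain y where y: "y \<in> vsp P' i" "p' i y = right_part v" using v P'(3)[of i] by force
    show ?thesis by (rule image_eqI[of _ _ "merge x y"]) (use x y in \<open>auto simp: vsp_direct_sum\<close>)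
  qed
  then show "?p \<in> rep_epis \<Lambda> (direct_sum P P') (direct_sum M M')"
    unfolding rep_epis_def using h homs_closed[OF h] by blast
  fix i v assume i: "i \<in> verts \<Lambda>" and "v \<in> kernel_fam (direct_sum P P') ?p (nxt \<Lambda> i)"
  then have "left_part v \<in> kernel_fam P p (nxt \<Lambda> i)" "right_part v \<in> kernel_fam P' p' (nxt \<Lambda> i)"
    by (auto simp: kernel_fam_def vsp_direct_sum merge_eq_0)
  then obtain x y where x: "x \<in> vsp P i" "left_part v = arr P i x" and y: "y \<in> vsp P' i" "right_part v = arr P' i y"
    using P(4)[OF i] P'(4)[OF i] by blast
  show "v \<in> arr (direct_sum P P') i ` vsp (direct_sum P P') i"
    by (rule image_eqI[of _ _ "merge x y"])
      (use x(1) y(1) in \<open>auto simp: arr_direct_sum vsp_direct_sum x(2)[symmetric] y(2)[symmetric]\<close>)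
qed

lemma good_cover_projective:
  assumes "projective \<Lambda> P"
  shows "good_cover P (\<lambda>i v. v) P" "zero_rep (P\<lparr>vsp := kernel_fam P (\<lambda>i v. v)\<rparr>)"
proof -
  have k: "kernel_fam P (\<lambda>i v. v) i = {0}" for i
    using module_0[OF projective_module[OF assms]] by (auto simp: kernel_fam_def)
  have "0 \<in> arr P i ` vsp P i" for i
    using module_0[OF projective_module[OF assms], of i] lin_0[OF module_lin[OF projective_module[OF assms]], of i]
    by (metis imageI)
  then show "good_cover P (\<lambda>i v. v) P"
    using assms by (simp add: good_cover_def k rep_epis_def homs_id)
  show "zero_rep (P\<lparr>vsp := kernel_fam P (\<lambda>i v. v)\<rparr>)" by (simp add: zero_rep_def k)
qed

lemma Ivl_arr_image:
  fixes v :: "'k::field amb"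
  assumes a: "a \<in> verts \<Lambda>" and i: "i \<in> verts \<Lambda>" and v: "v \<in> vsp (Ivl a n) (nxt \<Lambda> i)" and v0: "v (0, 0) = 0"
  shows "v \<in> arr (Ivl a n) i ` vsp (Ivl a n) i"
proof -
  define w :: "'k amb" where "w = (\<lambda>(x, l). v (x, Suc l))"
  have "w \<in> vsp (Ivl a n) i"
    unfolding vsp_Ivl
  proof (rule suppI)
    fix x l assume "w (x, l) \<noteq> 0"
    then have "v (x, Suc l) \<noteq> 0" by (simp add: w_def)
    from Ivl_mem[OF v this] show "(x, l) \<in> ivs a n i"
      using nxt_inj[OF nxt_pow_verts[OF a] i] by auto
  qed
  moreover have "v = arr (Ivl a n) i w"
  proof (rule ext)
    fix p :: "nat \<times> nat"
    obtain x l where p: "p = (x, l)" by (cases p)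
    show "v p = arr (Ivl a n) i w p"
      unfolding p arr_Ivl using Ivl_mem[OF v, of x l] v0 by (cases l; cases "v (x, l) = 0") (auto simp: w_def)
  qed
  ultimately show ?thesis by blast
qed

text \<open>The kernel of the truncation consists of the vectors whose first n coordinates vanish;
  shifting by n identifies it with the interval that starts n steps later.\<close>

lemma good_cover_Ivl:
  assumes a: "a \<in> verts \<Lambda>" and n: "0 < n" "n \<le> plen a"
  shows "good_cover (Ivl a (plen a)) (\<lambda>i. trunc n) (Ivl a n :: 'k::field rep)"
    "isomorphic \<Lambda> ((Ivl a (plen a))\<lparr>vsp := kernel_fam (Ivl a (plen a)) (\<lambda>i. trunc n)\<rparr>)
      (Ivl ((nxt \<Lambda> ^^ n) a) (plen a - n) :: 'k rep)"
proof -
  let ?P = "Ivl a (plen a) :: 'k rep" and ?b = "(nxt \<Lambda> ^^ n) a"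
  let ?J = "Ivl ?b (plen a - n) :: 'k rep"
  let ?K = "?P\<lparr>vsp := kernel_fam ?P (\<lambda>i. trunc n)\<rparr>"
  have ker: "v \<in> kernel_fam ?P (\<lambda>i. trunc n) i \<longleftrightarrow> v \<in> vsp ?P i \<and> (\<forall>l<n. v (0, l) = 0)" for v i
  proof -
    have "trunc n v = 0 \<longleftrightarrow> (\<forall>l<n. v (0, l) = 0)"
      by (auto simp: fun_eq_iff trunc_def)
    then show ?thesis by (simp add: kernel_fam_def)
  qed
  show "good_cover ?P (\<lambda>i. trunc n) (Ivl a n)"
    unfolding good_cover_def
  proof (intro conjI projective_Ivl a trunc_epi n ballI subsetI)
    fix i v assume i: "i \<in> verts \<Lambda>" and "v \<in> kernel_fam ?P (\<lambda>i. trunc n) (nxt \<Lambda> i)"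
    then have v: "v \<in> vsp ?P (nxt \<Lambda> i)" and v0: "v (0, 0) = 0" using ker n by auto
    show "v \<in> arr ?P i ` vsp ?P i" by (rule Ivl_arr_image[OF a i v v0])
  qed
  define s t :: "'k amb \<Rightarrow> 'k amb" where "s = (\<lambda>v (x, l). v (x, l + n))" and
    "t = (\<lambda>w (x, l). if n \<le> l then w (x, l - n) else 0)"
  have pow: "(nxt \<Lambda> ^^ l) ?b = (nxt \<Lambda> ^^ (l + n)) a" for l by (simp add: funpow_add)
  show "isomorphic \<Lambda> ?K ?J"
  proof (rule isomorphicI)
    show "iso_pair \<Lambda> ?K ?J (\<lambda>i. s) (\<lambda>i. t)"
      unfolding iso_pair_def
    proof (intro conjI allI ballI)
      show "(\<lambda>i. s) \<in> homs \<Lambda> ?K ?J"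
      proof (rule homsI)
        show "lin s" by (rule linI) (auto simp: s_def fun_eq_iff scal_apply)
        fix i v assume "v \<in> vsp ?K i"
        then have v: "v \<in> vsp ?P i" "\<And>l. l < n \<Longrightarrow> v (0, l) = 0" by (auto simp: ker)
        show "s v \<in> vsp ?J i"
          unfolding vsp_Ivl by (rule suppI) (use Ivl_mem[OF v(1)] in \<open>fastforce simp: s_def pow\<close>)
        show "s (arr ?K i v) = arr ?J i (s v)"
          using v(2)[of "n - 1"] n by (auto simp: fun_eq_iff s_def arr_Ivl)
      qed
      show "(\<lambda>i. t) \<in> homs \<Lambda> ?J ?K"
      proof (rule homsI)
        show "lin t" by (rule linI) (auto simp: t_def fun_eq_iff scal_apply)
        fix i w assume w: "w \<in> vsp ?J i"
        have "t w \<in> vsp ?P i"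
          unfolding vsp_Ivl
        proof (rule suppI)
          fix x l assume "t w (x, l) \<noteq> 0"
          then have "n \<le> l" "w (x, l - n) \<noteq> 0" by (auto simp: t_def split: if_splits)
          with Ivl_mem[OF w this(2)] show "(x, l) \<in> ivs a (plen a) i" by (auto simp: pow)
        qed
        then show "t w \<in> vsp ?K i" by (simp add: ker t_def)
        show "t (arr ?J i w) = arr ?K i (t w)"
          using n by (auto simp: fun_eq_iff t_def arr_Ivl)
      qed
      show "t (s v) = v" if "v \<in> vsp ?K i" for i v
      proof -
        have v: "v \<in> vsp ?P i" "\<And>l. l < n \<Longrightarrow> v (0, l) = 0" using that by (auto simp: ker)
        have "v (x, l) = 0" if "l < n" for x l using v(2)[OF that] Ivl_mem[OF v(1), of x l] by auto
        then show ?thesis by (auto simp: fun_eq_iff t_def s_def)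
      qed
      show "s (t w) = w" for w by (auto simp: fun_eq_iff t_def s_def)
    qed
  qed
qed

lemma good_cover_IC:
  assumes c: "c \<in> codes"
  obtains P p where "good_cover P p (IC c :: 'k::field rep)"
    "isomorphic \<Lambda> (P\<lparr>vsp := kernel_fam P p\<rparr>) (IC (om c))"
proof -
  obtain a n where an: "c = (a, n)" "a \<in> verts \<Lambda>" "n \<le> plen a" using c by (auto simp: codes_def)
  show thesis
  proof (cases "n = 0")
    case True
    have P: "projective \<Lambda> (IC c :: 'k rep)" using True an projective_IC_iff[OF c] by (simp add: live_def)
    have "isomorphic \<Lambda> (IC c\<lparr>vsp := kernel_fam (IC c) (\<lambda>i v. v)\<rparr>) (IC (om c) :: 'k rep)"
      by (rule isomorphic_zero[OF good_cover_module[OF good_cover_projective(1)[OF P]] IC_module[OF om_codes[OF c]]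
            good_cover_projective(2)[OF P]])
        (use True an IC_module[OF c] in \<open>auto simp: IC_def om_def zero_rep_Ivl\<close>)
    then show thesis using that good_cover_projective(1)[OF P] by blast
  next
    case False
    then show thesis using that good_cover_Ivl[OF an(2) _ an(3)] an by (auto simp: IC_def om_def)
  qed
qed

lemma good_cover_dsum:
  assumes "set cs \<subseteq> codes"
  obtains P p where "good_cover P p (dsum cs :: 'k::field rep)"
    "isomorphic \<Lambda> (P\<lparr>vsp := kernel_fam P p\<rparr>) (dsum (map om cs))"
proof -
  have "\<exists>P p. good_cover P p (dsum cs :: 'k rep) \<and> isomorphic \<Lambda> (P\<lparr>vsp := kernel_fam P p\<rparr>) (dsum (map om cs))"
    using assms
  proof (induction cs)
    case Nil
    have "(1, 0) \<in> codes" using one_verts by (simp add: codes_def)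
    from good_cover_IC[OF this] show ?case by (metis IC_def dsum.simps(1) fst_conv list.map(1) om_def snd_conv)
  next
    case (Cons c cs)
    then obtain P p where P: "good_cover P p (dsum cs :: 'k rep)"
      "isomorphic \<Lambda> (P\<lparr>vsp := kernel_fam P p\<rparr>) (dsum (map om cs))" by auto
    have c: "c \<in> codes" "dsum cs \<in> modules \<Lambda>" using Cons.prems dsum_module by auto
    obtain Q q where Q: "good_cover Q q (IC c :: 'k rep)"
      "isomorphic \<Lambda> (Q\<lparr>vsp := kernel_fam Q q\<rparr>) (IC (om c))" using good_cover_IC[OF c(1)] .
    have "isomorphic \<Lambda> (direct_sum (Q\<lparr>vsp := kernel_fam Q q\<rparr>) (P\<lparr>vsp := kernel_fam P p\<rparr>)) (dsum (map om (c # cs)))"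
      using isomorphic_direct_sum[OF Q(2) P(2) good_cover_module[OF Q(1) IC_module[OF c(1)]] good_cover_module[OF P(1) c(2)]]
      by simp
    then have "isomorphic \<Lambda> ((direct_sum Q P)\<lparr>vsp := kernel_fam (direct_sum Q P)
        (\<lambda>i v. merge (q i (left_part v)) (p i (right_part v)))\<rparr>) (dsum (map om (c # cs)))"
      by (simp only: kernel_direct_sum)
    with good_cover_direct_sum[OF Q(1) P(1)] show ?case
      unfolding dsum.simps(2) by blast
  qed
  then show thesis using that by blast
qed

lemma good_cover_iso:
  assumes P: "good_cover P p M" and M: "M \<in> modules \<Lambda>" and iso: "isomorphic \<Lambda> M N"
  obtains q where "good_cover P q N" "kernel_fam P q = kernel_fam P p"
proof -
  obtain f g where fg: "iso_pair \<Lambda> M N f g" using isomorphicE[OF iso M] .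
  then have f: "f \<in> homs \<Lambda> M N" and g: "g \<in> homs \<Lambda> N M" and gf: "\<And>i v. v \<in> vsp M i \<Longrightarrow> g i (f i v) = v"
    and fg: "\<And>i v. v \<in> vsp N i \<Longrightarrow> f i (g i v) = v"
    by (auto simp: iso_pair_def)
  have p: "p \<in> homs \<Lambda> P M" "\<And>i. p i ` vsp P i = vsp M i" using P by (auto simp: good_cover_def rep_epis_def)
  have "f i (p i v) = 0 \<longleftrightarrow> p i v = 0" if "v \<in> vsp P i" for i v
    using gf[OF homs_closed[OF p(1) that]] lin_0[OF homs_lin[OF f]] lin_0[OF homs_lin[OF g]] by metis
  then have k: "kernel_fam P (\<lambda>i v. f i (p i v)) = kernel_fam P p"
    by (auto simp: kernel_fam_def fun_eq_iff)
  have "(\<lambda>v. f i (p i v)) ` vsp P i = vsp N i" for i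
  proof -
    have "(\<lambda>v. f i (p i v)) ` vsp P i = f i ` vsp M i" unfolding p(2)[of i, symmetric] image_image ..
    also have "\<dots> = vsp N i"
    proof (intro equalityI subsetI)
      fix v assume "v \<in> vsp N i"
      then show "v \<in> f i ` vsp M i" using fg[of v i] homs_closed[OF g, of v i] by (metis imageI)
    qed (use homs_closed[OF f] in auto)
    finally show ?thesis .
  qed
  then have "good_cover P (\<lambda>i v. f i (p i v)) N"
    using P k homs_comp[OF p(1) f] by (simp add: good_cover_def rep_epis_def)
  then show thesis using that k by blast
qed

lemma good_cover_exists:
  assumes "M \<in> modules \<Lambda>" obtains P p where "good_cover P p M"
proof -
  obtain cs where cs: "set cs \<subseteq> {c \<in> codes. 0 < snd c}" "isomorphic \<Lambda> M (dsum cs)"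
    using decomposition[OF assms] .
  then have cs': "set cs \<subseteq> codes" by auto
  obtain P p where "good_cover P p (dsum cs :: 'a rep)" using good_cover_dsum[OF cs'] .
  from good_cover_iso[OF this dsum_module[OF cs'] isomorphic_sym[OF cs(2) assms]] show thesis using that by blast
qed

section \<open>The syzygy as an operation up to isomorphism\<close>

lemma Syz_cover:
  assumes "M \<in> modules \<Lambda>"
  obtains P p where "projective_cover \<Lambda> P p M" "Syz \<Lambda> M = P\<lparr>vsp := kernel_fam P p\<rparr>"
proof -
  have "\<exists>K P p. projective_cover \<Lambda> P p M \<and> K = P\<lparr>vsp := kernel_fam P p\<rparr>"
    using good_cover_exists[OF assms] good_cover_projective_cover by metis
  then have "\<exists>P p. projective_cover \<Lambda> P p M \<and> Syz \<Lambda> M = P\<lparr>vsp := kernel_fam P p\<rparr>"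
    unfolding Syz_def by (rule someI_ex)
  then show thesis using that by blast
qed

lemma Syz_module: "M \<in> modules \<Lambda> \<Longrightarrow> Syz \<Lambda> M \<in> modules \<Lambda>"
proof -
  assume M: "M \<in> modules \<Lambda>"
  obtain P p where P: "projective_cover \<Lambda> P p M" "Syz \<Lambda> M = P\<lparr>vsp := kernel_fam P p\<rparr>" using Syz_cover[OF M] .
  then have "p \<in> homs \<Lambda> P M" "projective \<Lambda> P" by (auto simp: projective_cover_def rep_epis_def)
  then show ?thesis
    unfolding P(2) by (intro submodule_module kernel_submodule[OF _ M] projective_module)
qed

lemma Syz_pow_module: "M \<in> modules \<Lambda> \<Longrightarrow> (Syz \<Lambda> ^^ m) M \<in> modules \<Lambda>"
  by (induction m) (auto simp: Syz_module)

lemma Syz_good_cover: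
  assumes M: "M \<in> modules \<Lambda>" and g: "good_cover P p M"
  shows "isomorphic \<Lambda> (Syz \<Lambda> M) (P\<lparr>vsp := kernel_fam P p\<rparr>)"
proof -
  obtain Q q where Q: "projective_cover \<Lambda> Q q M" "Syz \<Lambda> M = Q\<lparr>vsp := kernel_fam Q q\<rparr>" using Syz_cover[OF M] .
  show ?thesis
    unfolding Q(2) by (rule projective_cover_kernel_iso[OF Q(1) good_cover_projective_cover[OF g] M M isomorphic_refl])
qed

lemma Syz_cong:
  assumes M: "M \<in> modules \<Lambda>" and N: "N \<in> modules \<Lambda>" and iso: "isomorphic \<Lambda> M N"
  shows "isomorphic \<Lambda> (Syz \<Lambda> M) (Syz \<Lambda> N)"
proof -
  obtain P p where P: "projective_cover \<Lambda> P p M" "Syz \<Lambda> M = P\<lparr>vsp := kernel_fam P p\<rparr>" using Syz_cover[OF M] .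
  obtain Q q where Q: "projective_cover \<Lambda> Q q N" "Syz \<Lambda> N = Q\<lparr>vsp := kernel_fam Q q\<rparr>" using Syz_cover[OF N] .
  show ?thesis unfolding P(2) Q(2) by (rule projective_cover_kernel_iso[OF P(1) Q(1) M N iso])
qed

lemma Syz_pow_cong:
  assumes M: "M \<in> modules \<Lambda>" and N: "N \<in> modules \<Lambda>" and iso: "isomorphic \<Lambda> M N"
  shows "isomorphic \<Lambda> ((Syz \<Lambda> ^^ m) M) ((Syz \<Lambda> ^^ m) N)"
  by (induction m) (use assms in \<open>auto intro: Syz_cong Syz_pow_module\<close>)

text \<open>A sum of good covers is a good cover, and its kernel equals the sum of the kernels as a
  representation, not only up to isomorphism.\<close>

lemma Syz_direct_sum:
  assumes A: "A \<in> modules \<Lambda>" and B: "B \<in> modules \<Lambda>"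
  shows "isomorphic \<Lambda> (Syz \<Lambda> (direct_sum A B)) (direct_sum (Syz \<Lambda> A) (Syz \<Lambda> B))"
proof -
  obtain P p where P: "good_cover P p A" using good_cover_exists[OF A] .
  obtain Q q where Q: "good_cover Q q B" using good_cover_exists[OF B] .
  have "isomorphic \<Lambda> (Syz \<Lambda> (direct_sum A B)) (direct_sum (P\<lparr>vsp := kernel_fam P p\<rparr>) (Q\<lparr>vsp := kernel_fam Q q\<rparr>))"
    using Syz_good_cover[OF direct_sum_module[OF A B] good_cover_direct_sum[OF P Q]]
    by (simp only: kernel_direct_sum)
  moreover have "isomorphic \<Lambda> (direct_sum (P\<lparr>vsp := kernel_fam P p\<rparr>) (Q\<lparr>vsp := kernel_fam Q q\<rparr>))
      (direct_sum (Syz \<Lambda> A) (Syz \<Lambda> B))"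
    by (intro isomorphic_direct_sum isomorphic_sym[OF Syz_good_cover] good_cover_module[OF P A]
        good_cover_module[OF Q B] P Q A B Syz_module)
  ultimately show ?thesis by (rule isomorphic_trans)
qed

lemma Syz_projective: "projective \<Lambda> P \<Longrightarrow> projective \<Lambda> (Syz \<Lambda> P)"
proof -
  assume P: "projective \<Lambda> P"
  note M = projective_module[OF P]
  have "isomorphic \<Lambda> (P\<lparr>vsp := kernel_fam P (\<lambda>i v. v)\<rparr>) (Syz \<Lambda> P)"
    by (rule isomorphic_sym[OF Syz_good_cover[OF M good_cover_projective(1)[OF P]] Syz_module[OF M]])
  then show ?thesis
    by (rule projective_iso[OF projective_zero[OF good_cover_module[OF good_cover_projective(1)[OF P] M]
          good_cover_projective(2)[OF P]] Syz_module[OF M]])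
qed

lemma Syz_pow_dsum:
  assumes "set cs \<subseteq> codes"
  shows "isomorphic \<Lambda> ((Syz \<Lambda> ^^ m) (dsum cs :: 'k::field rep)) (dsum (map (om ^^ m) cs))"
proof (induction m)
  case 0
  then show ?case by (simp add: isomorphic_refl)
next
  case (Suc m)
  let ?cs = "map (om ^^ m) cs"
  have cs: "set ?cs \<subseteq> codes" using assms om_pow_codes by auto
  note D = dsum_module[OF cs]
  obtain P p where P: "good_cover P p (dsum ?cs :: 'k rep)"
    "isomorphic \<Lambda> (P\<lparr>vsp := kernel_fam P p\<rparr>) (dsum (map om ?cs))" using good_cover_dsum[OF cs] .
  have "isomorphic \<Lambda> (Syz \<Lambda> ((Syz \<Lambda> ^^ m) (dsum cs :: 'k rep))) (Syz \<Lambda> (dsum ?cs))"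
    by (rule Syz_cong[OF Syz_pow_module[OF dsum_module[OF assms]] D Suc.IH])
  moreover have "isomorphic \<Lambda> (Syz \<Lambda> (dsum ?cs :: 'k rep)) (dsum (map om ?cs))"
    by (rule isomorphic_trans[OF Syz_good_cover[OF D P(1)] P(2)])
  ultimately have "isomorphic \<Lambda> (Syz \<Lambda> ((Syz \<Lambda> ^^ m) (dsum cs :: 'k rep))) (dsum (map om ?cs))"
    by (rule isomorphic_trans)
  then show ?case by (simp add: comp_def)
qed

lemma Syz_pow_IC:
  assumes "c \<in> codes"
  shows "isomorphic \<Lambda> ((Syz \<Lambda> ^^ m) (IC c :: 'k::field rep)) (IC ((om ^^ m) c))"
proof -
  have d: "isomorphic \<Lambda> (dsum [e] :: 'k rep) (IC e)" "dsum [e] \<in> modules \<Lambda>" if "e \<in> codes" for e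
  proof -
    have "zero_rep (Ivl 1 0 :: 'k rep)" "Ivl 1 0 \<in> modules \<Lambda>"
      using one_verts by (auto simp: zero_rep_Ivl Ivl_module)
    then show "isomorphic \<Lambda> (dsum [e] :: 'k rep) (IC e)"
      using isomorphic_direct_sum_zero[OF IC_module[OF that]] by simp
    show "dsum [e] \<in> modules \<Lambda>" using that by (intro dsum_module) auto
  qed
  have "isomorphic \<Lambda> ((Syz \<Lambda> ^^ m) (IC c :: 'k rep)) ((Syz \<Lambda> ^^ m) (dsum [c]))"
    by (rule Syz_pow_cong[OF IC_module[OF assms] d(2)[OF assms] isomorphic_sym[OF d[OF assms]]])
  moreover have "isomorphic \<Lambda> ((Syz \<Lambda> ^^ m) (dsum [c] :: 'k rep)) (dsum [(om ^^ m) c])"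
    using Syz_pow_dsum[of "[c]" m] assms by simp
  ultimately show ?thesis
    using isomorphic_trans[OF isomorphic_trans d(1)[OF om_pow_codes[OF assms]]] by blast
qed

end

section \<open>Ranks of subgroups\<close>

lemma hom_finprod:
  assumes G: "comm_group G" and H: "comm_group H" and h: "h \<in> hom G H"
    and f: "f \<in> A \<rightarrow> carrier G"
  shows "h (finprod G f A) = finprod H (\<lambda>a. h (f a)) A"
proof -
  interpret G: comm_group G by (rule G)
  interpret H: comm_group H by (rule H)
  interpret group_hom G H h by unfold_locales (rule h)
  show ?thesis
    using f
  proof (induction A rule: infinite_finite_induct)
    case (insert a A)
    then have fA: "f \<in> A \<rightarrow> carrier G" "f a \<in> carrier G" by auto
    then have "(\<lambda>a. h (f a)) \<in> A \<rightarrow> carrier H" "h (f a) \<in> carrier H" by (auto intro: hom_closed)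
    note this fA
    with insert show ?case by (simp add: G.finprod_insert H.finprod_insert)
  qed simp_all
qed

lemma le_subgroup_rank:
  assumes "B \<subseteq> H" "int_independent G B"
  shows "enat (card B) \<le> subgroup_rank G H"
  unfolding subgroup_rank_def by (rule SUP_upper) (use assms in auto)

lemma subgroup_rank_le:
  assumes "\<And>B. B \<subseteq> H \<Longrightarrow> int_independent G B \<Longrightarrow> card B \<le> n"
  shows "subgroup_rank G H \<le> enat n"
  unfolding subgroup_rank_def by (rule SUP_least) (use assms in auto)

context comm_group
begin

text \<open>Applying to a relation a homomorphism that vanishes on all members of B except b
  isolates the coefficient of b.\<close>

lemma int_independent_homs:
  assumes B: "B \<subseteq> carrier G" "finite B"
    and f: "\<And>b. b \<in> B \<Longrightarrow> \<exists>f\<in>hom G integer_group. f b \<noteq> 0 \<and> (\<forall>b'\<in>B. b' \<noteq> b \<longrightarrow> f b' = 0)"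
  shows "int_independent G B"
  unfolding int_independent_def
proof (intro conjI B allI impI ballI)
  fix c :: "_ \<Rightarrow> int" and b
  assume c: "finprod G (\<lambda>b. b [^] c b) B = \<one>" and b: "b \<in> B"
  obtain f where f: "f \<in> hom G integer_group" "f b \<noteq> 0" "\<And>b'. b' \<in> B \<Longrightarrow> b' \<noteq> b \<Longrightarrow> f b' = 0"
    using assms(3)[OF b] by blast
  interpret Z: comm_group integer_group by (rule abelian_integer_group)
  interpret f: group_hom G integer_group f by unfold_locales (rule f(1))
  have p: "f (x [^] k) = k * f x" if "x \<in> carrier G" for x and k :: int
    using f.hom_int_pow[OF that] by simp
  have z: "finprod integer_group (\<lambda>b'. f (b' [^] c b')) (B - {b}) = 0"
  proof -
    have "f (b' [^] c b') = \<one>\<^bsub>integer_group\<^esub>" if "b' \<in> B - {b}" for b'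
      using that p f(3) B by auto
    then have "finprod integer_group (\<lambda>b'. f (b' [^] c b')) (B - {b}) = \<one>\<^bsub>integer_group\<^esub>"
      by (rule Z.finprod_one_eqI)
    then show ?thesis by (simp only: one_integer_group)
  qed
  have "0 = f (finprod G (\<lambda>b. b [^] c b) B)" using c f.hom_one by simp
  also have "\<dots> = finprod integer_group (\<lambda>b'. f (b' [^] c b')) B"
    by (rule hom_finprod[OF comm_group_axioms abelian_integer_group f(1)]) (use B in auto)
  also have "B = insert b (B - {b})" using b by auto
  also have "finprod integer_group (\<lambda>b'. f (b' [^] c b')) (insert b (B - {b})) = f (b [^] c b)"
    using B by (subst Z.finprod_insert) (auto simp: z)
  also have "\<dots> = c b * f b" using p b B by auto
  finally show "c b = 0" using f(2) by simp
qed

lemma subgroup_rank_trivial: "subgroup_rank G {\<one>} = 0"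
proof -
  have "subgroup_rank G {\<one>} \<le> enat 0"
  proof (rule subgroup_rank_le)
    fix B assume B: "B \<subseteq> {\<one>}" "int_independent G B"
    \<comment> \<open>The neutral element satisfies a relation with coefficient 1, so an independent
      subset has to be empty.\<close>
    have "finprod G (\<lambda>b. b [^] (1 :: int)) B = \<one>"
      using B(1) by (intro finprod_one_eqI) auto
    then have "\<forall>b\<in>B. (\<lambda>b. 1 :: int) b = 0"
      using B(2)[unfolded int_independent_def, THEN conjunct2, rule_format, of "\<lambda>b. 1"] by blast
    then show "card B \<le> 0" by auto
  qed
  then show ?thesis by (simp add: zero_enat_def[symmetric])
qed

lemma subgroup_rank_cyclic:
  assumes x: "x \<in> carrier G"
  shows "subgroup_rank G (generate G {x}) \<le> 1"
proof -
  have "subgroup_rank G (generate G {x}) \<le> enat 1"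
  proof (rule subgroup_rank_le, rule ccontr)
    fix B assume B: "B \<subseteq> generate G {x}" "int_independent G B" and "\<not> card B \<le> 1"
    then have fin: "finite B" by (simp add: int_independent_def)
    obtain b b' where b: "b \<in> B" "b' \<in> B" "b \<noteq> b'"
      using \<open>\<not> card B \<le> 1\<close> fin by (metis card_le_Suc0_iff_eq One_nat_def)
    obtain m n :: int where mn: "b = x [^] m" "b' = x [^] n"
      using B(1) b generate_pow[OF x] by blast
    have carr: "B \<subseteq> carrier G" using B(1) generate_incl[of "{x}"] x by blast
    \<comment> \<open>Two powers of x with exponents m and n satisfy the relation with coefficients
      n and - m; if both coefficients vanish, the two powers coincide.\<close>
    define c :: "_ \<Rightarrow> int" where "c = (\<lambda>y. if y = b then n else if y = b' then - m else 0)"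
    have "finprod G (\<lambda>y. y [^] c y) B = finprod G (\<lambda>y. y [^] c y) {b, b'}"
      by (rule finprod_mono_neutral_cong_right) (use fin b carr in \<open>auto simp: c_def\<close>)
    also have "\<dots> = b [^] n \<otimes> b' [^] (- m)"
      using b carr by (subst finprod_insert) (auto simp: c_def)
    also have "\<dots> = x [^] (m * n) \<otimes> x [^] (n * (- m))"
      using x by (simp only: mn int_pow_pow)
    also have "\<dots> = \<one>" using x by (simp add: int_pow_mult[symmetric])
    finally have zero: "\<forall>y\<in>B. c y = 0" using B(2) by (simp add: int_independent_def)
    have "c b = n" "c b' = - m" using b(3) by (auto simp: c_def)
    then have "n = 0" "m = 0" using zero b by auto
    then show False using mn b(3) by simp
  qed
  then show ?thesis by (simp add: one_enat_def)
qed

text \<open>Injectivity is asked on H alone, since the operator on \<open>K0\<close> to which this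
  is applied becomes injective only on the image of one of its powers.\<close>

lemma subgroup_rank_hom_image:
  assumes L: "L \<in> hom G G" and H: "subgroup H G" and inj: "inj_on L H"
  shows "subgroup_rank G (L ` H) = subgroup_rank G H"
proof (rule antisym)
  interpret L: group_hom G G L by unfold_locales (rule L)
  have HG: "H \<subseteq> carrier G" using H by (rule subgroup.subset)
  have prod: "L (finprod G (\<lambda>b. b [^] c b) B) = finprod G (\<lambda>b. L b [^] c b) B"
    if "B \<subseteq> H" for B and c :: "_ \<Rightarrow> int"
  proof -
    have "L (finprod G (\<lambda>b. b [^] c b) B) = finprod G (\<lambda>b. L (b [^] c b)) B"
      by (rule hom_finprod[OF comm_group_axioms comm_group_axioms L]) (use that HG in auto)
    also have "\<dots> = finprod G (\<lambda>b. L b [^] c b) B"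
      by (rule finprod_cong') (use that HG in \<open>auto simp: L.hom_int_pow\<close>)
    finally show ?thesis .
  qed
  have reindex: "finprod G (\<lambda>b. b [^] c b) (L ` B) = L (finprod G (\<lambda>b. b [^] c (L b)) B)"
    if B: "B \<subseteq> H" for B and c :: "_ \<Rightarrow> int"
    unfolding prod[OF B]
    by (rule finprod_reindex) (use B HG inj in \<open>auto intro: inj_on_subset\<close>)
  have ind: "int_independent G (L ` B) \<longleftrightarrow> int_independent G B" if B: "B \<subseteq> H" for B
  proof
    have fin: "finite (L ` B) \<longleftrightarrow> finite B" by (rule finite_image_iff[OF inj_on_subset[OF inj B]])
    {
      assume i: "int_independent G B"
      show "int_independent G (L ` B)"
        unfolding int_independent_def
      proof (intro conjI allI impI)
        show "finite (L ` B)" using i fin by (simp add: int_independent_def)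
        fix c :: "_ \<Rightarrow> int" assume c: "finprod G (\<lambda>b. b [^] c b) (L ` B) = \<one>"
        have "finprod G (\<lambda>b. b [^] c (L b)) B \<in> H"
          using B
        proof (induction B rule: infinite_finite_induct)
          case (insert b B)
          have "b [^] c (L b) \<in> H" using insert.prems subgroup_int_pow_closed[OF H] by auto
          moreover have "finprod G (\<lambda>b. b [^] c (L b)) (insert b B) = b [^] c (L b) \<otimes> finprod G (\<lambda>b. b [^] c (L b)) B"
            using insert HG by (intro finprod_insert) auto
          ultimately show ?case using insert subgroup.m_closed[OF H] by auto
        qed (simp_all add: subgroup.one_closed[OF H])
        moreover have "L (finprod G (\<lambda>b. b [^] c (L b)) B) = L \<one>" using c reindex[OF B] by simp
        ultimately have "finprod G (\<lambda>b. b [^] c (L b)) B = \<one>"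
          using inj subgroup.one_closed[OF H] by (meson inj_onD)
        then have "\<forall>b\<in>B. c (L b) = 0"
          using i[unfolded int_independent_def, THEN conjunct2, rule_format, of "\<lambda>b. c (L b)"] by blast
        then show "\<forall>b\<in>L ` B. c b = 0" by blast
      qed
    }
    {
      assume i: "int_independent G (L ` B)"
      show "int_independent G B"
        unfolding int_independent_def
      proof (intro conjI allI impI)
        show "finite B" using i fin by (simp add: int_independent_def)
        fix c :: "_ \<Rightarrow> int" assume c: "finprod G (\<lambda>b. b [^] c b) B = \<one>"
        define d where "d = (\<lambda>y. c (inv_into B L y))"
        have d: "d (L b) = c b" if "b \<in> B" for b
          unfolding d_def using inv_into_f_f[OF inj_on_subset[OF inj B] that] by simp
        have "finprod G (\<lambda>b. b [^] d (L b)) B = finprod G (\<lambda>b. b [^] c b) B"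
          by (rule finprod_cong') (use B HG d in auto)
        then have "finprod G (\<lambda>b. b [^] d b) (L ` B) = \<one>"
          using reindex[OF B] c by simp
        then have "\<forall>b\<in>L ` B. d b = 0" using i unfolding int_independent_def by blast
        then show "\<forall>b\<in>B. c b = 0" using d by simp
      qed
    }
  qed
  show "subgroup_rank G (L ` H) \<le> subgroup_rank G H"
    unfolding subgroup_rank_def[of G "L ` H"]
  proof (rule SUP_least)
    fix B' assume "B' \<in> {B. B \<subseteq> L ` H \<and> int_independent G B}"
    then obtain B where B: "B \<subseteq> H" "B' = L ` B" "int_independent G B'" by (auto simp: subset_image_iff)
    then have "card B' = card B" using card_image[OF inj_on_subset[OF inj]] by blast
    then show "enat (card B') \<le> subgroup_rank G H"
      using le_subgroup_rank[OF B(1)] ind B by simp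
  qed
  show "subgroup_rank G H \<le> subgroup_rank G (L ` H)"
    unfolding subgroup_rank_def[of G H]
  proof (rule SUP_least)
    fix B assume "B \<in> {B. B \<subseteq> H \<and> int_independent G B}"
    then have B: "B \<subseteq> H" "int_independent G B" by auto
    then have "card (L ` B) = card B" using card_image[OF inj_on_subset[OF inj]] by blast
    then show "enat (card B) \<le> subgroup_rank G (L ` H)"
      using le_subgroup_rank[of "L ` B" "L ` H" G] ind B by (metis image_mono)
  qed
qed

end

section \<open>The group \<open>K\<^sub>0\<close>\<close>

context nakayama
begin

abbreviation FA :: "('k::field rep \<Rightarrow>\<^sub>0 int) monoid" where
  "FA \<equiv> free_Abelian_group (modules \<Lambda>)"

lemma K0_rels_carrier: "K0_rels \<Lambda> \<subseteq> carrier (FA :: ('k::field rep \<Rightarrow>\<^sub>0 int) monoid)"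
proof
  fix x :: "'k rep \<Rightarrow>\<^sub>0 int" assume "x \<in> K0_rels \<Lambda>"
  then consider A B C where "x = frag_of C - (frag_of A + frag_of B)"
      "A \<in> modules \<Lambda>" "B \<in> modules \<Lambda>" "C \<in> modules \<Lambda>"
    | P where "x = frag_of P" "P \<in> modules \<Lambda>"
    unfolding K0_rels_def using projective_module by blast
  then show "x \<in> carrier FA"
  proof cases
    case 1
    have "Poly_Mapping.keys x \<subseteq> {C} \<union> ({A} \<union> {B})"
      unfolding 1(1) using keys_diff[of "frag_of C" "frag_of A + frag_of B"]
        Poly_Mapping.keys_add[of "frag_of A" "frag_of B"] by auto
    then show ?thesis using 1 by auto
  qed auto
qed

lemma K0_ker_subgroup: "subgroup (K0_ker \<Lambda>) (FA :: ('k::field rep \<Rightarrow>\<^sub>0 int) monoid)"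
  unfolding K0_ker_def
  by (rule group.generate_is_subgroup[OF group_free_Abelian_group K0_rels_carrier])

lemma K0_ker_normal: "K0_ker \<Lambda> \<lhd> (FA :: ('k::field rep \<Rightarrow>\<^sub>0 int) monoid)"
  by (rule comm_group.subgroup_imp_normal[OF abelian_free_Abelian_group K0_ker_subgroup])

lemma K0_comm_group: "comm_group (K0 \<Lambda> :: ('k::field rep \<Rightarrow>\<^sub>0 int) set monoid)"
  unfolding K0_def by (rule comm_group.abelian_FactGroup[OF abelian_free_Abelian_group K0_ker_subgroup])

definition proj :: "('k::field rep \<Rightarrow>\<^sub>0 int) \<Rightarrow> ('k rep \<Rightarrow>\<^sub>0 int) set" where
  "proj x = K0_ker \<Lambda> #>\<^bsub>FA\<^esub> x"

lemma proj_hom: "proj \<in> hom FA (K0 \<Lambda> :: ('k::field rep \<Rightarrow>\<^sub>0 int) set monoid)"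
  unfolding proj_def[abs_def] K0_def by (rule normal.r_coset_hom_Mod[OF K0_ker_normal])

lemma proj_group_hom: "group_hom FA (K0 \<Lambda> :: ('k::field rep \<Rightarrow>\<^sub>0 int) set monoid) proj"
  by (intro group_hom.intro group_hom_axioms.intro proj_hom group_free_Abelian_group
      comm_group.axioms(2)[OF K0_comm_group])

lemma K0_class_proj: "K0_class \<Lambda> M = proj (frag_of M)"
  by (simp add: K0_class_def proj_def)

lemma carrier_K0: "carrier (K0 \<Lambda> :: ('k::field rep \<Rightarrow>\<^sub>0 int) set monoid) = proj ` carrier FA"
  by (simp only: K0_def carrier_FactGroup proj_def[abs_def])

lemma K0_class_carrier: "M \<in> modules \<Lambda> \<Longrightarrow> K0_class \<Lambda> M \<in> carrier (K0 \<Lambda>)"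
  unfolding K0_class_proj carrier_K0 by (intro imageI) simp

lemma proj_rel:
  assumes "x \<in> K0_rels \<Lambda>"
  shows "proj x = \<one>\<^bsub>K0 \<Lambda>\<^esub>"
proof -
  have "x \<in> K0_ker \<Lambda>" unfolding K0_ker_def using assms by (rule generate.incl)
  then have "proj x = K0_ker \<Lambda>"
    unfolding proj_def by (rule subgroup.rcos_const[OF K0_ker_subgroup group_free_Abelian_group])
  then show ?thesis by (simp add: K0_def FactGroup_def)
qed

lemma K0_class_projective: "projective \<Lambda> P \<Longrightarrow> K0_class \<Lambda> P = \<one>\<^bsub>K0 \<Lambda>\<^esub>"
  unfolding K0_class_proj by (rule proj_rel) (auto simp: K0_rels_def)

lemma K0_class_direct_sum:
  assumes "A \<in> modules \<Lambda>" "B \<in> modules \<Lambda>" "C \<in> modules \<Lambda>" "isomorphic \<Lambda> C (direct_sum A B)"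
  shows "K0_class \<Lambda> C = K0_class \<Lambda> A \<otimes>\<^bsub>K0 \<Lambda>\<^esub> K0_class \<Lambda> B"
proof -
  interpret K: comm_group "K0 \<Lambda>" by (rule K0_comm_group)
  let ?d = "frag_of C - (frag_of A + frag_of B)"
  have r: "?d \<in> K0_rels \<Lambda>" using assms by (auto simp: K0_rels_def)
  have d: "?d \<in> carrier FA" using r K0_rels_carrier by blast
  have AB: "frag_of A \<in> carrier FA" "frag_of B \<in> carrier FA" using assms by auto
  then have ab: "frag_of A + frag_of B \<in> carrier FA"
    by (metis group.subgroup_self group_free_Abelian_group mult_free_Abelian_group subgroup.m_closed)
  have "proj (frag_of C) = proj (?d \<otimes>\<^bsub>FA\<^esub> (frag_of A \<otimes>\<^bsub>FA\<^esub> frag_of B))" by simp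
  also have "\<dots> = proj ?d \<otimes>\<^bsub>K0 \<Lambda>\<^esub> proj (frag_of A \<otimes>\<^bsub>FA\<^esub> frag_of B)"
    by (rule hom_mult[OF proj_hom d]) (use ab in simp)
  also have "proj (frag_of A \<otimes>\<^bsub>FA\<^esub> frag_of B) = proj (frag_of A) \<otimes>\<^bsub>K0 \<Lambda>\<^esub> proj (frag_of B)"
    by (rule hom_mult[OF proj_hom AB])
  also have "proj ?d = \<one>\<^bsub>K0 \<Lambda>\<^esub>" by (rule proj_rel[OF r])
  finally show ?thesis
    using assms K0_class_carrier[of A] K0_class_carrier[of B] by (simp add: K0_class_proj)
qed

lemma K0_class_iso:
  assumes "M \<in> modules \<Lambda>" "N \<in> modules \<Lambda>" "isomorphic \<Lambda> M N"
  shows "K0_class \<Lambda> M = K0_class \<Lambda> N"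
proof -
  interpret K: comm_group "K0 \<Lambda>" by (rule K0_comm_group)
  let ?Z = "Ivl 1 0 :: 'a rep"
  have Z: "?Z \<in> modules \<Lambda>" "zero_rep ?Z" using one_verts by (auto simp: Ivl_module zero_rep_Ivl)
  have "isomorphic \<Lambda> N (direct_sum N ?Z)"
    by (rule isomorphic_sym[OF isomorphic_direct_sum_zero[OF assms(2) Z] direct_sum_module[OF assms(2) Z(1)]])
  then have "isomorphic \<Lambda> M (direct_sum N ?Z)" using assms(3) isomorphic_trans by blast
  from K0_class_direct_sum[OF assms(2) Z(1) assms(1) this] show ?thesis
    using K0_class_projective[OF projective_zero[OF Z]] K0_class_carrier[OF assms(2)] by simp
qed

text \<open>The universal property of \<open>K0\<close>: both kinds of defining relations lie in the
  kernel of the induced homomorphism on the free group.\<close>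

lemma K0_hom_exists:
  fixes F :: "'k::field rep \<Rightarrow> 'h"
  assumes H: "comm_group H" and F: "\<And>M. M \<in> modules \<Lambda> \<Longrightarrow> F M \<in> carrier H"
    and add: "\<And>A B C. A \<in> modules \<Lambda> \<Longrightarrow> B \<in> modules \<Lambda> \<Longrightarrow> C \<in> modules \<Lambda> \<Longrightarrow>
      isomorphic \<Lambda> C (direct_sum A B) \<Longrightarrow> F C = F A \<otimes>\<^bsub>H\<^esub> F B"
    and proj: "\<And>P. projective \<Lambda> P \<Longrightarrow> F P = \<one>\<^bsub>H\<^esub>"
  obtains g where "g \<in> hom (K0 \<Lambda>) H" "\<And>M. M \<in> modules \<Lambda> \<Longrightarrow> g (K0_class \<Lambda> M) = F M"
proof -
  interpret H: comm_group H by (rule H)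
  obtain h where h: "h \<in> hom FA H" "\<And>M. M \<in> modules \<Lambda> \<Longrightarrow> h (frag_of M) = F M"
    using H.free_Abelian_group_universal[of F "modules \<Lambda>"] F by blast
  interpret h: group_hom FA H h
    by (intro group_hom.intro group_hom_axioms.intro h group_free_Abelian_group H.is_group)
  have "K0_rels \<Lambda> \<subseteq> kernel FA H h"
  proof
    fix x :: "'k rep \<Rightarrow>\<^sub>0 int" assume x: "x \<in> K0_rels \<Lambda>"
    then have xc: "x \<in> carrier FA" using K0_rels_carrier by blast
    from x consider A B C where "x = frag_of C - (frag_of A + frag_of B)"
        "A \<in> modules \<Lambda>" "B \<in> modules \<Lambda>" "C \<in> modules \<Lambda>" "isomorphic \<Lambda> C (direct_sum A B)"
      | P where "x = frag_of P" "projective \<Lambda> P"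
      by (auto simp: K0_rels_def)
    then have "h x = \<one>\<^bsub>H\<^esub>"
    proof cases
      case 1
      have AB: "frag_of A \<in> carrier FA" "frag_of B \<in> carrier FA" using 1 by auto
      have "h (frag_of C) = h (x \<otimes>\<^bsub>FA\<^esub> (frag_of A \<otimes>\<^bsub>FA\<^esub> frag_of B))" using 1(1) by simp
      also have "\<dots> = h x \<otimes>\<^bsub>H\<^esub> (h (frag_of A) \<otimes>\<^bsub>H\<^esub> h (frag_of B))"
        using xc AB by (simp only: h.hom_mult h.G.m_closed)
      finally have "F A \<otimes>\<^bsub>H\<^esub> F B = h x \<otimes>\<^bsub>H\<^esub> (F A \<otimes>\<^bsub>H\<^esub> F B)"
        using 1 by (simp only: h(2) add)
      then show ?thesis
        using F[OF 1(2)] F[OF 1(3)] h.hom_closed[OF xc] H.r_cancel_one'[of "F A \<otimes>\<^bsub>H\<^esub> F B" "h x"] by simp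
    next
      case 2
      then show ?thesis using h(2)[OF projective_module[OF 2(2)]] proj by simp
    qed
    then show "x \<in> kernel FA H h" using xc by (simp add: kernel_def)
  qed
  then have "K0_ker \<Lambda> \<subseteq> kernel FA H h"
    unfolding K0_ker_def by (rule h.G.generate_subgroup_incl[OF _ h.subgroup_kernel])
  from h.FactGroup_universal_kernel[OF K0_ker_normal this] obtain g where
    g: "g \<in> hom (FA Mod K0_ker \<Lambda>) H" "\<And>x. x \<in> carrier FA \<Longrightarrow> g (K0_ker \<Lambda> #>\<^bsub>FA\<^esub> x) = h x" by blast
  show thesis
  proof (rule that)
    show "g \<in> hom (K0 \<Lambda>) H" using g(1) by (simp add: K0_def)
    show "g (K0_class \<Lambda> M) = F M" if "M \<in> modules \<Lambda>" for M
      using g(2)[of "frag_of M"] h(2)[OF that] that by (simp add: K0_class_def)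
  qed
qed

text \<open>The universal property justifies the choice in \<open>K0_L\<close>: up to isomorphism
  syzygies are compatible with direct sums, and they preserve projectives.\<close>

lemma K0_L: "K0_L \<Lambda> \<in> hom (K0 \<Lambda>) (K0 \<Lambda> :: ('k::field rep \<Rightarrow>\<^sub>0 int) set monoid)"
  "M \<in> modules \<Lambda> \<Longrightarrow> K0_L \<Lambda> (K0_class \<Lambda> (M :: 'k rep)) = K0_class \<Lambda> (Syz \<Lambda> M)"
proof -
  have add: "K0_class \<Lambda> (Syz \<Lambda> C) = K0_class \<Lambda> (Syz \<Lambda> A) \<otimes>\<^bsub>K0 \<Lambda>\<^esub> K0_class \<Lambda> (Syz \<Lambda> B)"
    if "A \<in> modules \<Lambda>" "B \<in> modules \<Lambda>" "C \<in> modules \<Lambda>" "isomorphic \<Lambda> C (direct_sum A B)" for A B C :: "'k rep"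
    by (rule K0_class_direct_sum[OF Syz_module[OF that(1)] Syz_module[OF that(2)] Syz_module[OF that(3)]
          isomorphic_trans[OF Syz_cong[OF that(3) direct_sum_module[OF that(1,2)] that(4)] Syz_direct_sum[OF that(1,2)]]])
  obtain g where "g \<in> hom (K0 \<Lambda>) (K0 \<Lambda> :: ('k rep \<Rightarrow>\<^sub>0 int) set monoid)"
    "\<And>M :: 'k rep. M \<in> modules \<Lambda> \<Longrightarrow> g (K0_class \<Lambda> M) = K0_class \<Lambda> (Syz \<Lambda> M)"
    by (rule K0_hom_exists[OF K0_comm_group K0_class_carrier[OF Syz_module] add K0_class_projective[OF Syz_projective]]) blast+
  then have "K0_L \<Lambda> \<in> hom (K0 \<Lambda>) (K0 \<Lambda> :: ('k rep \<Rightarrow>\<^sub>0 int) set monoid) \<and>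
     (\<forall>M\<in>modules \<Lambda>. K0_L \<Lambda> (K0_class \<Lambda> (M :: 'k rep)) = K0_class \<Lambda> (Syz \<Lambda> M))"
    unfolding K0_L_def by (intro someI[of "\<lambda>L. L \<in> hom (K0 \<Lambda>) (K0 \<Lambda>) \<and>
      (\<forall>M\<in>modules \<Lambda>. L (K0_class \<Lambda> M) = K0_class \<Lambda> (Syz \<Lambda> M))" g]) blast
  then show "K0_L \<Lambda> \<in> hom (K0 \<Lambda>) (K0 \<Lambda> :: ('k rep \<Rightarrow>\<^sub>0 int) set monoid)"
    "M \<in> modules \<Lambda> \<Longrightarrow> K0_L \<Lambda> (K0_class \<Lambda> (M :: 'k rep)) = K0_class \<Lambda> (Syz \<Lambda> M)" by auto
qed

lemma K0_L_pow_hom: "K0_L \<Lambda> ^^ m \<in> hom (K0 \<Lambda>) (K0 \<Lambda> :: ('k::field rep \<Rightarrow>\<^sub>0 int) set monoid)"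
proof (induction m)
  case 0
  then show ?case by (auto simp: hom_def)
next
  case (Suc m)
  then show ?case using hom_compose[OF Suc K0_L(1)] by (simp add: comp_def)
qed

lemma K0_L_pow_class:
  "M \<in> modules \<Lambda> \<Longrightarrow> (K0_L \<Lambda> ^^ m) (K0_class \<Lambda> M) = K0_class \<Lambda> ((Syz \<Lambda> ^^ m) M)"
  by (induction m) (auto simp: K0_L(2) Syz_pow_module)

text \<open>The classes of modules generate \<open>K0\<close>.\<close>

lemma K0_hom_eqI:
  fixes f g :: "('k::field rep \<Rightarrow>\<^sub>0 int) set \<Rightarrow> ('k rep \<Rightarrow>\<^sub>0 int) set"
  assumes f: "f \<in> hom (K0 \<Lambda>) (K0 \<Lambda>)" and g: "g \<in> hom (K0 \<Lambda>) (K0 \<Lambda>)"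
    and eq: "\<And>M. M \<in> modules \<Lambda> \<Longrightarrow> f (K0_class \<Lambda> M) = g (K0_class \<Lambda> M)"
    and x: "x \<in> carrier (K0 \<Lambda>)"
  shows "f x = g x"
proof -
  interpret K: comm_group "K0 \<Lambda> :: ('k rep \<Rightarrow>\<^sub>0 int) set monoid" by (rule K0_comm_group)
  interpret p: group_hom FA "K0 \<Lambda> :: ('k rep \<Rightarrow>\<^sub>0 int) set monoid" proj by (rule proj_group_hom)
  interpret f: group_hom "K0 \<Lambda>" "K0 \<Lambda>" f by unfold_locales (rule f)
  interpret g: group_hom "K0 \<Lambda>" "K0 \<Lambda>" g by unfold_locales (rule g)
  obtain y where y: "Poly_Mapping.keys y \<subseteq> modules \<Lambda>" "x = proj y" using x by (auto simp: carrier_K0)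
  have "f (proj y) = g (proj y)"
    using y(1)
  proof (rule free_Abelian_group_induct)
    show "f (proj 0) = g (proj 0)" using p.hom_one by simp
  next
    fix u v :: "'k rep \<Rightarrow>\<^sub>0 int"
    assume u: "Poly_Mapping.keys u \<subseteq> modules \<Lambda>" and v: "Poly_Mapping.keys v \<subseteq> modules \<Lambda>"
      and e: "f (proj u) = g (proj u)" "f (proj v) = g (proj v)"
    have c: "u \<in> carrier FA" "v \<in> carrier FA" using u v by auto
    have "proj (u - v) = proj (u \<otimes>\<^bsub>FA\<^esub> inv\<^bsub>FA\<^esub> v)" using v by simp
    also have "\<dots> = proj u \<otimes>\<^bsub>K0 \<Lambda>\<^esub> inv\<^bsub>K0 \<Lambda>\<^esub> proj v"
      using c by (simp only: p.hom_mult p.hom_inv p.G.inv_closed)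
    finally have "proj (u - v) = proj u \<otimes>\<^bsub>K0 \<Lambda>\<^esub> inv\<^bsub>K0 \<Lambda>\<^esub> proj v" .
    then show "f (proj (u - v)) = g (proj (u - v))"
      using p.hom_closed[OF c(1)] p.hom_closed[OF c(2)] e by simp
  next
    fix M :: "'k rep" assume "M \<in> modules \<Lambda>"
    then show "f (proj (frag_of M)) = g (proj (frag_of M))" using eq by (simp add: K0_class_proj)
  qed
  then show ?thesis by (simp add: y)
qed

text \<open>These are the coordinate functions of \<open>K0\<close> in the basis of live
  intervals.\<close>

lemma K0_mult_hom:
  assumes c: "live c"
  obtains g where "g \<in> hom (K0 \<Lambda>) integer_group"
    "\<And>M :: 'k::field rep. M \<in> modules \<Lambda> \<Longrightarrow> g (K0_class \<Lambda> M) = mult c M"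
proof (rule K0_hom_exists[OF abelian_integer_group, of "mult c :: 'k rep \<Rightarrow> int"])
  show "mult c C = mult c A \<otimes>\<^bsub>integer_group\<^esub> mult c B"
    if "A \<in> modules \<Lambda>" "B \<in> modules \<Lambda>" "C \<in> modules \<Lambda>" "isomorphic \<Lambda> C (direct_sum A B)" for A B C :: "'k rep"
    using mult_iso[OF that(3,4)] mult_direct_sum[OF that(1,2)] by simp
  show "mult c P = \<one>\<^bsub>integer_group\<^esub>" if "projective \<Lambda> P" for P :: "'k rep"
    using mult_projective[OF that c] by simp
qed (use that in auto)

end

section \<open>The \<open>\<phi>\<close>-dimension in terms of intervals\<close>

lemma funpow_funpow: "(f ^^ m) ((f ^^ n) x) = (f ^^ (m + n)) x"
  by (simp add: funpow_add)

lemma funpow_mult_fixed: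
  assumes "(f ^^ m) x = x" shows "(f ^^ (k * m)) x = x"
  using assms by (induction k) (auto simp: funpow_add)

context nakayama
begin

text \<open>The type argument carries the field, which a code does not determine.\<close>

definition cls :: "'k::field itself \<Rightarrow> nat \<times> nat \<Rightarrow> ('k rep \<Rightarrow>\<^sub>0 int) set" where
  "cls T c = K0_class \<Lambda> (IC c :: 'k rep)"

lemma cls_carrier: "c \<in> codes \<Longrightarrow> cls T c \<in> carrier (K0 \<Lambda>)"
  by (simp add: cls_def K0_class_carrier IC_module)

lemma cls_dead: "c \<in> codes \<Longrightarrow> \<not> live c \<Longrightarrow> cls T c = \<one>\<^bsub>K0 \<Lambda>\<^esub>"
  by (simp add: cls_def K0_class_projective projective_IC_iff)

lemma K0_L_cls:
  assumes "c \<in> codes"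
  shows "(K0_L \<Lambda> ^^ m) (cls T c) = cls T ((om ^^ m) c)"
  unfolding cls_def K0_L_pow_class[OF IC_module[OF assms]]
  by (rule K0_class_iso[OF Syz_pow_module[OF IC_module[OF assms]] IC_module[OF om_pow_codes[OF assms]]
        Syz_pow_IC[OF assms]])

lemma live_codes: "live c \<Longrightarrow> c \<in> codes" "live c \<Longrightarrow> 0 < snd c"
  by (auto simp: live_def)

lemma om_dead: "c \<in> codes \<Longrightarrow> \<not> live c \<Longrightarrow> \<not> live (om c)"
  by (auto simp: live_def om_def codes_def)

lemma om_pow_dead: "c \<in> codes \<Longrightarrow> \<not> live c \<Longrightarrow> \<not> live ((om ^^ m) c)"
  by (induction m) (auto simp: om_dead om_pow_codes)

lemma K0_class_dsum_cong:
  assumes "set cs \<subseteq> codes" "f ` set cs \<subseteq> codes" "g ` set cs \<subseteq> codes"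
    "\<And>c. c \<in> set cs \<Longrightarrow> cls TYPE('k::field) (f c) = cls TYPE('k) (g c)"
  shows "K0_class \<Lambda> (dsum (map f cs) :: 'k rep) = K0_class \<Lambda> (dsum (map g cs))"
  using assms
proof (induction cs)
  case (Cons c cs)
  have *: "K0_class \<Lambda> (dsum (map h (c # cs)) :: 'k rep) = cls TYPE('k) (h c) \<otimes>\<^bsub>K0 \<Lambda>\<^esub> K0_class \<Lambda> (dsum (map h cs))"
    if "h ` set (c # cs) \<subseteq> codes" for h
  proof -
    have m: "IC (h c) \<in> modules \<Lambda>" "dsum (map h cs) \<in> modules \<Lambda>"
      using that by (auto intro!: IC_module dsum_module)
    show ?thesis
      using K0_class_direct_sum[OF m direct_sum_module[OF m] isomorphic_refl] by (simp add: cls_def)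
  qed
  show ?case unfolding *[OF Cons.prems(2)] *[OF Cons.prems(3)] using Cons by simp
qed simp

text \<open>The combinatorial form of the bound t on the \<phi>-dimension, as
  \<open>phi_dim_le_iff\<close> will show.\<close>

definition periodic_from :: "nat \<Rightarrow> bool" where
  "periodic_from t \<longleftrightarrow> (\<forall>c\<in>codes. live ((om ^^ t) c) \<longrightarrow> (\<exists>m\<ge>1. (om ^^ m) ((om ^^ t) c) = (om ^^ t) c))"

lemma uniform_period:
  assumes "periodic_from t"
  obtains m where "m \<ge> 1" "\<And>c. c \<in> codes \<Longrightarrow> live ((om ^^ t) c) \<Longrightarrow> (om ^^ (m + t)) c = (om ^^ t) c"
proof -
  have "\<forall>c\<in>codes. \<exists>m\<ge>1. live ((om ^^ t) c) \<longrightarrow> (om ^^ m) ((om ^^ t) c) = (om ^^ t) c"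
    using assms unfolding periodic_from_def by blast
  then obtain p where p: "\<And>c. c \<in> codes \<Longrightarrow> p c \<ge> (1 :: nat)"
    "\<And>c. c \<in> codes \<Longrightarrow> live ((om ^^ t) c) \<Longrightarrow> (om ^^ p c) ((om ^^ t) c) = (om ^^ t) c" by metis
  \<comment> \<open>A common multiple of the periods of all codes, where an arbitrary positive
    number stands in for codes whose t-th syzygy is not live.\<close>
  define m where "m = prod p codes"
  have "m \<noteq> 0" unfolding m_def using finite_codes p(1) by (fastforce simp: prod_zero_iff)
  moreover have "(om ^^ (m + t)) c = (om ^^ t) c" if "c \<in> codes" "live ((om ^^ t) c)" for c
  proof -
    have "p c dvd m" unfolding m_def by (rule dvd_prodI[OF finite_codes that(1)])
    then obtain k where "m = k * p c" by (metis dvd_div_mult_self)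
    then show ?thesis using funpow_mult_fixed[OF p(2)[OF that], of k] by (simp add: funpow_add)
  qed
  ultimately show thesis using that[of m] by simp
qed

lemma add_subgroup_subgroup: "M \<in> modules \<Lambda> \<Longrightarrow> subgroup (add_subgroup \<Lambda> M) (K0 \<Lambda>)"
  unfolding add_subgroup_def
  by (rule group.generate_is_subgroup[OF comm_group.axioms(2)[OF K0_comm_group]])
    (auto simp: indecomposable_def K0_class_carrier)

text \<open>With a common period m, the m-th power of the operator fixes the image of its t-th power
  elementwise. So all powers of the operator are injective there, and the ranks stay constant from t
  on. After j steps, j * m - j further steps return to the start.\<close>

lemma phi_le:
  fixes M :: "'k::field rep"
  assumes t: "periodic_from t" and M: "M \<in> modules \<Lambda>"
  shows "phi \<Lambda> M \<le> t"
  unfolding phi_def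
proof (rule Least_le, intro allI impI)
  fix j :: nat assume "j \<ge> 1"
  interpret K: comm_group "K0 \<Lambda> :: ('k rep \<Rightarrow>\<^sub>0 int) set monoid" by (rule K0_comm_group)
  let ?L = "K0_L \<Lambda> :: ('k rep \<Rightarrow>\<^sub>0 int) set \<Rightarrow> _" and ?H = "add_subgroup \<Lambda> M"
  obtain m where m: "m \<ge> 1" "\<And>c. c \<in> codes \<Longrightarrow> live ((om ^^ t) c) \<Longrightarrow> (om ^^ (m + t)) c = (om ^^ t) c"
    using uniform_period[OF t] by blast
  have cls: "cls TYPE('k) ((om ^^ (m + t)) c) = cls TYPE('k) ((om ^^ t) c)" if c: "c \<in> codes" for c
  proof (cases "live ((om ^^ t) c)")
    case True
    then show ?thesis using m(2)[OF c] by simp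
  next
    case False
    have "\<not> live ((om ^^ (m + t)) c)"
      using om_pow_dead[OF om_pow_codes[OF c] False, of m] by (simp add: funpow_add)
    then show ?thesis using cls_dead om_pow_codes[OF c] False by metis
  qed
  have fix1: "(?L ^^ (m + t)) x = (?L ^^ t) x" if "x \<in> carrier (K0 \<Lambda>)" for x
  proof (rule K0_hom_eqI[OF K0_L_pow_hom K0_L_pow_hom _ that])
    fix X :: "'k rep" assume X: "X \<in> modules \<Lambda>"
    obtain cs where cs: "set cs \<subseteq> {c \<in> codes. 0 < snd c}" "isomorphic \<Lambda> X (dsum cs)"
      using decomposition[OF X] .
    have cs': "set cs \<subseteq> codes" using cs(1) by auto
    have L: "(?L ^^ l) (K0_class \<Lambda> X) = K0_class \<Lambda> (dsum (map (om ^^ l) cs))" for l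
    proof -
      have cm: "set (map (om ^^ l) cs) \<subseteq> codes" using cs' om_pow_codes by auto
      show ?thesis
        unfolding K0_L_pow_class[OF X]
        by (rule K0_class_iso[OF Syz_pow_module[OF X] dsum_module[OF cm]
              isomorphic_trans[OF Syz_pow_cong[OF X dsum_module[OF cs'] cs(2)] Syz_pow_dsum[OF cs']]])
    qed
    show "(?L ^^ (m + t)) (K0_class \<Lambda> X) = (?L ^^ t) (K0_class \<Lambda> X)"
      unfolding L by (rule K0_class_dsum_cong[OF cs']) (use cs' om_pow_codes cls in auto)
  qed
  have period: "(?L ^^ (k * m)) ((?L ^^ t) x) = (?L ^^ t) x" if "x \<in> carrier (K0 \<Lambda>)" for x k
    using fix1[OF that] by (intro funpow_mult_fixed) (simp add: funpow_add)
  have "j * m - j + j = j * m" using m(1) by simp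
  then have undo: "(?L ^^ (j * m - j)) ((?L ^^ j) ((?L ^^ t) x)) = (?L ^^ t) x" if "x \<in> carrier (K0 \<Lambda>)" for x
    using period[OF that, of j] by (metis comp_apply funpow_add)
  have HG: "?H \<subseteq> carrier (K0 \<Lambda>)" using subgroup.subset[OF add_subgroup_subgroup[OF M]] .
  have inj: "inj_on (?L ^^ j) ((?L ^^ t) ` ?H)"
  proof (rule inj_onI)
    fix x y assume "x \<in> (?L ^^ t) ` ?H" "y \<in> (?L ^^ t) ` ?H" and e: "(?L ^^ j) x = (?L ^^ j) y"
    then obtain x' y' where "x = (?L ^^ t) x'" "y = (?L ^^ t) y'" "x' \<in> carrier (K0 \<Lambda>)" "y' \<in> carrier (K0 \<Lambda>)"
      using HG by blast
    then show "x = y" using undo e by metis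
  qed
  interpret Lt: group_hom "K0 \<Lambda> :: ('k rep \<Rightarrow>\<^sub>0 int) set monoid" "K0 \<Lambda>" "?L ^^ t"
    by unfold_locales (rule K0_L_pow_hom)
  have sub: "subgroup ((?L ^^ t) ` ?H) (K0 \<Lambda>)"
    by (rule Lt.subgroup_img_is_subgroup[OF add_subgroup_subgroup[OF M]])
  have "(?L ^^ (t + j)) ` ?H = (?L ^^ j) ` (?L ^^ t) ` ?H"
    by (simp add: image_image funpow_add add.commute[of t j])
  then show "subgroup_rank (K0 \<Lambda>) ((?L ^^ t) ` ?H) = subgroup_rank (K0 \<Lambda>) ((?L ^^ (t + j)) ` ?H)"
    using K.subgroup_rank_hom_image[OF K0_L_pow_hom sub inj] by simp
qed

text \<open>An indecomposable summand has a code of positive multiplicity in the sum, and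
  multiplicities leave only c and d.\<close>

lemma add_subgroup_pair:
  assumes c: "live c" and d: "live d"
  shows "add_subgroup \<Lambda> (direct_sum (IC c) (IC d) :: 'k::field rep)
    = generate (K0 \<Lambda>) {cls TYPE('k) c, cls TYPE('k) d}"
proof -
  let ?M = "direct_sum (IC c) (IC d) :: 'k rep"
  note m = IC_module[OF live_codes(1)[OF c], where ?'a = 'k] IC_module[OF live_codes(1)[OF d], where ?'a = 'k]
  have "is_summand \<Lambda> (IC c) ?M"
    unfolding is_summand_def using m isomorphic_refl by blast
  moreover have "is_summand \<Lambda> (IC d) ?M"
    unfolding is_summand_def using m isomorphic_direct_sum_comm by blast
  moreover have "K0_class \<Lambda> X \<in> {cls TYPE('k) c, cls TYPE('k) d}"
    if X: "indecomposable \<Lambda> X" "is_summand \<Lambda> X ?M" for X :: "'k rep"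
  proof -
    obtain e where e: "e \<in> codes" "0 < snd e" "isomorphic \<Lambda> X (IC e)"
      using indecomposable_cases[OF X(1)] .
    obtain Y where Y: "X \<in> modules \<Lambda>" "Y \<in> modules \<Lambda>" "isomorphic \<Lambda> ?M (direct_sum X Y)"
      using X(2) by (auto simp: is_summand_def)
    have "mult e (IC c :: 'k rep) + mult e (IC d :: 'k rep) = mult e X + mult e Y"
      using mult_iso[OF direct_sum_module[OF m] Y(3), of e] mult_direct_sum[OF m, of e] mult_direct_sum[OF Y(1,2), of e]
      by simp
    moreover have "mult e X = 1"
      using mult_iso[OF Y(1) e(3)] mult_IC[OF e(1,1,2)] by metis
    ultimately have "mult e (IC c :: 'k rep) + mult e (IC d :: 'k rep) \<ge> 1"
      using mult_nonneg[OF Y(2) e(1,2)] by simp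
    then have "e = c \<or> e = d"
      using mult_IC[OF e(1) live_codes(1)[OF c] e(2), where ?'a = 'k]
        mult_IC[OF e(1) live_codes(1)[OF d] e(2), where ?'a = 'k] by (auto split: if_splits)
    then show ?thesis
      using K0_class_iso[OF Y(1) IC_module[OF e(1)] e(3)] by (auto simp: cls_def)
  qed
  ultimately have "{K0_class \<Lambda> X |X. indecomposable \<Lambda> X \<and> is_summand \<Lambda> X ?M} = {cls TYPE('k) c, cls TYPE('k) d}"
    using indecomposable_IC[OF live_codes[OF c]] indecomposable_IC[OF live_codes[OF d]]
    unfolding cls_def by blast
  then show ?thesis by (simp add: add_subgroup_def)
qed

text \<open>The cardinality of \<open>{x, y}\<close> is 1 for x = y, so that cyclic subgroups are
  covered as well. Independence comes from the coordinate functions, which also show that different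
  live codes have different classes.\<close>

lemma rank_pair:
  assumes x: "live x" and y: "live y"
  shows "enat (card {x, y}) \<le> subgroup_rank (K0 \<Lambda>) (generate (K0 \<Lambda>) {cls TYPE('k::field) x, cls TYPE('k) y})"
proof -
  interpret K: comm_group "K0 \<Lambda> :: ('k rep \<Rightarrow>\<^sub>0 int) set monoid" by (rule K0_comm_group)
  let ?c = "cls TYPE('k)"
  have sep: "\<exists>f\<in>hom (K0 \<Lambda>) integer_group. f (?c z) = 1 \<and> (\<forall>w\<in>codes. w \<noteq> z \<longrightarrow> f (?c w) = 0)" if z: "live z" for z
  proof -
    obtain f where f: "f \<in> hom (K0 \<Lambda>) integer_group"
      "\<And>M :: 'k rep. M \<in> modules \<Lambda> \<Longrightarrow> f (K0_class \<Lambda> M) = mult z M" using K0_mult_hom[OF z] by blast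
    have "f (?c w) = (if z = w then 1 else 0)" if "w \<in> codes" for w
      using f(2)[OF IC_module[OF that]] mult_IC[OF live_codes(1)[OF z] that live_codes(2)[OF z], where ?'a = 'k]
      by (simp add: cls_def)
    then show ?thesis using f(1) live_codes(1)[OF z] by (intro bexI[of _ f]) simp_all
  qed
  have inj: "inj_on ?c {x, y}"
  proof (rule inj_onI, rule ccontr)
    fix u v assume "u \<in> {x, y}" "v \<in> {x, y}" "?c u = ?c v" "u \<noteq> v"
    moreover from this have "live u" "v \<in> codes" using live_codes(1)[OF x] live_codes(1)[OF y] x y by auto
    ultimately show False using sep[of u] by fastforce
  qed
  have "int_independent (K0 \<Lambda>) (?c ` {x, y})"
  proof (rule K.int_independent_homs)
    fix b assume "b \<in> ?c ` {x, y}"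
    then obtain z where z: "z \<in> {x, y}" "b = ?c z" by blast
    then have "live z" using x y by auto
    then obtain f where f: "f \<in> hom (K0 \<Lambda>) integer_group" "f (?c z) = 1" "\<And>w. w \<in> codes \<Longrightarrow> w \<noteq> z \<Longrightarrow> f (?c w) = 0"
      using sep by blast
    moreover have "f b' = 0" if "b' \<in> ?c ` {x, y}" "b' \<noteq> b" for b'
    proof -
      obtain w where w: "w \<in> {x, y}" "b' = ?c w" using \<open>b' \<in> ?c ` {x, y}\<close> by blast
      then have "w \<in> codes" "w \<noteq> z" using x y live_codes(1) z \<open>b' \<noteq> b\<close> by blast+
      then show ?thesis unfolding w(2) by (rule f(3))
    qed
    ultimately show "\<exists>f\<in>hom (K0 \<Lambda>) integer_group. f b \<noteq> 0 \<and> (\<forall>b'\<in>?c ` {x, y}. b' \<noteq> b \<longrightarrow> f b' = 0)"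
      unfolding z(2) by (intro bexI[of _ f]) simp_all
  next
    show "?c ` {x, y} \<subseteq> carrier (K0 \<Lambda>)"
      using cls_carrier[OF live_codes(1)[OF x]] cls_carrier[OF live_codes(1)[OF y]] by blast
  qed simp
  moreover have "?c ` {x, y} \<subseteq> generate (K0 \<Lambda>) {?c x, ?c y}" by (auto intro: generate.incl)
  ultimately have "enat (card (?c ` {x, y})) \<le> subgroup_rank (K0 \<Lambda>) (generate (K0 \<Lambda>) {?c x, ?c y})"
    by (intro le_subgroup_rank)
  then show ?thesis by (simp only: card_image[OF inj])
qed

lemma rank_single:
  assumes x: "x \<in> codes"
  shows "subgroup_rank (K0 \<Lambda>) (generate (K0 \<Lambda>) {cls TYPE('k::field) x}) = (if live x then 1 else 0)"
proof -
  interpret K: comm_group "K0 \<Lambda> :: ('k rep \<Rightarrow>\<^sub>0 int) set monoid" by (rule K0_comm_group)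
  show ?thesis
  proof (cases "live x")
    case True
    have "subgroup_rank (K0 \<Lambda>) (generate (K0 \<Lambda>) {cls TYPE('k) x}) \<le> 1"
      by (rule K.subgroup_rank_cyclic[OF cls_carrier[OF x]])
    moreover have "1 \<le> subgroup_rank (K0 \<Lambda>) (generate (K0 \<Lambda>) {cls TYPE('k) x})"
      using rank_pair[OF True True, where ?'k = 'k] by (simp add: one_enat_def)
    ultimately show ?thesis using True by simp
  next
    case False
    then show ?thesis using K.subgroup_rank_trivial by (simp add: cls_dead[OF x] K.generate_one)
  qed
qed

text \<open>If \<open>\<Omega>\<close> kills the interval \<open>c\<close> eventually, the rank drops from 1 to 0. Otherwise some
  \<open>\<Omega>\<^sup>p c\<close> merges with \<open>c\<close> under a power of \<open>\<Omega>\<close>, and for \<open>c \<oplus> \<Omega>\<^sup>p c\<close> the rank drops from 2 to 1.\<close>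

lemma phi_ge:
  assumes c: "c \<in> codes" "live ((om ^^ t) c)" "\<not> (\<exists>m\<ge>1. (om ^^ m) ((om ^^ t) c) = (om ^^ t) c)"
  obtains M :: "'k::field rep" where "M \<in> modules \<Lambda>" "t < phi \<Lambda> M"
proof -
  note found = that
  let ?K = "K0 \<Lambda> :: ('k rep \<Rightarrow>\<^sub>0 int) set monoid" and ?L = "K0_L \<Lambda> :: ('k rep \<Rightarrow>\<^sub>0 int) set \<Rightarrow> _"
  let ?c = "cls TYPE('k)"
  have live_t: "live ((om ^^ k) c)" if "k \<le> t" for k
  proof (rule ccontr)
    assume "\<not> live ((om ^^ k) c)"
    from om_pow_dead[OF om_pow_codes[OF c(1)] this, of "t - k"] c(2) that show False
      by (metis comp_apply funpow_add le_add_diff_inverse2)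
  qed
  have img: "subgroup_rank ?K ((?L ^^ k) ` add_subgroup \<Lambda> (direct_sum (IC c) (IC d)))
    = subgroup_rank ?K (generate ?K {?c ((om ^^ k) c), ?c ((om ^^ k) d)})" if d: "live d" for d k
  proof -
    interpret L: group_hom ?K ?K "?L ^^ k"
      by (intro group_hom.intro group_hom_axioms.intro K0_L_pow_hom comm_group.axioms(2)[OF K0_comm_group])
    have "{?c c, ?c d} \<subseteq> carrier ?K"
      using cls_carrier[OF c(1)] cls_carrier[OF live_codes(1)[OF d]] by blast
    from L.generate_img[OF this] show ?thesis
      unfolding add_subgroup_pair[OF live_t[of 0, simplified] d]
      using K0_L_cls[OF c(1), of k "TYPE('k)"] K0_L_cls[OF live_codes(1)[OF d], of k "TYPE('k)"] by simp
  qed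
  \<comment> \<open>The rank is at least r + 1 up to step t and equal to r from step s on, so it
    cannot be final at any step k \<le> t.\<close>
  have main: thesis if d: "live d" and r: "\<And>k. k \<le> t \<Longrightarrow> live ((om ^^ k) d) \<and> r + 1 \<le> card {(om ^^ k) c, (om ^^ k) d}"
    and s: "\<And>k. k \<ge> s \<Longrightarrow> subgroup_rank ?K (generate ?K {?c ((om ^^ k) c), ?c ((om ^^ k) d)}) = enat r" for d r s
  proof -
    let ?M = "direct_sum (IC c) (IC d) :: 'k rep"
    let ?P = "\<lambda>k. \<forall>j\<ge>1. subgroup_rank ?K ((?L ^^ k) ` add_subgroup \<Lambda> ?M) = subgroup_rank ?K ((?L ^^ (k + j)) ` add_subgroup \<Lambda> ?M)"
    \<comment> \<open>The minimum in \<open>phi\<close> is attained, because the rank is constant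
      from s on.\<close>
    have "?P s" unfolding img[OF d] using s by simp
    then have P: "?P (phi \<Lambda> ?M)" unfolding phi_def by (rule LeastI)
    have "t < phi \<Lambda> ?M"
    proof (rule ccontr)
      assume "\<not> t < phi \<Lambda> ?M"
      then have k: "phi \<Lambda> ?M \<le> t" by simp
      have "enat (r + 1) \<le> subgroup_rank ?K (generate ?K {?c ((om ^^ phi \<Lambda> ?M) c), ?c ((om ^^ phi \<Lambda> ?M) d)})"
        using rank_pair[OF live_t[OF k] conjunct1[OF r[OF k]], where ?'k = 'k] r[OF k]
        by (meson enat_ord_simps(1) order_trans)
      also have "\<dots> = subgroup_rank ?K (generate ?K {?c ((om ^^ (phi \<Lambda> ?M + Suc s)) c), ?c ((om ^^ (phi \<Lambda> ?M + Suc s)) d)})"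
        using P unfolding img[OF d] by (metis le_add1 plus_1_eq_Suc)
      also have "\<dots> = enat r" by (rule s) simp
      finally show False by simp
    qed
    then show thesis
      using found[of ?M] direct_sum_module[OF IC_module[OF c(1)] IC_module[OF live_codes(1)[OF d]]] by blast
  qed
  show thesis
  proof (cases "\<exists>s. \<not> live ((om ^^ s) c)")
    case True
    then obtain s where s: "\<not> live ((om ^^ s) c)" by blast
    show thesis
    proof (rule main[of c 0 s])
      show "live c" using live_t[of 0] by simp
      show "live ((om ^^ k) c) \<and> 0 + 1 \<le> card {(om ^^ k) c, (om ^^ k) c}" if "k \<le> t" for k
        using live_t[OF that] by simp
      show "subgroup_rank ?K (generate ?K {?c ((om ^^ k) c), ?c ((om ^^ k) c)}) = enat 0" if "s \<le> k" for k
      proof -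
        have "\<not> live ((om ^^ k) c)"
          using om_pow_dead[OF om_pow_codes[OF c(1)] s, of "k - s"] that
          by (metis comp_apply funpow_add le_add_diff_inverse2)
        then show ?thesis using rank_single[OF om_pow_codes[OF c(1)], of k, where ?'k = 'k] by (simp add: zero_enat_def)
      qed
    qed
  next
    case False
    then have live: "live ((om ^^ s) c)" for s by blast
    have "\<not> inj (\<lambda>s. (om ^^ s) c)"
    proof
      assume "inj (\<lambda>s. (om ^^ s) c)"
      moreover have "finite (range (\<lambda>s. (om ^^ s) c))"
        by (rule finite_subset[OF _ finite_codes]) (use om_pow_codes[OF c(1)] in auto)
      ultimately show False using finite_imageD infinite_UNIV_nat by blast
    qed
    then obtain i' j' where ij': "i' \<noteq> j'" "(om ^^ i') c = (om ^^ j') c" by (auto simp: inj_def)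
    define i j where "i = min i' j'" and "j = max i' j'"
    have ij: "i < j" "(om ^^ i) c = (om ^^ j) c" using ij' by (auto simp: i_def j_def min_def max_def)
    \<comment> \<open>The orbits of c and d agree from step i on, as j - i is a period there. Up to
      step t they differ, since agreement would make the t-th syzygy of c periodic.\<close>
    define d where "d = (om ^^ (j - i)) c"
    have d: "(om ^^ k) d = (om ^^ (k + (j - i))) c" for k by (simp add: d_def funpow_add)
    show thesis
    proof (rule main[of d 1 i])
      show "live d" using live by (simp add: d_def)
      show "live ((om ^^ k) d) \<and> 1 + 1 \<le> card {(om ^^ k) c, (om ^^ k) d}" if k: "k \<le> t" for k
      proof -
        have "(om ^^ k) c \<noteq> (om ^^ k) d"
        proof
          assume "(om ^^ k) c = (om ^^ k) d"
          then have "(om ^^ (t - k)) ((om ^^ k) c) = (om ^^ (t - k)) ((om ^^ (k + (j - i))) c)" by (simp add: d)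
          moreover have "t - k + k = t" "t - k + (k + (j - i)) = (j - i) + t" using k by simp_all
          ultimately have "(om ^^ (j - i)) ((om ^^ t) c) = (om ^^ t) c" unfolding funpow_funpow by metis
          moreover have "j - i \<ge> 1" using ij by simp
          ultimately show False using c(3) by blast
        qed
        then show ?thesis using live by (simp add: d)
      qed
      show "subgroup_rank ?K (generate ?K {?c ((om ^^ k) c), ?c ((om ^^ k) d)}) = enat 1" if "i \<le> k" for k
      proof -
        have e: "k + (j - i) = k - i + j" "k = k - i + i" using that ij(1) by simp_all
        have "(om ^^ k) d = (om ^^ (k - i)) ((om ^^ j) c)"
          unfolding d funpow_funpow e(1) ..
        also have "\<dots> = (om ^^ k) c"
          unfolding ij(2)[symmetric] funpow_funpow e(2)[symmetric] ..
        finally show ?thesis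
          using rank_single[OF om_pow_codes[OF c(1)], of k, where ?'k = 'k] live[of k] by (simp add: one_enat_def)
      qed
    qed
  qed
qed

theorem phi_dim_le_iff: "phi_dim TYPE('k::field) \<Lambda> \<le> enat t \<longleftrightarrow> periodic_from t"
proof
  assume "periodic_from t"
  then show "phi_dim TYPE('k) \<Lambda> \<le> enat t"
    unfolding phi_dim_def by (intro SUP_least) (simp add: phi_le)
next
  assume le: "phi_dim TYPE('k) \<Lambda> \<le> enat t"
  show "periodic_from t"
  proof (rule ccontr)
    assume "\<not> periodic_from t"
    then obtain c where c: "c \<in> codes" "live ((om ^^ t) c)" "\<not> (\<exists>m\<ge>1. (om ^^ m) ((om ^^ t) c) = (om ^^ t) c)"
      unfolding periodic_from_def by blast
    obtain M :: "'k rep" where M: "M \<in> modules \<Lambda>" "t < phi \<Lambda> M" using phi_ge[OF c] .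
    have "enat (phi \<Lambda> M) \<le> phi_dim TYPE('k) \<Lambda>" unfolding phi_dim_def by (rule SUP_upper[OF M(1)])
    with le have "enat (phi \<Lambda> M) \<le> enat t" by (rule order_trans[rotated])
    then show False using M(2) by simp
  qed
qed

end

section \<open>Intervals on the universal cover\<close>

lemma finite_inj_periodic:
  assumes fin: "finite Q" and inj: "inj_on f Q" and maps: "f ` Q \<subseteq> Q" and q: "q \<in> Q"
  obtains m where "m \<ge> 1" "(f ^^ m) q = q"
proof -
  have Q: "(f ^^ i) x \<in> Q" if "x \<in> Q" for i x
    using that by (induction i) (use maps in auto)
  have injp: "x = y" if "x \<in> Q" "y \<in> Q" "(f ^^ i) x = (f ^^ i) y" for i x y
    using that by (induction i) (use Q in \<open>auto dest: inj_onD[OF inj]\<close>)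
  have "\<not> inj (\<lambda>i. (f ^^ i) q)"
  proof
    assume "inj (\<lambda>i. (f ^^ i) q)"
    moreover have "finite (range (\<lambda>i. (f ^^ i) q))"
      by (rule finite_subset[OF _ fin]) (use Q[OF q] in auto)
    ultimately show False using finite_imageD infinite_UNIV_nat by blast
  qed
  then obtain i' j' where ij': "i' \<noteq> j'" "(f ^^ i') q = (f ^^ j') q" by (auto simp: inj_def)
  define i j where "i = min i' j'" and "j = max i' j'"
  have ij: "i < j" "(f ^^ i) q = (f ^^ j) q" using ij' by (auto simp: i_def j_def min_def max_def)
  have "j = i + (j - i)" using ij by simp
  then have "(f ^^ i) q = (f ^^ i) ((f ^^ (j - i)) q)" using ij(2) by (metis funpow_funpow)
  then have "q = (f ^^ (j - i)) q" by (rule injp[OF q Q[OF q]])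
  then show thesis using that[of "j - i"] ij by simp
qed

context nakayama
begin

definition e :: "int \<Rightarrow> int" where "e x = x + int (plen (vt x))"

definition iv :: "int \<Rightarrow> int \<Rightarrow> nat \<times> nat" where "iv x y = (vt x, nat (y - x))"

lemma e_ge: "e x \<ge> x + 2"
  using plen_ge[OF vt_verts, of x] by (simp add: e_def)

lemma e_step: "e x \<le> e (x + 1)"
  using plen_nxt[OF vt_verts, of x] by (simp add: e_def nxt_vt)

lemma e_mono: "x \<le> y \<Longrightarrow> e x \<le> e y"
proof (induction y rule: int_ge_induct)
  case (step y)
  then show ?case using e_step[of y] by simp
qed simp

lemma e_less: "e x < e y \<Longrightarrow> x < y"
  using e_mono[of y x] by linarith

lemma vt_shift [simp]: "vt (x + k * int \<N>) = vt x"
  by (simp add: vt_eq_iff)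

lemma e_shift: "e (x + k * int \<N>) = e x + k * int \<N>"
  by (simp add: e_def)

text \<open>Intervals on the cover with the same code differ by full turns. The order hypotheses
  matter because \<open>nat (y - x)\<close> truncates at 0.\<close>

lemma iv_eq_iff:
  assumes "x \<le> y" "x' \<le> y'"
  shows "iv x y = iv x' y' \<longleftrightarrow> (\<exists>k. x' = x + k * int \<N> \<and> y' = y + k * int \<N>)"
proof
  assume "iv x y = iv x' y'"
  then have v: "x' mod int \<N> = x mod int \<N>" and l: "y - x = y' - x'"
    using assms by (auto simp: iv_def vt_eq_iff)
  from v obtain k where "x' = x + k * int \<N>"
    by (metis add.commute mod_eqE mult.commute)
  then show "\<exists>k. x' = x + k * int \<N> \<and> y' = y + k * int \<N>" using l by (intro exI[of _ k]) simp
qed (auto simp: iv_def)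

lemma iv_code: "x \<le> y \<Longrightarrow> iv x y \<in> codes \<longleftrightarrow> y \<le> e x"
  by (auto simp: iv_def codes_def e_def)

lemma iv_live: "x \<le> y \<Longrightarrow> live (iv x y) \<longleftrightarrow> x < y \<and> y < e x"
  by (auto simp: live_def iv_code) (auto simp: iv_def e_def)

lemma live_ivE:
  assumes "live c" obtains x y where "c = iv x y" "x < y" "y < e x"
proof -
  define x y where "x = int (fst c) - 1" and "y = x + int (snd c)"
  have c: "c = iv x y"
    using vt_surj[of "fst c"] assms by (auto simp: iv_def x_def y_def live_def codes_def prod_eq_iff)
  then show thesis using that[of x y] assms iv_live[of x y] by (simp add: y_def)
qed

lemma om_iv:
  assumes "x < y" "y \<le> e x" shows "om (iv x y) = iv y (e x)"
  using assms by (auto simp: om_def iv_def nxt_pow_vt e_def nat_diff_distrib)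

text \<open>Monotonicity gives e x \<le> e y, so the second syzygy of [x, y) is taken by the same
  rule as the first.\<close>

lemma om2_iv: "x < y \<Longrightarrow> y < e x \<Longrightarrow> (om ^^ 2) (iv x y) = iv (e x) (e y)"
  using om_iv[of x y] om_iv[of y "e x"] e_mono[of x y] by (simp add: numeral_2_eq_2)

lemma live_om_powD: "c \<in> codes \<Longrightarrow> live ((om ^^ m) c) \<Longrightarrow> live c"
  using om_pow_dead by blast

definition periodic_code :: "nat \<times> nat \<Rightarrow> bool" where
  "periodic_code c \<longleftrightarrow> (\<exists>m\<ge>1. (om ^^ m) c = c)"

text \<open>Once a syzygy is zero or projective it never becomes live again, so a periodic orbit
  through a live code cannot pass through such a syzygy.\<close>

lemma periodic_code_live:
  assumes "live c" "periodic_code c" shows "live ((om ^^ k) c)"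
proof (rule ccontr)
  assume d: "\<not> live ((om ^^ k) c)"
  obtain m where m: "m \<ge> 1" "(om ^^ m) c = c" using assms(2) by (auto simp: periodic_code_def)
  have c: "c \<in> codes" using assms by (simp add: live_def)
  have "k * m - k + k = k * m" using m by simp
  then have "(om ^^ (k * m - k)) ((om ^^ k) c) = c"
    using funpow_mult_fixed[OF m(2), of k] by (simp only: funpow_funpow)
  then show False using om_pow_dead[OF om_pow_codes[OF c] d, of "k * m - k"] assms(1) by simp
qed

lemma periodic_code_twice:
  assumes "periodic_code c" obtains m where "m \<ge> 1" "((om ^^ 2) ^^ m) c = c"
proof -
  obtain m where m: "m \<ge> 1" "(om ^^ m) c = c" using assms by (auto simp: periodic_code_def)
  have "((om ^^ 2) ^^ m) c = c"
    using funpow_mult_fixed[OF m(2), of 2] by (simp add: funpow_mult)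
  then show thesis using that m(1) by blast
qed

lemma periodic_code_endpoints:
  assumes x: "x < y" "y < e x" and p: "periodic_code (iv x y)"
  shows "x \<in> range e" "y \<in> range e"
proof -
  obtain m where m: "m \<ge> 1" "((om ^^ 2) ^^ m) (iv x y) = iv x y" using periodic_code_twice[OF p] .
  \<comment> \<open>The predecessor of the interval in its orbit under \<Omega>^2. It is live, so
    its second syzygy has both end points in the image of \<open>e\<close>.\<close>
  define d where "d = ((om ^^ 2) ^^ (m - 1)) (iv x y)"
  have l: "live (iv x y)" using x by (simp add: iv_live)
  have "live d" using periodic_code_live[OF l p, of "2 * (m - 1)"] by (simp add: d_def funpow_mult)
  then obtain u v where uv: "d = iv u v" "u < v" "v < e u" by (rule live_ivE)
  have "Suc (m - 1) = m" using m by simp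
  then have "(om ^^ 2) d = iv x y" using m(2) unfolding d_def by (metis comp_apply funpow.simps(2))
  then have "iv (e u) (e v) = iv x y" using om2_iv[OF uv(2,3)] uv(1) by simp
  then obtain k where "x = e u + k * int \<N>" "y = e v + k * int \<N>"
    using iv_eq_iff[of "e u" "e v" x y] e_mono[of u v] uv x by auto
  then have "x = e (u + k * int \<N>)" "y = e (v + k * int \<N>)" by (simp_all add: e_shift)
  then show "x \<in> range e" "y \<in> range e" by blast+
qed

section \<open>The injective case and the gap between \<phi>-dimensions 0 and 2\<close>

definition strict :: bool where "strict \<longleftrightarrow> (\<forall>x. e x < e (x + 1))"

text \<open>Strictness makes \<open>plen\<close> nondecreasing along the positions; being periodic,
  it is constant.\<close>

lemma strict_plen:
  assumes "strict" obtains c where "\<And>a. a \<in> verts \<Lambda> \<Longrightarrow> plen a = c"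
proof -
  have step: "plen (vt x) \<le> plen (vt (x + 1))" for x
  proof -
    have "e x < e (x + 1)" using assms by (simp add: strict_def)
    then show ?thesis by (simp add: e_def)
  qed
  have mono: "plen (vt x) \<le> plen (vt y)" if "x \<le> y" for x y
    using that
  proof (induction y rule: int_ge_induct)
    case (step y)
    then show ?case using \<open>\<And>x. plen (vt x) \<le> plen (vt (x + 1))\<close>[of y] by linarith
  qed simp
  have "plen (vt x) = plen (vt 0)" for x
  proof (rule antisym)
    have N: "int \<N> > 0" using nverts_ge by simp
    \<comment> \<open>Since a turn has length at least 1, \<bar>x\<bar> full turns lead from 0 at
      least to x, and from x at least to 0.\<close>
    have "x \<le> 0 + \<bar>x\<bar> * int \<N>" "0 \<le> x + \<bar>x\<bar> * int \<N>"
      using N mult_left_mono[of 1 "int \<N>" "\<bar>x\<bar>"] by auto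
    from mono[OF this(1)] mono[OF this(2)] show "plen (vt x) \<le> plen (vt 0)" "plen (vt 0) \<le> plen (vt x)"
      by (simp_all only: vt_shift)
  qed
  then show thesis using that[of "plen (vt 0)"] vt_surj by metis
qed

text \<open>With a constant length p of the projectives, \<Omega>^2 is the translation by p, and
  \<open>\<N>\<close> of these translations amount to p full turns.\<close>

lemma strict_periodic:
  assumes "strict" shows "periodic_from 0"
  unfolding periodic_from_def
proof (intro ballI impI)
  fix c assume "c \<in> codes" "live ((om ^^ 0) c)"
  then have "live c" by simp
  then obtain x y where xy: "c = iv x y" "x < y" "y < e x" by (rule live_ivE)
  obtain p where p: "\<And>a. a \<in> verts \<Lambda> \<Longrightarrow> plen a = p" using strict_plen[OF assms] by blast
  have e: "e z = z + int p" for z by (simp add: e_def p)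
  have "((om ^^ 2) ^^ k) c = iv (x + int k * int p) (y + int k * int p)" for k
  proof (induction k)
    case (Suc k)
    have "((om ^^ 2) ^^ Suc k) c = (om ^^ 2) (iv (x + int k * int p) (y + int k * int p))"
      using Suc by simp
    also have "\<dots> = iv (x + int (Suc k) * int p) (y + int (Suc k) * int p)"
      using xy by (subst om2_iv) (auto simp: e algebra_simps)
    finally show ?case .
  qed (simp add: xy)
  from this[of \<N>] have "((om ^^ 2) ^^ \<N>) c = c"
    using iv_eq_iff[of x y "x + int \<N> * int p" "y + int \<N> * int p"] xy by (auto simp: mult.commute)
  then have "(om ^^ (2 * \<N>)) c = c" by (simp add: funpow_mult mult.commute)
  then show "\<exists>m\<ge>1. (om ^^ m) ((om ^^ 0) c) = (om ^^ 0) c"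
    using nverts_ge by (intro exI[of _ "2 * \<N>"]) auto
qed

lemma not_strict_not_periodic:
  assumes "\<not> strict" shows "\<not> periodic_from 1"
proof
  assume p: "periodic_from 1"
  obtain x where "\<not> e x < e (x + 1)" using assms by (auto simp: strict_def)
  then have x: "e (x + 1) = e x" using e_step[of x] by simp
  \<comment> \<open>Over one turn \<open>e\<close> grows by the number of vertices. The step at x
    contributes nothing, so some step contributes at least 2: otherwise the remaining
    \<open>\<N> - 1\<close> steps could not make up for it.\<close>
  obtain z where z: "e (z + 1) \<ge> e z + 2"
  proof (rule ccontr)
    assume "\<not> thesis"
    have s: "e (z + 1) \<le> e z + 1" for z
    proof -
      have "\<not> e z + 2 \<le> e (z + 1)" using that[of z] \<open>\<not> thesis\<close> by blast
      then show ?thesis by linarith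
    qed
    have "e (x + 1 + int k) \<le> e (x + 1) + int k" for k
    proof (induction k)
      case (Suc k)
      have "x + 1 + int (Suc k) = x + 1 + int k + 1" by simp
      then have "e (x + 1 + int (Suc k)) \<le> e (x + 1 + int k) + 1" using s[of "x + 1 + int k"] by metis
      then show ?case using Suc by simp
    qed simp
    from this[of "\<N> - 1"] show False
      using e_shift[of x 1] x nverts_ge by (simp add: of_nat_diff)
  qed
  \<comment> \<open>The value y - 1 is skipped by \<open>e\<close>: as e z < y - 1 < e (z + 1), it
    could only be taken strictly between z and z + 1.\<close>
  define y where "y = e (z + 1)"
  have y1: "y - 1 \<notin> range e"
  proof
    assume "y - 1 \<in> range e"
    then obtain w where w: "e w = y - 1" by (metis rangeE)
    have "z < w" by (rule e_less) (use w z in \<open>simp add: y_def\<close>)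
    moreover have "w < z + 1" by (rule e_less) (use w in \<open>simp add: y_def\<close>)
    ultimately show False by simp
  qed
  have a: "z + 1 < y - 1" "y - 1 < e (z + 1)" using e_ge[of "z + 1"] by (auto simp: y_def)
  \<comment> \<open>Removing the socle from the projective interval at z + 1 leaves [z + 1, y - 1),
    whose syzygy is that socle. Projectives have length at least 2, so the quotient is nonzero and
    the simple socle is not projective.\<close>
  have om: "(om ^^ 1) (iv (z + 1) (y - 1)) = iv (y - 1) y" using om_iv[of "z + 1" "y - 1"] a by (simp add: y_def)
  have ey: "y < e (y - 1)" using e_ge[of "y - 1"] by simp
  have "periodic_code (iv (y - 1) y)"
    using p[unfolded periodic_from_def, rule_format, of "iv (z + 1) (y - 1)"] om a ey
    by (simp add: iv_code iv_live periodic_code_def)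
  then show False using periodic_code_endpoints(1)[of "y - 1" y] ey y1 by simp
qed

section \<open>Consecutive points of the image of \<open>e\<close>\<close>

definition consec :: "int \<Rightarrow> int \<Rightarrow> bool" where
  "consec x y \<longleftrightarrow> x \<in> range e \<and> y \<in> range e \<and> x < y \<and> (\<forall>w. x < w \<and> w < y \<longrightarrow> w \<notin> range e)"

lemma range_e_shift: "x \<in> range e \<Longrightarrow> x + k * int \<N> \<in> range e"
  using e_shift by (metis rangeE rangeI)

lemma consec_succ:
  assumes "x \<in> range e" obtains y where "consec x y"
proof -
  \<comment> \<open>The point one turn after x lies in the image of \<open>e\<close>, so the next
    point is found among finitely many candidates.\<close>
  let ?S = "{y \<in> range e. x < y \<and> y \<le> x + int \<N>}"
  have fin: "finite ?S" by (rule finite_subset[of _ "{x..x + int \<N>}"]) auto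
  have ne: "x + int \<N> \<in> ?S" using range_e_shift[OF assms, of 1] nverts_ge by simp
  have m: "Min ?S \<in> ?S" using fin ne Min_in by blast
  define y where "y = Min ?S"
  have y: "y \<in> range e" "x < y" "y \<le> x + int \<N>" using m unfolding y_def by blast+
  have "w \<notin> range e" if w: "x < w" "w < y" for w
  proof
    assume "w \<in> range e"
    then have "w \<in> ?S" using w y by auto
    then have "y \<le> w" unfolding y_def by (rule Min_le[OF fin])
    then show False using w(2) by simp
  qed
  then have "consec x y" using assms y unfolding consec_def by blast
  then show thesis by (rule that)
qed

lemma consec_unique: "consec x y \<Longrightarrow> consec x z \<Longrightarrow> y = z"
  unfolding consec_def by (metis linorder_neqE_linordered_idom)

lemma consec_le: "consec x y \<Longrightarrow> w \<in> range e \<Longrightarrow> x < w \<Longrightarrow> y \<le> w"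
  unfolding consec_def by (meson linorder_not_less)

lemma consec_le_e: "consec x y \<Longrightarrow> y \<le> e x"
  by (rule consec_le) (use e_ge[of x] in auto)

text \<open>Since \<Omega>^2 [a, b) = [e a, e b), the live second syzygies are exactly the live
  intervals with both end points in the image of \<open>e\<close>.\<close>

lemma periodic_from_2_iff:
  "periodic_from 2 \<longleftrightarrow> (\<forall>x\<in>range e. \<forall>y\<in>range e. x < y \<and> y < e x \<longrightarrow> periodic_code (iv x y))"
proof
  assume p: "periodic_from 2"
  show "\<forall>x\<in>range e. \<forall>y\<in>range e. x < y \<and> y < e x \<longrightarrow> periodic_code (iv x y)"
  proof (intro ballI impI)
    fix x y assume "x \<in> range e" "y \<in> range e" and xy: "x < y \<and> y < e x"
    then obtain a b where ab: "x = e a" "y = e b" by blast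
    then have "a < b" "b < e a" using xy e_less by auto
    then have "(om ^^ 2) (iv a b) = iv x y" "iv a b \<in> codes" using om2_iv ab iv_code by auto
    moreover have "live (iv x y)" using xy by (simp add: iv_live)
    ultimately show "periodic_code (iv x y)"
      using p[unfolded periodic_from_def, rule_format, of "iv a b"] by (simp add: periodic_code_def)
  qed
next
  assume r: "\<forall>x\<in>range e. \<forall>y\<in>range e. x < y \<and> y < e x \<longrightarrow> periodic_code (iv x y)"
  show "periodic_from 2"
    unfolding periodic_from_def
  proof (intro ballI impI)
    fix c assume c: "c \<in> codes" "live ((om ^^ 2) c)"
    then obtain a b where ab: "c = iv a b" "a < b" "b < e a" using live_om_powD live_ivE by metis
    have o: "(om ^^ 2) c = iv (e a) (e b)" using om2_iv ab by simp
    then have "e a < e b" "e b < e (e a)" using c(2) iv_live[of "e a" "e b"] e_mono[of a b] ab by auto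
    then show "\<exists>m\<ge>1. (om ^^ m) ((om ^^ 2) c) = (om ^^ 2) c" using r o by (auto simp: periodic_code_def)
  qed
qed

lemma consec_periodic_imp:
  assumes c: "\<And>x y. consec x y \<Longrightarrow> live (iv x y) \<and> periodic_code (iv x y)"
  shows "periodic_from 2"
proof -
  \<comment> \<open>For the successor s of x, the interval [x, s) is live and periodic, so [e x, e
    s) is live and in particular nonempty; moreover s \<le> y.\<close>
  have mono: "e x < e y" if "x \<in> range e" "y \<in> range e" "x < y" for x y
  proof -
    obtain s where s: "consec x s" using consec_succ[OF \<open>x \<in> range e\<close>] .
    have xs: "x < s" using s by (simp add: consec_def)
    have l: "live (iv x s)" "periodic_code (iv x s)" using c[OF s] by auto
    then have se: "s < e x" using xs by (simp add: iv_live)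
    have "live (iv (e x) (e s))" using periodic_code_live[OF l, of 2] om2_iv[OF xs se] by simp
    then have "e x < e s" using e_mono[of x s] xs iv_live by simp
    also have "e s \<le> e y" by (rule e_mono[OF consec_le[OF s that(2,3)]])
    finally show ?thesis .
  qed
  have inj: "x = y" if "x \<in> range e" "y \<in> range e" "e x = e y" for x y
    using mono[OF that(1,2)] mono[OF that(2,1)] that(3) by (cases x y rule: linorder_cases) auto
  \<comment> \<open>The live intervals with end points in the image of \<open>e\<close>. Strict
    monotonicity on this image keeps them live under \<Omega>^2 and makes \<Omega>^2 injective on
    them, up to translation by full turns.\<close>
  define Q where "Q = {iv x y |x y. x \<in> range e \<and> y \<in> range e \<and> x < y \<and> y < e x}"
  have om2: "(om ^^ 2) (iv x y) \<in> Q" if "x \<in> range e" "y \<in> range e" "x < y" "y < e x" for x y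
    unfolding om2_iv[OF that(3,4)] Q_def using mono[OF that(1-3)] mono[OF that(2) _ that(4)] by blast
  have maps: "(om ^^ 2) ` Q \<subseteq> Q" using om2 by (auto simp: Q_def simp del: funpow.simps)
  have fin: "finite Q" by (rule finite_subset[OF _ finite_codes]) (auto simp: Q_def iv_code)
  have injQ: "inj_on (om ^^ 2) Q"
  proof (rule inj_onI)
    fix p q assume "p \<in> Q" "q \<in> Q" and eq: "(om ^^ 2) p = (om ^^ 2) q"
    then obtain x y u v where p: "p = iv x y" "x \<in> range e" "y \<in> range e" "x < y" "y < e x"
      and q: "q = iv u v" "u \<in> range e" "v \<in> range e" "u < v" "v < e u" unfolding Q_def by blast
    have "iv (e x) (e y) = iv (e u) (e v)" using eq om2_iv p q by simp
    then obtain k where k: "e u = e x + k * int \<N>" "e v = e y + k * int \<N>"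
      using iv_eq_iff[of "e x" "e y" "e u" "e v"] e_mono[of x y] e_mono[of u v] p q by auto
    have "u = x + k * int \<N>" "v = y + k * int \<N>"
      using inj[OF q(2) range_e_shift[OF p(2)]] inj[OF q(3) range_e_shift[OF p(3)]] k by (simp_all add: e_shift)
    then show "p = q" using iv_eq_iff[of x y u v] p q by auto
  qed
  show ?thesis
    unfolding periodic_from_2_iff
  proof (intro ballI impI)
    fix x y assume "x \<in> range e" "y \<in> range e" "x < y \<and> y < e x"
    then have "iv x y \<in> Q" unfolding Q_def by blast
    then obtain m where m: "m \<ge> 1" "((om ^^ 2) ^^ m) (iv x y) = iv x y"
      using finite_inj_periodic[OF fin injQ maps] by blast
    then have "(om ^^ (2 * m)) (iv x y) = iv x y" by (simp add: funpow_mult mult.commute)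
    then show "periodic_code (iv x y)" unfolding periodic_code_def using m(1) by (intro exI[of _ "2 * m"]) simp
  qed
qed

text \<open>If \<open>e z\<close> is the successor of \<open>z\<close> in \<open>range e\<close>, then so it is for the predecessor of \<open>z\<close>, as
  otherwise the interval between the two would be periodic but killed by \<open>\<Omega>\<^sup>2\<close>. Hence this holds
  everywhere or nowhere, and if it holds everywhere then all second syzygies are projective.\<close>

lemma periodic_imp_consec:
  assumes p: "periodic_from 2" and l: "c \<in> codes" "live ((om ^^ 2) c)" and xy: "consec x y"
  shows "live (iv x y) \<and> periodic_code (iv x y)"
proof -
  have per: "live (iv z w) \<and> periodic_code (iv z w)" if "z \<in> range e" "w \<in> range e" "z < w" "w < e z" for z w
    using p that iv_live[of z w] unfolding periodic_from_2_iff by auto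
  have pred: "e w = z" if w: "consec w z" and z: "consec z (e z)" for w z
  proof (rule ccontr)
    assume "e w \<noteq> z"
    then have lt: "w < z" "z < e w" using w consec_le_e[OF w] by (auto simp: consec_def)
    \<comment> \<open>As z < e w, the successor e z of z is at most e w. Then [w, z) is live with an
      empty second syzygy, yet periodic by hypothesis.\<close>
    have "e z \<le> e w" by (rule consec_le[OF z _ lt(2)]) simp
    then have eq: "e w = e z" using e_mono[of w z] lt by simp
    have "live (iv w z)" "periodic_code (iv w z)" using per[OF _ _ lt] w by (auto simp: consec_def)
    then have "live (iv (e w) (e z))" using periodic_code_live[of "iv w z" 2] om2_iv[OF lt] by simp
    then show False using eq iv_live[of "e w" "e z"] by simp
  qed
  have "\<not> consec z0 (e z0)" for z0
  proof
    assume z0: "consec z0 (e z0)"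
    \<comment> \<open>The exceptional point is translated by full turns so that the descent through
      predecessors can start above any given point.\<close>
    have shift: "consec (z0 + k * int \<N>) (e (z0 + k * int \<N>))" for k
      unfolding consec_def
    proof (intro conjI allI impI)
      show "z0 + k * int \<N> \<in> range e" using z0 range_e_shift by (simp add: consec_def)
      show "z0 + k * int \<N> < e (z0 + k * int \<N>)" using e_ge[of "z0 + k * int \<N>"] by simp
      fix w assume w: "z0 + k * int \<N> < w \<and> w < e (z0 + k * int \<N>)"
      show "w \<notin> range e"
      proof
        assume "w \<in> range e"
        from range_e_shift[OF this, of "- k"] have "w - k * int \<N> \<in> range e" by simp
        then show False using z0 w unfolding consec_def e_shift by (metis add_less_cancel_right diff_add_cancel)
      qed
    qed simp
    have down: "consec z (e z)" if "consec z1 (e z1)" "z \<in> range e" "z \<le> z1" for z z1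
      using that(2,3)
    proof (induction "nat (z1 - z)" arbitrary: z rule: less_induct)
      case less
      show ?case
      proof (cases "z = z1")
        case True
        then show ?thesis using that(1) by simp
      next
        case False
        obtain s where s: "consec z s" using consec_succ[OF less.prems(1)] .
        have "z1 \<in> range e" using that(1) by (simp add: consec_def)
        then have "s \<le> z1" using consec_le[OF s] less.prems False by simp
        moreover have "z < s" "s \<in> range e" using s by (auto simp: consec_def)
        ultimately have "consec s (e s)" using less.hyps[of s] by simp
        then show ?thesis using pred[OF s] s by simp
      qed
    qed
    have all: "consec z (e z)" if "z \<in> range e" for z
    proof (rule down[OF shift that])
      show "z \<le> z0 + \<bar>z - z0\<bar> * int \<N>"
        using nverts_ge mult_left_mono[of 1 "int \<N>" "\<bar>z - z0\<bar>"] by auto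
    qed
    \<comment> \<open>The live second syzygy [e a, e b) has its end point e b strictly between e a
      and e (e a), which contradicts that these are consecutive.\<close>
    obtain a b where ab: "c = iv a b" "a < b" "b < e a" using live_om_powD[OF l] live_ivE by metis
    have "e a < e b" "e b < e (e a)"
      using l(2) om2_iv[OF ab(2,3)] iv_live[of "e a" "e b"] e_mono[of a b] ab by auto
    then show False using all[of "e a"] unfolding consec_def by blast
  qed
  then have "y \<noteq> e x" using xy by blast
  then have "y < e x" using consec_le_e[OF xy] by simp
  then show ?thesis using per xy by (auto simp: consec_def)
qed

text \<open>Used contrapositively: infinite global dimension provides an interval whose second
  syzygy is not projective.\<close>

lemma gl_dim_le_2:
  assumes "\<And>c. c \<in> codes \<Longrightarrow> \<not> live ((om ^^ 2) c)"
  shows "gl_dim TYPE('k::field) \<Lambda> \<le> 2"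
  unfolding gl_dim_def
proof (rule SUP_least)
  fix M :: "'k rep" assume M: "M \<in> modules \<Lambda>"
  have res: "proj_res_le \<Lambda> (Suc n) X" if X: "X \<in> modules \<Lambda>" and r: "proj_res_le \<Lambda> n (Syz \<Lambda> X)" for n and X :: "'k rep"
  proof -
    obtain P p where "projective_cover \<Lambda> P p X" "Syz \<Lambda> X = P\<lparr>vsp := kernel_fam P p\<rparr>" using Syz_cover[OF X] .
    then show ?thesis using r by (auto simp: projective_cover_def)
  qed
  obtain cs where cs: "set cs \<subseteq> {c \<in> codes. 0 < snd c}" "isomorphic \<Lambda> M (dsum cs)"
    using decomposition[OF M] .
  have cs': "set cs \<subseteq> codes" using cs(1) by auto
  have cm: "set (map (om ^^ 2) cs) \<subseteq> codes" using cs' om_pow_codes[of _ 2] by (auto simp del: funpow.simps)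
  have "projective \<Lambda> (dsum (map (om ^^ 2) cs) :: 'k rep)"
    by (rule projective_dsum[OF cm]) (use cs' assms in \<open>auto simp del: funpow.simps\<close>)
  moreover have "isomorphic \<Lambda> ((Syz \<Lambda> ^^ 2) M) (dsum (map (om ^^ 2) cs))"
    by (rule isomorphic_trans[OF Syz_pow_cong[OF M dsum_module[OF cs'] cs(2)] Syz_pow_dsum[OF cs']])
  then have "isomorphic \<Lambda> (dsum (map (om ^^ 2) cs)) ((Syz \<Lambda> ^^ 2) M)"
    by (rule isomorphic_sym[OF _ Syz_pow_module[OF M]])
  ultimately have "projective \<Lambda> ((Syz \<Lambda> ^^ 2) M)"
    by (rule projective_iso[OF _ Syz_pow_module[OF M]])
  then have "proj_res_le \<Lambda> 0 (Syz \<Lambda> (Syz \<Lambda> M))" by (simp add: numeral_2_eq_2)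
  then have "proj_res_le \<Lambda> 2 M"
    unfolding numeral_2_eq_2 by (intro res M Syz_module)
  then have "proj_dim \<Lambda> M \<le> enat 2" unfolding proj_dim_def by (intro INF_lower) simp
  then show "proj_dim \<Lambda> M \<le> 2" by (simp add: numeral_eq_enat)
qed

section \<open>The relations and the steps of \<open>e\<close>\<close>

text \<open>The position over the start of relation j within the turn that begins at 0.\<close>

definition st :: "nat \<Rightarrow> int" where "st j = int (kidx \<Lambda> (2 * j - 1)) - 1"

lemma vt_st: "j \<in> {1..nrels \<Lambda>} \<Longrightarrow> vt (st j) = kidx \<Lambda> (2 * j - 1)"
  using vt_surj[OF rel_facts(2)] by (simp add: st_def)

lemma st_less:
  assumes "i \<in> {1..nrels \<Lambda>}" "j \<in> {1..nrels \<Lambda>}" "i < j" shows "st i < st j"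
  using assms(3,1,2)
proof (induction rule: strict_inc_induct)
  case (base i)
  then have "i \<in> {1..<nrels \<Lambda>}" "j = i + 1" by auto
  then have "kidx \<Lambda> (2 * i - 1) < kidx \<Lambda> (2 * i + 1)" using cyclic by (simp add: cyclic_nakayama_def)
  then show ?case using \<open>j = i + 1\<close> by (simp add: st_def)
next
  case (step i)
  then have "i \<in> {1..<nrels \<Lambda>}" by auto
  then have "kidx \<Lambda> (2 * i - 1) < kidx \<Lambda> (2 * i + 1)" using cyclic by (simp add: cyclic_nakayama_def)
  then have "st i < st (Suc i)" by (simp add: st_def)
  also have "st (Suc i) < st j" using step by auto
  finally show ?case .
qed

lemma st_bounds: "j \<in> {1..nrels \<Lambda>} \<Longrightarrow> 0 \<le> st j \<and> st j < int \<N>"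
  using rel_facts(2)[of j] by (auto simp: st_def verts_def)

lemma irredundant:
  assumes "i \<in> {1..nrels \<Lambda>}" "j \<in> {1..nrels \<Lambda>}" "x + rlen \<Lambda> j \<le> rlen \<Lambda> i"
    "(nxt \<Lambda> ^^ x) (kidx \<Lambda> (2 * i - 1)) = kidx \<Lambda> (2 * j - 1)"
  shows "i = j \<and> x = 0"
proof -
  have "\<not> path_in_ideal \<Lambda> (rel_path \<Lambda> ` ({1..nrels \<Lambda>} - {i})) (rel_path \<Lambda> i)"
    using cyclic assms(1) unfolding cyclic_nakayama_def by blast
  moreover have "path_in_ideal \<Lambda> (rel_path \<Lambda> ` ({1..nrels \<Lambda>} - {i})) (rel_path \<Lambda> i)" if "i \<noteq> j"
    unfolding path_in_ideal_def
    by (intro bexI[of _ "rel_path \<Lambda> j"]) (use assms that in \<open>auto simp: rel_path_def\<close>)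
  ultimately have "i = j" by blast
  then show ?thesis using assms(3) by simp
qed

text \<open>A shorter zero path from the start of relation j would contain another relation inside
  relation j, against irredundancy.\<close>

lemma plen_rel: "j \<in> {1..nrels \<Lambda>} \<Longrightarrow> plen (kidx \<Lambda> (2 * j - 1)) = rlen \<Lambda> j"
proof (rule antisym)
  assume j: "j \<in> {1..nrels \<Lambda>}"
  let ?a = "kidx \<Lambda> (2 * j - 1)"
  note a = rel_facts(2)[OF j]
  show "plen ?a \<le> rlen \<Lambda> j"
    unfolding zero_path_plen[OF a, symmetric] zero_path_iff
    by (intro bexI[OF _ j] exI[of _ 0]) simp
  have "zero_path \<Lambda> (?a, plen ?a)" using zero_path_plen[OF a] by simp
  then obtain i x where i: "i \<in> {1..nrels \<Lambda>}" "x + rlen \<Lambda> i \<le> plen ?a"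
    "(nxt \<Lambda> ^^ x) ?a = kidx \<Lambda> (2 * i - 1)" unfolding zero_path_iff by blast
  have "i = j" if "plen ?a \<le> rlen \<Lambda> j" using irredundant[OF j i(1) _ i(3)] i(2) that by simp
  then show "rlen \<Lambda> j \<le> plen ?a" using i(2) by (cases "plen ?a \<le> rlen \<Lambda> j") auto
qed

lemma e_st: "j \<in> {1..nrels \<Lambda>} \<Longrightarrow> e (st j) = st j + int (rlen \<Lambda> j)"
  unfolding e_def by (simp only: vt_st plen_rel)

text \<open>If \<open>e\<close> did not increase after the start of relation j, that relation
  without its first arrow would still be a zero path and so contain another relation.\<close>

lemma e_st_less: "j \<in> {1..nrels \<Lambda>} \<Longrightarrow> e (st j) < e (st j + 1)"
proof (rule ccontr)
  assume j: "j \<in> {1..nrels \<Lambda>}" and "\<not> e (st j) < e (st j + 1)"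
  let ?a = "kidx \<Lambda> (2 * j - 1)"
  have "plen (nxt \<Lambda> ?a) \<le> rlen \<Lambda> j - 1"
    using \<open>\<not> e (st j) < e (st j + 1)\<close> e_st[OF j] by (simp add: e_def nxt_vt[symmetric] vt_st[OF j])
  then have "zero_path \<Lambda> (nxt \<Lambda> ?a, rlen \<Lambda> j - 1)" using zero_path_plen by simp
  then obtain i x where i: "i \<in> {1..nrels \<Lambda>}" "x + rlen \<Lambda> i \<le> rlen \<Lambda> j - 1"
    "(nxt \<Lambda> ^^ x) (nxt \<Lambda> ?a) = kidx \<Lambda> (2 * i - 1)" unfolding zero_path_iff by blast
  have "(nxt \<Lambda> ^^ Suc x) ?a = kidx \<Lambda> (2 * i - 1)" using i(3) by (simp add: funpow_swap1)
  moreover have "Suc x + rlen \<Lambda> i \<le> rlen \<Lambda> j" using i(2) rel_facts(1)[OF j] by simp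
  ultimately show False using irredundant[OF j i(1)] by blast
qed

lemma e_not_start:
  assumes "\<And>j. j \<in> {1..nrels \<Lambda>} \<Longrightarrow> vt x \<noteq> kidx \<Lambda> (2 * j - 1)"
  shows "e (x + 1) = e x"
proof -
  have "zero_path \<Lambda> (vt x, plen (vt x))" using zero_path_plen by simp
  then obtain i l where i: "i \<in> {1..nrels \<Lambda>}" "l + rlen \<Lambda> i \<le> plen (vt x)"
    "(nxt \<Lambda> ^^ l) (vt x) = kidx \<Lambda> (2 * i - 1)" unfolding zero_path_iff by blast
  then obtain l' where l: "l = Suc l'" using assms by (cases l) auto
  then have "(nxt \<Lambda> ^^ l') (nxt \<Lambda> (vt x)) = kidx \<Lambda> (2 * i - 1)" using i(3) by (simp add: funpow_swap1)
  then have "zero_path \<Lambda> (nxt \<Lambda> (vt x), plen (vt x) - 1)"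
    unfolding zero_path_iff using i l by (intro bexI[OF _ i(1)] exI[of _ l']) auto
  then have "plen (nxt \<Lambda> (vt x)) \<le> plen (vt x) - 1" using zero_path_plen by simp
  then have "e (x + 1) \<le> e x" using plen_ge[OF vt_verts, of x] by (simp add: e_def nxt_vt)
  then show ?thesis using e_step[of x] by simp
qed

text \<open>Moving x forward to the next start of a relation does not change its value under
  \<open>e\<close>; so the points of the image are, up to full turns, the ends of the
  relations.\<close>

lemma range_e: "w \<in> range e \<longleftrightarrow> (\<exists>j\<in>{1..nrels \<Lambda>}. \<exists>k. w = e (st j) + k * int \<N>)"
proof
  assume "w \<in> range e"
  then obtain x where x: "w = e x" by blast
  have one: "1 \<in> {1..nrels \<Lambda>}" using nrels_ge by simp
  obtain l where "(nxt \<Lambda> ^^ l) (vt x) = kidx \<Lambda> (2 * 1 - 1)"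
    using nxt_pow_reach[OF vt_verts rel_facts(2)[OF one]] .
  then have "\<exists>j\<in>{1..nrels \<Lambda>}. vt (x + int l) = kidx \<Lambda> (2 * j - 1)"
    by (intro bexI[OF _ one]) (simp add: nxt_pow_vt)
  then have "\<exists>j\<in>{1..nrels \<Lambda>}. \<exists>k. e x = e (st j) + k * int \<N>"
  proof (induction l arbitrary: x)
    case 0
    then obtain j where j: "j \<in> {1..nrels \<Lambda>}" "vt x = vt (st j)" using vt_st by auto
    then obtain k where "x = st j + k * int \<N>"
      unfolding vt_eq_iff by (metis add.commute mod_eqE mult.commute)
    then show ?case using j e_shift by blast
  next
    case (Suc l)
    show ?case
    proof (cases "\<exists>j\<in>{1..nrels \<Lambda>}. vt x = kidx \<Lambda> (2 * j - 1)")
      case True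
      then obtain j where j: "j \<in> {1..nrels \<Lambda>}" "vt x = vt (st j)" using vt_st by auto
      then obtain k where "x = st j + k * int \<N>"
        unfolding vt_eq_iff by (metis add.commute mod_eqE mult.commute)
      then show ?thesis using j e_shift by blast
    next
      case False
      have "x + int (Suc l) = (x + 1) + int l" by simp
      then show ?thesis using Suc.IH[of "x + 1"] Suc.prems e_not_start[of x] False by metis
    qed
  qed
  then show "\<exists>j\<in>{1..nrels \<Lambda>}. \<exists>k. w = e (st j) + k * int \<N>" by (simp add: x)
next
  assume "\<exists>j\<in>{1..nrels \<Lambda>}. \<exists>k. w = e (st j) + k * int \<N>"
  then show "w \<in> range e" using range_e_shift by blast
qed

lemma e_st_mono: "i \<in> {1..nrels \<Lambda>} \<Longrightarrow> j \<in> {1..nrels \<Lambda>} \<Longrightarrow> i < j \<Longrightarrow> e (st i) < e (st j)"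
  using e_st_less[of i] e_mono[of "st i + 1" "st j"] st_less[of i j] by simp

lemma e_st_last: "i \<in> {1..nrels \<Lambda>} \<Longrightarrow> j \<in> {1..nrels \<Lambda>} \<Longrightarrow> e (st i) < e (st j) + int \<N>"
  using e_st_less[of i] e_mono[of "st i + 1" "st j + 1 * int \<N>"] e_shift[of "st j" 1] st_bounds[of i] st_bounds[of j]
  by simp

text \<open>The ends of the relations in increasing order. Index 0 is the end of the last relation
  moved back by one turn, in accordance with the convention k_0 = k_{2r}.\<close>

definition ee :: "nat \<Rightarrow> int" where
  "ee j = (if j = 0 then e (st (nrels \<Lambda>)) - int \<N> else e (st j))"

text \<open>The bound by one turn, for which two relations are needed, later makes these intervals
  the shortest ones with their top and socle.\<close>

lemma consec_ee:
  assumes j: "j \<in> {1..nrels \<Lambda>}"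
  shows "consec (ee (j - 1)) (ee j)" "ee j - ee (j - 1) < int \<N>"
proof -
  let ?r = "nrels \<Lambda>"
  have r: "?r \<in> {1..?r}" "1 \<in> {1..?r}" "1 < ?r" using nrels_ge by auto
  have eej: "ee j = e (st j)" using j by (simp add: ee_def)
  have rng: "ee (j - 1) \<in> range e" "ee j \<in> range e"
    using range_e_shift[of "e (st ?r)" "-1"] by (auto simp: ee_def)
  have less: "ee (j - 1) < ee j"
  proof (cases "j = 1")
    case True
    then show ?thesis using e_st_last[OF r(1) r(2)] by (simp add: ee_def)
  next
    case False
    then show ?thesis using e_st_mono[of "j - 1" j] j by (auto simp: ee_def)
  qed
  show "ee j - ee (j - 1) < int \<N>"
  proof (cases "j = 1")
    case True
    then show ?thesis using e_st_mono[OF r(2,1,3)] by (simp add: ee_def)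
  next
    case False
    then have "j - 1 \<in> {1..?r}" "j - 1 \<noteq> 0" using j by auto
    then show ?thesis using e_st_last[OF j, of "j - 1"] by (simp add: ee_def)
  qed
  have N: "int \<N> > 0" using nverts_ge by simp
  have "w \<notin> range e" if w: "ee (j - 1) < w" "w < ee j" for w
  proof
    assume "w \<in> range e"
    then obtain i k where i: "i \<in> {1..?r}" "w = e (st i) + k * int \<N>" unfolding range_e by blast
    have le: "e (st 1) \<le> e (st i)" "e (st i) \<le> e (st ?r)"
      using e_st_mono[OF r(2) i(1)] e_st_mono[OF i(1) r(1)] i(1) by (cases "i = 1"; cases "i = ?r"; force)+
    have k: "k \<le> 0"
    proof (rule ccontr)
      assume "\<not> k \<le> 0"
      then have "k * int \<N> \<ge> int \<N>" using N by simp
      then show False using w(2) i(2) e_st_last[OF j i(1)] eej by linarith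
    qed
    show False
    proof (cases "j = 1")
      case True
      then have "k \<noteq> 0" using w(2) i(2) le(1) eej by auto
      then have "k * int \<N> \<le> -1 * int \<N>" using k N by (intro mult_right_mono) auto
      then show False using w(1) i(2) le(2) True by (simp add: ee_def)
    next
      case False
      then have j1: "j - 1 \<in> {1..?r}" "ee (j - 1) = e (st (j - 1))" using j by (auto simp: ee_def)
      have "k = 0"
      proof (rule ccontr)
        assume "k \<noteq> 0"
        then have "k * int \<N> \<le> -1 * int \<N>" using k N by (intro mult_right_mono) auto
        then show False using w(1) i(2) j1 e_st_last[OF i(1) j1(1)] by simp
      qed
      then have wi: "w = e (st i)" using i(2) by simp
      have "j - 1 < i" using e_st_mono[OF i(1) j1(1)] w(1) wi j1(2) by (cases i "j - 1" rule: linorder_cases) auto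
      moreover have "i < j" using e_st_mono[OF j i(1)] w(2) wi eej by (cases i j rule: linorder_cases) auto
      ultimately show False by simp
    qed
  qed
  then show "consec (ee (j - 1)) (ee j)" using rng less by (auto simp: consec_def)
qed

lemma consec_iv_cases:
  assumes "consec x y" obtains j where "j \<in> {1..nrels \<Lambda>}" "iv x y = iv (ee (j - 1)) (ee j)"
proof -
  let ?r = "nrels \<Lambda>"
  have xy: "x \<in> range e" "x < y" using assms by (auto simp: consec_def)
  obtain i k where i: "i \<in> {1..?r}" "x = e (st i) + k * int \<N>" using xy(1) unfolding range_e by blast
  have shift: "consec (u + m * int \<N>) (v + m * int \<N>)" if "consec u v" for u v m
    unfolding consec_def
  proof (intro conjI allI impI)
    fix w assume w: "u + m * int \<N> < w \<and> w < v + m * int \<N>"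
    show "w \<notin> range e"
    proof
      assume "w \<in> range e"
      from range_e_shift[OF this, of "- m"] have "w - m * int \<N> \<in> range e" by simp
      moreover have "u < w - m * int \<N>" "w - m * int \<N> < v" using w by linarith+
      ultimately show False using that unfolding consec_def by blast
    qed
  qed (use that range_e_shift in \<open>auto simp: consec_def\<close>)
  have "\<exists>j m. j \<in> {1..?r} \<and> x = ee (j - 1) + m * int \<N>"
  proof (cases "i = ?r")
    case True
    \<comment> \<open>The end of the last relation is the left neighbour of the end of the first one
      in the next turn.\<close>
    have "x = ee (1 - 1) + (k + 1) * int \<N>" using i True by (simp add: ee_def algebra_simps)
    moreover have "1 \<in> {1..?r}" using nrels_ge by simp
    ultimately show ?thesis by blast
  next
    case False
    have "x = ee (Suc i - 1) + k * int \<N>" "Suc i \<in> {1..?r}" using i False by (auto simp: ee_def)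
    then show ?thesis by blast
  qed
  then obtain j m where j: "j \<in> {1..?r}" "x = ee (j - 1) + m * int \<N>" by blast
  have "y = ee j + m * int \<N>"
    using consec_unique[OF assms] shift[OF consec_ee(1)[OF j(1)], of m] j(2) by blast
  moreover have "ee (j - 1) < ee j" using consec_ee(1)[OF j(1)] by (simp add: consec_def)
  ultimately have "iv (ee (j - 1)) (ee j) = iv x y"
    using iv_eq_iff[of "ee (j - 1)" "ee j" x y] xy(2) j(2) by auto
  then show thesis using that j(1) by simp
qed

definition dcode :: "nat \<Rightarrow> nat \<times> nat" where "dcode j = iv (ee (j - 1)) (ee j)"

lemma dcode_codes: "j \<in> {1..nrels \<Lambda>} \<Longrightarrow> dcode j \<in> codes \<and> 0 < snd (dcode j)"
  using consec_ee(1)[of j] consec_le_e[OF consec_ee(1), of j] iv_code[of "ee (j - 1)" "ee j"]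
  by (auto simp: dcode_def consec_def iv_def)

text \<open>A nonzero projective interval has zero syzygy, and zero stays zero, so it is not
  periodic.\<close>

lemma dcode_periodic_live: "j \<in> {1..nrels \<Lambda>} \<Longrightarrow> periodic_code (dcode j) \<Longrightarrow> live (dcode j)"
proof (rule ccontr)
  assume j: "j \<in> {1..nrels \<Lambda>}" and p: "periodic_code (dcode j)" and d: "\<not> live (dcode j)"
  note c = dcode_codes[OF j]
  obtain m where m: "m \<ge> 1" "(om ^^ m) (dcode j) = dcode j" using p by (auto simp: periodic_code_def)
  have "snd (om (dcode j)) = 0" using c d by (auto simp: om_def live_def codes_def)
  then have "snd ((om ^^ k) (om (dcode j))) = 0" for k
    by (induction k) (auto simp: om_def)
  from this[of "m - 1"] have "snd ((om ^^ m) (dcode j)) = 0"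
    using m(1) by (metis Suc_diff_le diff_Suc_1 funpow_Suc_right comp_apply One_nat_def)
  then show False using m(2) c by simp
qed

text \<open>Infinite global dimension enters from left to right: without a live second syzygy the
  left side would hold vacuously.\<close>

theorem periodic_from_2_dcode:
  assumes "gl_dim TYPE('k::field) \<Lambda> = \<infinity>"
  shows "periodic_from 2 \<longleftrightarrow> (\<forall>j\<in>{1..nrels \<Lambda>}. periodic_code (dcode j))"
proof
  assume p: "periodic_from 2"
  have "\<not> gl_dim TYPE('k) \<Lambda> \<le> 2" using assms by (simp add: numeral_eq_enat)
  then obtain c where "c \<in> codes" "live ((om ^^ 2) c)" using gl_dim_le_2[where ?'k = 'k] by blast
  then show "\<forall>j\<in>{1..nrels \<Lambda>}. periodic_code (dcode j)"
    using periodic_imp_consec[OF p _ _ consec_ee(1)] unfolding dcode_def by blast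
next
  assume "\<forall>j\<in>{1..nrels \<Lambda>}. periodic_code (dcode j)"
  then have "live (iv x y) \<and> periodic_code (iv x y)" if "consec x y" for x y
    using consec_iv_cases[OF that] dcode_periodic_live unfolding dcode_def by metis
  then show "periodic_from 2" by (rule consec_periodic_imp)
qed

end

section \<open>Socle, radical and length\<close>

context nakayama
begin

lemma prv_nxt: "i \<in> verts \<Lambda> \<Longrightarrow> prv (nxt \<Lambda> i) = i"
  using nxt_inj[of "prv (nxt \<Lambda> i)" i] prv by simp

lemma submodulesD:
  assumes "W \<in> submodules \<Lambda> M"
  shows "amb.subspace (W i)" "v \<in> W i \<Longrightarrow> v \<in> vsp M i" "v \<in> W i \<Longrightarrow> arr M i v \<in> W (nxt \<Lambda> i)"
  using assms by (auto simp: submodules_def)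

lemma submodulesI:
  assumes "\<And>i. amb.subspace (W i)" "\<And>i v. v \<in> W i \<Longrightarrow> v \<in> vsp M i" "\<And>i v. v \<in> W i \<Longrightarrow> arr M i v \<in> W (nxt \<Lambda> i)"
  shows "W \<in> submodules \<Lambda> M"
  unfolding submodules_def using assms by auto

text \<open>The radical, as exactly one arrow ends at each vertex. Away from the vertices the value
  is set to zero, because \<open>prv\<close> always returns a vertex.\<close>

definition Jfam :: "'k::field rep \<Rightarrow> nat \<Rightarrow> 'k amb set" where
  "Jfam M i = (if i \<in> verts \<Lambda> then arr M (prv i) ` vsp M (prv i) else {0})"

lemma Jfam_nxt: "i \<in> verts \<Lambda> \<Longrightarrow> Jfam M (nxt \<Lambda> i) = arr M i ` vsp M i"
  by (simp add: Jfam_def prv_nxt)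

lemma Jfam_submodule:
  assumes M: "M \<in> modules \<Lambda>"
  shows "Jfam M \<in> submodules \<Lambda> M"
proof (rule submodulesI)
  show sub: "amb.subspace (Jfam M i)" for i
    using lp.linear_subspace_image[OF module_lin[OF M] module_subspace[OF M]] by (simp add: Jfam_def)
  fix i
  fix v assume v: "v \<in> Jfam M i"
  show vM: "v \<in> vsp M i"
    using v module_closed[OF M, of _ "prv i"] prv[of i] module_0[OF M] by (auto simp: Jfam_def split: if_splits)
  show "arr M i v \<in> Jfam M (nxt \<Lambda> i)"
  proof (cases "i \<in> verts \<Lambda>")
    case True
    then show ?thesis using vM by (simp add: Jfam_nxt)
  next
    case False
    then have "v = 0" using v by (simp add: Jfam_def)
    then show ?thesis using lin_0[OF module_lin[OF M]] amb.subspace_0[OF sub] by simp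
  qed
qed

lemma Jfam_full:
  assumes M: "M \<in> modules \<Lambda>" and W: "W \<in> submodules \<Lambda> M"
    and full: "\<And>i v. v \<in> vsp M i \<Longrightarrow> \<exists>w\<in>W i. \<exists>u\<in>Jfam M i. v = w + u"
  shows "W = vsp M"
proof (rule submodule_plus_radical[OF M W])
  fix i v assume i: "i \<in> verts \<Lambda>" and "v \<in> vsp M (nxt \<Lambda> i)"
  from full[OF this(2)] show "\<exists>w\<in>W (nxt \<Lambda> i). \<exists>u\<in>vsp M i. v = w + arr M i u"
    unfolding Jfam_nxt[OF i] by blast
qed

text \<open>By Nakayama's lemma the radical of a simple module is a proper submodule, hence
  zero.\<close>

lemma simple_mod_arr:
  assumes M: "M \<in> modules \<Lambda>" and W: "W \<in> submodules \<Lambda> M" and s: "simple_mod \<Lambda> (M\<lparr>vsp := W\<rparr>)"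
    and w: "w \<in> W i"
  shows "arr M i w = 0"
proof -
  let ?S = "M\<lparr>vsp := W\<rparr>"
  have S: "?S \<in> modules \<Lambda>" by (rule submodule_module[OF M W])
  have subs: "submodules \<Lambda> ?S = {\<lambda>i. {0}, W}" and nz: "\<not> zero_rep ?S"
    using s by (auto simp: simple_mod_def)
  have "Jfam ?S \<noteq> W"
  proof
    assume J: "Jfam ?S = W"
    have "(\<lambda>i. {0}) = vsp ?S"
    proof (rule Jfam_full[OF S])
      show "(\<lambda>i. {0}) \<in> submodules \<Lambda> ?S" by (simp add: subs)
      fix i v assume "v \<in> vsp ?S i"
      then show "\<exists>w\<in>{0}. \<exists>u\<in>Jfam ?S i. v = w + u" using J by simp
    qed
    then have "vsp ?S i = {0}" for i by (metis (no_types))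
    then show False using nz by (simp add: zero_rep_def)
  qed
  then have "Jfam ?S = (\<lambda>i. {0})" using Jfam_submodule[OF S] subs by blast
  show ?thesis
  proof (cases "i \<in> verts \<Lambda>")
    case True
    have "arr M i w \<in> Jfam ?S (nxt \<Lambda> i)" using w by (simp add: Jfam_nxt[OF True])
    then show ?thesis using \<open>Jfam ?S = (\<lambda>i. {0})\<close> by simp
  next
    case False
    then have "w = 0" using w submodulesD(2)[OF W w] module_outside[OF M] by auto
    then show ?thesis using lin_0[OF module_lin[OF M]] by simp
  qed
qed

text \<open>Simple submodules are killed by the arrows, and a nonzero vector killed by the arrow at
  its vertex spans a simple submodule.\<close>

lemma vsp_socle:
  assumes M: "M \<in> modules \<Lambda>"
  shows "vsp (socle \<Lambda> M) i = {v \<in> vsp M i. arr M i v = 0}"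
proof (intro equalityI subsetI)
  let ?K = "{v \<in> vsp M i. arr M i v = 0}"
  let ?U = "\<Union>W\<in>{W \<in> submodules \<Lambda> M. simple_mod \<Lambda> (M\<lparr>vsp := W\<rparr>)}. W i"
  have K: "amb.subspace ?K"
    using amb.subspace_inter[OF module_subspace[OF M, of i] lp.linear_subspace_kernel[OF module_lin[OF M, of i]]]
    by (simp add: Int_def)
  have socle: "vsp (socle \<Lambda> M) i = amb.span ?U" by (simp add: socle_def)
  {
    fix v assume "v \<in> vsp (socle \<Lambda> M) i"
    moreover have "amb.span ?U \<subseteq> ?K"
      by (rule amb.span_minimal[OF _ K]) (use simple_mod_arr[OF M] submodulesD(2) in blast)
    ultimately show "v \<in> ?K" using socle by blast
  }
  fix v assume v: "v \<in> ?K"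
  show "v \<in> vsp (socle \<Lambda> M) i"
  proof (cases "v = 0")
    case True
    then show ?thesis unfolding socle by (simp add: amb.span_zero)
  next
    case False
    define W where "W = (\<lambda>j. if j = i then amb.span {v} else {0})"
    have iv: "i \<in> verts \<Lambda>" using v False module_outside[OF M, of i] by auto
    have W0: "arr M j w = 0" if "w \<in> W j" for j w
      using that v lin_0[OF module_lin[OF M]] lin_scal[OF module_lin[OF M]]
      by (auto simp: W_def amb.span_singleton split: if_splits)
    have W0': "0 \<in> W j" for j by (simp add: W_def amb.span_zero)
    have W: "W \<in> submodules \<Lambda> M"
    proof (rule submodulesI)
      fix j w assume w: "w \<in> W j"
      show "w \<in> vsp M j"
        using w v module_0[OF M] amb.subspace_scale[OF module_subspace[OF M]]
        by (auto simp: W_def amb.span_singleton split: if_splits)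
      show "arr M j w \<in> W (nxt \<Lambda> j)" using W0[OF w] W0' by simp
    qed (simp add: W_def)
    have "simple_mod \<Lambda> (M\<lparr>vsp := W\<rparr>)"
      unfolding simple_mod_def
    proof (intro conjI submodule_module[OF M W])
      have vW: "v \<in> W i" by (simp add: W_def amb.span_base)
      then show "\<not> zero_rep (M\<lparr>vsp := W\<rparr>)" using False by (auto simp: zero_rep_def)
      show "submodules \<Lambda> (M\<lparr>vsp := W\<rparr>) = {\<lambda>i. {0}, vsp (M\<lparr>vsp := W\<rparr>)}"
      proof (intro equalityI subsetI)
        fix V assume V: "V \<in> submodules \<Lambda> (M\<lparr>vsp := W\<rparr>)"
        have sub: "amb.subspace (V j)" "V j \<subseteq> W j" for j
          using submodulesD[OF V] by auto
        have other: "V j = {0}" if "j \<noteq> i" for j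
          using sub[of j] that amb.subspace_0[OF sub(1)[of j]] by (auto simp: W_def)
        show "V \<in> {\<lambda>i. {0}, vsp (M\<lparr>vsp := W\<rparr>)}"
        proof (cases "V i = {0}")
          case True
          then have "V = (\<lambda>i. {0})" using other by (metis (full_types))
          then show ?thesis by simp
        next
          case False
          then obtain x where x: "x \<in> V i" "x \<noteq> 0" using amb.subspace_0[OF sub(1)] by blast
          then obtain k where k: "x = scal k v" using sub(2)[of i] by (auto simp: W_def amb.span_singleton)
          then have "k \<noteq> 0" using x by auto
          then have "v = scal (1 / k) x" using k by simp
          then have "v \<in> V i" using amb.subspace_scale[OF sub(1) x(1)] by simp
          then have "W i \<subseteq> V i" by (simp add: W_def amb.span_minimal sub(1))
          then have "V j = W j" for j using sub(2)[of j] other[of j] by (cases "j = i") (auto simp: W_def)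
          then have "V = W" by blast
          then show ?thesis by simp
        qed
      next
        fix V assume "V \<in> {\<lambda>i. {0}, vsp (M\<lparr>vsp := W\<rparr>)}"
        moreover have "(\<lambda>i. {0}) \<in> submodules \<Lambda> (M\<lparr>vsp := W\<rparr>)"
          by (rule submodulesI) (auto simp: W0' lin_0[OF module_lin[OF M]])
        moreover have "W \<in> submodules \<Lambda> (M\<lparr>vsp := W\<rparr>)"
          by (rule submodulesI) (use submodulesD[OF W] in auto)
        ultimately show "V \<in> submodules \<Lambda> (M\<lparr>vsp := W\<rparr>)" by auto
      qed
    qed
    moreover have "v \<in> W i" by (simp add: W_def amb.span_base)
    ultimately show ?thesis unfolding socle by (intro amb.span_base) (use W in blast)
  qed
qed

text \<open>A maximal submodule W that misses part of \<open>Jfam M\<close> would satisfy W +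
  \<open>Jfam M\<close> = M, against Nakayama's lemma. Conversely, a vector outside
  \<open>Jfam M\<close> is avoided by a maximal submodule, cut out by a functional at its
  vertex.\<close>

lemma radical_Jfam:
  assumes M: "M \<in> modules \<Lambda>"
  shows "radical \<Lambda> M = Jfam M"
proof (intro ext equalityI subsetI)
  note J = Jfam_submodule[OF M]
  fix i v
  {
    assume v: "v \<in> Jfam M i"
    have "v \<in> W i" if "W \<in> maximal_submodules \<Lambda> M" for W
    proof (rule ccontr)
      assume nv: "v \<notin> W i"
      have W: "W \<in> submodules \<Lambda> M" "W \<noteq> vsp M"
        and max: "\<And>V. V \<in> submodules \<Lambda> M \<Longrightarrow> W \<le> V \<Longrightarrow> V = W \<or> V = vsp M"
        using that by (auto simp: maximal_submodules_def)
      define V where "V = (\<lambda>i. {w + u |w u. w \<in> W i \<and> u \<in> Jfam M i})"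
      have V: "V \<in> submodules \<Lambda> M"
      proof (rule submodulesI)
        show "amb.subspace (V j)" for j
          unfolding V_def by (rule amb.subspace_sums[OF submodulesD(1)[OF W(1)] submodulesD(1)[OF J]])
        fix j x assume "x \<in> V j"
        then obtain w u where x: "x = w + u" "w \<in> W j" "u \<in> Jfam M j" by (auto simp: V_def)
        show "x \<in> vsp M j"
          unfolding x(1) using submodulesD(2)[OF W(1) x(2)] submodulesD(2)[OF J x(3)]
          by (rule amb.subspace_add[OF module_subspace[OF M]])
        show "arr M j x \<in> V (nxt \<Lambda> j)"
          unfolding x(1) lin_add[OF module_lin[OF M]] V_def
          using submodulesD(3)[OF W(1) x(2)] submodulesD(3)[OF J x(3)] by blast
      qed
      have 0: "0 \<in> W j" "0 \<in> Jfam M j" for j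
        using amb.subspace_0 submodulesD(1)[OF W(1)] submodulesD(1)[OF J] by blast+
      have WV: "w \<in> V j" if "w \<in> W j" for w j
        unfolding V_def using that 0(2)[of j] by (intro CollectI exI[of _ w] exI[of _ 0]) simp
      have "v \<in> V i" unfolding V_def using v 0(1)[of i] by (intro CollectI exI[of _ 0] exI[of _ v]) simp
      then have "V \<noteq> W" using nv by blast
      then have VM: "V = vsp M" using max[OF V] WV by (auto simp: le_fun_def)
      have "W = vsp M"
      proof (rule Jfam_full[OF M W(1)])
        fix j x assume "x \<in> vsp M j"
        then have "x \<in> V j" by (simp add: VM)
        then show "\<exists>w\<in>W j. \<exists>u\<in>Jfam M j. x = w + u" unfolding V_def by blast
      qed
      then show False using W(2) by simp
    qed
    then show "v \<in> radical \<Lambda> M i" using submodulesD(2)[OF J v] by (auto simp: radical_def)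
  }
  assume v: "v \<in> radical \<Lambda> M i"
  then have vM: "v \<in> vsp M i" by (simp add: radical_def)
  show "v \<in> Jfam M i"
  proof (rule ccontr)
    assume nv: "v \<notin> Jfam M i"
    obtain B where B: "B \<subseteq> Jfam M i" "amb.independent B" "Jfam M i \<subseteq> amb.span B" "card B = amb.dim (Jfam M i)"
      using amb.basis_exists by blast
    have sp: "amb.span B = Jfam M i" using B submodulesD(1)[OF J] by (simp add: amb.span_subspace)
    have "amb.independent (insert v B)" using nv B(2) sp by (simp add: amb.independent_insertI)
    \<comment> \<open>The functional is 1 at v and vanishes on \<open>Jfam M i\<close>. Because of
      the latter its kernel contains everything that the arrow into i produces, which makes
      \<open>W\<close> below a submodule.\<close>
    then obtain u where u: "Vector_Spaces.linear scal (*) u" "\<And>x. x \<in> insert v B \<Longrightarrow> u x = (if x = v then 1 else 0)"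
      using lf.linear_independent_extend[of "insert v B" "\<lambda>x. if x = v then 1 else 0"] by blast
    have uv: "u v = 1" using u(2) by simp
    have uJ: "u x = 0" if "x \<in> Jfam M i" for x
    proof (rule lf.linear_eq_on[OF u(1) lf.linear_zero])
      show "x \<in> amb.span B" using that sp by simp
      fix b assume "b \<in> B"
      then show "u b = 0" using u(2)[of b] B(1) nv by auto
    qed
    define W where "W = (\<lambda>j. if j = i then {x \<in> vsp M i. u x = 0} else vsp M j)"
    have iv: "i \<in> verts \<Lambda>"
    proof (rule ccontr)
      assume "i \<notin> verts \<Lambda>"
      then show False using vM nv module_outside[OF M] by (simp add: Jfam_def)
    qed
    have W: "W \<in> submodules \<Lambda> M"
    proof (rule submodulesI)
      show "amb.subspace (W j)" for j
        using amb.subspace_inter[OF module_subspace[OF M, of i] lf.linear_subspace_kernel[OF u(1)]] module_subspace[OF M]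
        by (auto simp: W_def Int_def)
      fix j x assume x: "x \<in> W j"
      show xM: "x \<in> vsp M j" using x by (auto simp: W_def split: if_splits)
      have "arr M j x \<in> Jfam M (nxt \<Lambda> j)"
      proof (cases "j \<in> verts \<Lambda>")
        case False
        then have "x = 0" using xM module_outside[OF M] by auto
        then show ?thesis
          using lin_0[OF module_lin[OF M]] amb.subspace_0[OF submodulesD(1)[OF J]] by simp
      qed (use xM in \<open>simp add: Jfam_nxt\<close>)
      then show "arr M j x \<in> W (nxt \<Lambda> j)" using uJ module_closed[OF M xM] by (auto simp: W_def)
    qed
    have "W \<in> maximal_submodules \<Lambda> M"
      unfolding maximal_submodules_def
    proof (intro CollectI conjI W ballI impI)
      have "v \<notin> W i" using uv by (simp add: W_def)
      then show "W \<noteq> vsp M" using vM by blast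
      fix V assume V: "V \<in> submodules \<Lambda> M" and WV: "W \<le> V"
      have WV': "x \<in> V j" if "x \<in> W j" for x j using WV that by (auto simp: le_fun_def)
      show "V = W \<or> V = vsp M"
      proof (cases "V i \<subseteq> W i")
        case True
        have "V j = W j" for j
          using True WV'[of _ j] submodulesD(2)[OF V, of _ j] by (cases "j = i") (auto simp: W_def)
        then show ?thesis by blast
      next
        case False
        then obtain x where x: "x \<in> V i" "u x \<noteq> 0" using submodulesD(2)[OF V] by (auto simp: W_def)
        have xM: "x \<in> vsp M i" by (rule submodulesD(2)[OF V x(1)])
        have "y \<in> V i" if y: "y \<in> vsp M i" for y
        proof -
          let ?z = "y - scal (u y / u x) x"
          have "?z \<in> vsp M i"
            by (intro amb.subspace_diff[OF module_subspace[OF M]] y amb.subspace_scale[OF module_subspace[OF M]] xM)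
          moreover have "u ?z = 0" using x(2) by (simp add: lf.linear_diff[OF u(1)] lf.linear_scale[OF u(1)])
          ultimately have "?z \<in> V i" using WV'[of ?z i] by (simp add: W_def)
          then have "?z + scal (u y / u x) x \<in> V i"
            by (intro amb.subspace_add[OF submodulesD(1)[OF V]] amb.subspace_scale[OF submodulesD(1)[OF V]] x)
          then show ?thesis by simp
        qed
        then have "V j = vsp M j" for j
          using submodulesD(2)[OF V, of _ j] WV'[of _ j] by (cases "j = i") (auto simp: W_def)
        then show ?thesis by blast
      qed
    qed
    then have "v \<in> W i" using v by (auto simp: radical_def)
    then show False using uv by (simp add: W_def)
  qed
qed

section \<open>Tops and socles of intervals\<close>

lemma simple_at_Ivl: "simple_at a = Ivl a 1"
proof -
  have A: "(\<lambda>j. if j = a then amb.span {unit_vec (0, 0) :: 'a amb} else {0}) = (\<lambda>i. supp (ivs a 1 i))"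
  proof
    fix j
    have "ivs a 1 j = (if j = a then {(0, 0)} else {})" by (auto simp: ivs_def)
    then show "(if j = a then amb.span {unit_vec (0, 0) :: 'a amb} else {0}) = supp (ivs a 1 j)"
      using span_unit_vec[of "{(0, 0)}", where ?'k = 'a] by simp
  qed
  have B: "(\<lambda>j v. 0) = (\<lambda>(i :: nat) (v :: 'a amb) (x, l). if x = 0 \<and> 0 < l \<and> l < 1 then v (0, l - 1) else 0)"
    by (auto simp: fun_eq_iff)
  show ?thesis
    unfolding simple_at_def Ivl_def by (rule arg_cong2[where f = "\<lambda>v a. \<lparr>vsp = v, arr = a\<rparr>", OF A B])
qed

lemma simple_at_nonzero:
  assumes "v \<in> vsp (simple_at b) i" "v \<noteq> 0" shows "i = b"
  using assms by (auto simp: simple_at_def split: if_splits)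

text \<open>The generator of the interval is not in the radical, so a map onto the top does not kill
  it; hence the top lives at the vertex of the generator.\<close>

lemma has_top_unique:
  assumes M: "M \<in> modules \<Lambda>" and a: "a \<in> verts \<Lambda>" "0 < n" "n \<le> plen a"
    and iso: "isomorphic \<Lambda> M (Ivl a n)" and top: "has_top \<Lambda> M (simple_at b)"
  shows "a = b"
proof -
  obtain f g where fg: "iso_pair \<Lambda> M (Ivl a n) f g" using isomorphicE[OF iso M] .
  then have f: "f \<in> homs \<Lambda> M (Ivl a n)" and g: "g \<in> homs \<Lambda> (Ivl a n) M"
    and inv: "\<And>i w. w \<in> vsp (Ivl a n) i \<Longrightarrow> f i (g i w) = w" by (auto simp: iso_pair_def)
  let ?u = "unit_vec (0, 0) :: 'a amb"
  have u: "?u \<in> vsp (Ivl a n) a" using a by (simp add: vsp_Ivl)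
  have gu: "g a ?u \<in> vsp M a" by (rule homs_closed[OF g u])
  have "g a ?u \<notin> Jfam M a"
  proof
    assume "g a ?u \<in> Jfam M a"
    then obtain w where w: "w \<in> vsp M (prv a)" "g a ?u = arr M (prv a) w" using a by (auto simp: Jfam_def)
    have "f (nxt \<Lambda> (prv a)) (arr M (prv a) w) = arr (Ivl a n) (prv a) (f (prv a) w)" by (rule homs_arr[OF f w(1)])
    then have "?u = arr (Ivl a n) (prv a) (f (prv a) w)" using prv(1)[OF a(1)] w(2) inv[OF u] by simp
    then have "?u (0, 0) = arr (Ivl a n) (prv a) (f (prv a) w) (0, 0)" by simp
    then show False by (simp add: arr_Ivl unit_vec_apply)
  qed
  moreover obtain h where h: "h \<in> rep_epis \<Lambda> M (simple_at b)" "kernel_fam M h = radical \<Lambda> M"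
    using top by (auto simp: has_top_def)
  ultimately have "g a ?u \<notin> kernel_fam M h a" by (simp add: radical_Jfam[OF M])
  then have "h a (g a ?u) \<noteq> 0" using gu by (simp add: kernel_fam_def)
  moreover have "h a (g a ?u) \<in> vsp (simple_at b) a" using h(1) gu by (auto simp: rep_epis_def homs_closed)
  ultimately show ?thesis using simple_at_nonzero by blast
qed

lemma has_top_Ivl:
  assumes a: "a \<in> verts \<Lambda>" "0 < n" "n \<le> plen a"
  shows "has_top \<Lambda> (Ivl a n :: 'k::field rep) (simple_at a)"
  unfolding has_top_def simple_at_Ivl
proof (rule bexI[where x = "\<lambda>i. trunc 1"])
  let ?I = "Ivl a n :: 'k rep"
  show "(\<lambda>i. trunc 1) \<in> rep_epis \<Lambda> ?I (Ivl a 1)" using a by (intro trunc_epi) simp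
  note I = Ivl_module[OF a(1,3), where ?'a = 'k]
  show "kernel_fam ?I (\<lambda>i. trunc 1) = radical \<Lambda> ?I"
    unfolding radical_Jfam[OF I]
  proof (rule ext, rule Set.set_eqI)
    fix i and v :: "'k amb"
    have t: "trunc 1 v = 0 \<longleftrightarrow> v (0, 0) = 0" by (auto simp: trunc_def fun_eq_iff)
    show "v \<in> kernel_fam ?I (\<lambda>i. trunc 1) i \<longleftrightarrow> v \<in> Jfam ?I i"
    proof (cases "i \<in> verts \<Lambda>")
      case True
      note p = prv(1)[OF True]
      have "v (0, 0) = 0" if "v \<in> arr ?I (prv i) ` vsp ?I (prv i)" using that by (auto simp: arr_Ivl)
      moreover have "v \<in> vsp ?I i" if "v \<in> arr ?I (prv i) ` vsp ?I (prv i)"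
        using that module_closed[OF I, of _ "prv i"] p by auto
      moreover have "v \<in> arr ?I (prv i) ` vsp ?I (prv i)" if "v \<in> vsp ?I i" "v (0, 0) = 0"
        using Ivl_arr_image[OF a(1) prv(2), of v n i] that p by simp
      ultimately show ?thesis using True by (auto simp: kernel_fam_def Jfam_def t simp del: One_nat_def)
    next
      case False
      then show ?thesis using module_outside[OF I False] by (auto simp: kernel_fam_def Jfam_def t simp del: One_nat_def)
    qed
  qed
qed

text \<open>The last basis vector is killed by the arrow leaving its vertex, so the socle is nonzero
  at that vertex.\<close>

lemma socle_unique:
  assumes M: "M \<in> modules \<Lambda>" and a: "a \<in> verts \<Lambda>" "0 < n" "n \<le> plen a"
    and iso: "isomorphic \<Lambda> M (Ivl a n)" and soc: "isomorphic \<Lambda> (socle \<Lambda> M) (simple_at b)"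
  shows "(nxt \<Lambda> ^^ (n - 1)) a = b"
proof -
  obtain f g where fg: "iso_pair \<Lambda> M (Ivl a n) f g" using isomorphicE[OF iso M] .
  then have g: "g \<in> homs \<Lambda> (Ivl a n) M" and f: "f \<in> homs \<Lambda> M (Ivl a n)"
    and inv: "\<And>i w. w \<in> vsp (Ivl a n) i \<Longrightarrow> f i (g i w) = w" by (auto simp: iso_pair_def)
  let ?u = "unit_vec (0, n - 1) :: 'a amb" and ?t = "(nxt \<Lambda> ^^ (n - 1)) a"
  have u: "?u \<in> vsp (Ivl a n) ?t" using a by (simp add: vsp_Ivl)
  have "g (nxt \<Lambda> ?t) (arr (Ivl a n) ?t ?u) = arr M ?t (g ?t ?u)" by (rule homs_arr[OF g u])
  then have "arr M ?t (g ?t ?u) = 0" using a by (simp add: arr_Ivl_unit lin_0[OF homs_lin[OF g]])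
  then have gs: "g ?t ?u \<in> vsp (socle \<Lambda> M) ?t" using homs_closed[OF g u] by (simp add: vsp_socle[OF M])
  have "g ?t ?u \<noteq> 0" using inv[OF u] lin_0[OF homs_lin[OF f]] unit_vec_nonzero by metis
  obtain h where h: "h \<in> homs \<Lambda> (socle \<Lambda> M) (simple_at b)"
    "bij_betw (h ?t) (vsp (socle \<Lambda> M) ?t) (vsp (simple_at b) ?t)" using soc by (auto simp: isomorphic_def)
  have "0 \<in> vsp (socle \<Lambda> M) ?t" by (simp add: vsp_socle[OF M] module_0[OF M] lin_0[OF module_lin[OF M]])
  then have "h ?t (g ?t ?u) \<noteq> 0"
    using h(2) gs \<open>g ?t ?u \<noteq> 0\<close> lin_0[OF homs_lin[OF h(1)]] unfolding bij_betw_def inj_on_def by metis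
  then show ?thesis using simple_at_nonzero[OF homs_closed[OF h(1) gs]] by blast
qed

lemma socle_Ivl:
  assumes a: "a \<in> verts \<Lambda>" "0 < n" "n \<le> plen a"
  shows "isomorphic \<Lambda> (socle \<Lambda> (Ivl a n :: 'k::field rep)) (simple_at ((nxt \<Lambda> ^^ (n - 1)) a))"
proof (rule isomorphicI)
  let ?I = "Ivl a n :: 'k rep" and ?t = "(nxt \<Lambda> ^^ (n - 1)) a"
  note I = Ivl_module[OF a(1,3), where ?'a = 'k]
  have soc: "v \<in> vsp (socle \<Lambda> ?I) i \<longleftrightarrow> v \<in> vsp ?I i \<and> (\<forall>l<n - 1. v (0, l) = 0)" for v i
  proof -
    have "arr ?I i v = 0 \<longleftrightarrow> (\<forall>l<n - 1. v (0, l) = 0)"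
    proof
      assume z: "arr ?I i v = 0"
      show "\<forall>l<n - 1. v (0, l) = 0"
      proof (intro allI impI)
        fix l assume "l < n - 1"
        then show "v (0, l) = 0" using fun_cong[OF z, of "(0, Suc l)"] by (simp add: arr_Ivl less_diff_conv)
      qed
    next
      assume "\<forall>l<n - 1. v (0, l) = 0"
      then show "arr ?I i v = 0" by (auto simp: fun_eq_iff arr_Ivl)
    qed
    then show ?thesis by (simp add: vsp_socle[OF I])
  qed
  have sa: "arr (socle \<Lambda> ?I) = arr ?I" by (simp add: socle_def)
  have s0: "arr ?I i v = 0" if "v \<in> vsp (socle \<Lambda> ?I) i" for v i using that by (simp add: vsp_socle[OF I])
  have st: "arr (simple_at b) i v = 0" for b i and v :: "'k amb" by (simp add: simple_at_def)
  have sv: "vsp (simple_at b) i = (if i = b then range (\<lambda>k. scal k (unit_vec (0, 0) :: 'k amb)) else {0})" for b i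
    by (simp add: simple_at_def amb.span_singleton)
  define f g :: "'k amb \<Rightarrow> 'k amb" where "f = (\<lambda>v. scal (v (0, n - 1)) (unit_vec (0, 0)))"
    and "g = (\<lambda>v. scal (v (0, 0)) (unit_vec (0, n - 1)))"
  have lin: "lin f" "lin g" unfolding f_def g_def by (rule lin_coord_scal)+
  have zero: "v (0, n - 1) = 0" if "v \<in> vsp ?I i" "i \<noteq> ?t" for v i using Ivl_mem[OF that(1)] that(2) by blast
  show "iso_pair \<Lambda> (socle \<Lambda> ?I) (simple_at ?t) (\<lambda>i. f) (\<lambda>i. g)"
    unfolding iso_pair_def
  proof (intro conjI allI ballI)
    show "(\<lambda>i. f) \<in> homs \<Lambda> (socle \<Lambda> ?I) (simple_at ?t)"
    proof (rule homsI)
      fix i and v :: "'k amb" assume v: "v \<in> vsp (socle \<Lambda> ?I) i"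
      show "f v \<in> vsp (simple_at ?t) i" using v zero soc by (auto simp: sv f_def)
      show "f (arr (socle \<Lambda> ?I) i v) = arr (simple_at ?t) i (f v)"
        using s0[OF v] lin_0[OF lin(1)] by (simp add: sa st)
    qed (rule lin)
    show "(\<lambda>i. g) \<in> homs \<Lambda> (simple_at ?t) (socle \<Lambda> ?I)"
    proof (rule homsI)
      fix i and v :: "'k amb" assume v: "v \<in> vsp (simple_at ?t) i"
      show gv: "g v \<in> vsp (socle \<Lambda> ?I) i"
      proof (cases "i = ?t")
        case True
        have "unit_vec (0, n - 1) \<in> vsp ?I ?t" using a by (simp add: vsp_Ivl)
        then show ?thesis
          using True by (auto simp: soc g_def scal_apply unit_vec_apply intro!: amb.subspace_scale[OF module_subspace[OF I]])
      next
        case False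
        then have "v = 0" using v by (simp add: sv)
        then show ?thesis using lin_0[OF lin(2)] module_0[OF I] by (simp add: soc)
      qed
      show "g (arr (simple_at ?t) i v) = arr (socle \<Lambda> ?I) i (g v)"
        using s0[OF gv] lin_0[OF lin(2)] by (simp add: sa st)
    qed (rule lin)
    fix i
    show "g (f v) = v" if v: "v \<in> vsp (socle \<Lambda> ?I) i" for v
    proof (rule ext)
      fix p :: "nat \<times> nat"
      obtain x l where p: "p = (x, l)" by (cases p)
      have vI: "v \<in> vsp ?I i" "\<And>l. l < n - 1 \<Longrightarrow> v (0, l) = 0" using v soc by auto
      have "v p = 0" if "p \<noteq> (0, n - 1)"
      proof (rule ccontr)
        assume "v p \<noteq> 0"
        then have "x = 0" "l < n" using Ivl_mem[OF vI(1), of x l] by (auto simp: p)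
        then have "l < n - 1" using that p by auto
        then show False using vI(2) \<open>v p \<noteq> 0\<close> \<open>x = 0\<close> p by simp
      qed
      then show "g (f v) p = v p" by (auto simp: g_def f_def scal_apply unit_vec_apply)
    qed
    show "f (g w) = w" if w: "w \<in> vsp (simple_at ?t) i" for w
      using w by (auto simp: sv f_def g_def scal_apply unit_vec_apply split: if_splits)
  qed
qed

section \<open>Composition series and lengths of intervals\<close>

definition Vfam :: "nat \<Rightarrow> nat \<Rightarrow> nat \<Rightarrow> nat \<Rightarrow> 'k::field amb set" where
  "Vfam a n k i = {v \<in> vsp (Ivl a n) i. \<forall>l<k. v (0, l) = 0}"

lemma Vfam_submodule:
  assumes a: "a \<in> verts \<Lambda>" "n \<le> plen a"
  shows "Vfam a n k \<in> submodules \<Lambda> (Ivl a n :: 'k::field rep)"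
proof (rule submodulesI)
  note I = Ivl_module[OF a, where ?'a = 'k]
  fix i
  show "amb.subspace (Vfam a n k i :: 'k amb set)"
    unfolding Vfam_def
    by (rule amb.subspaceI)
      (auto simp: module_0[OF I] scal_apply intro: amb.subspace_add[OF module_subspace[OF I]] amb.subspace_scale[OF module_subspace[OF I]])
  fix v :: "'k amb" assume "v \<in> Vfam a n k i"
  then have v: "v \<in> vsp (Ivl a n) i" "\<And>l. l < k \<Longrightarrow> v (0, l) = 0" by (auto simp: Vfam_def)
  then show "v \<in> vsp (Ivl a n) i" by simp
  show "arr (Ivl a n) i v \<in> Vfam a n k (nxt \<Lambda> i)"
    using module_closed[OF I v(1)] v(2) by (auto simp: Vfam_def arr_Ivl)
qed

lemma Vfam_antimono: "k \<le> k' \<Longrightarrow> Vfam a n k' \<le> Vfam a n k"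
  by (auto simp: Vfam_def le_fun_def)

text \<open>The leading coordinates of the vectors in W decide: k is the smallest one that occurs,
  or n if W is zero.\<close>

lemma submodule_Vfam:
  fixes W :: "nat \<Rightarrow> 'k::field amb set"
  assumes a: "a \<in> verts \<Lambda>" "n \<le> plen a" and W: "W \<in> submodules \<Lambda> (Ivl a n)"
  obtains k where "k \<le> n" "W = Vfam a n k"
proof -
  define k where "k = (LEAST k. Vfam a n k \<le> W)"
  have "Vfam a n n \<le> W"
  proof (clarsimp simp: le_fun_def)
    fix i and v :: "'k amb" assume "v \<in> Vfam a n n i"
    then have v: "v \<in> vsp (Ivl a n) i" "\<And>l. l < n \<Longrightarrow> v (0, l) = 0" by (auto simp: Vfam_def)
    then have "v = 0" using Ivl_least[OF v(1)] by blast
    then show "v \<in> W i" using amb.subspace_0[OF submodulesD(1)[OF W]] by simp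
  qed
  then have k: "k \<le> n" "Vfam a n k \<le> W" unfolding k_def by (auto intro: Least_le LeastI)
  moreover have "W \<le> Vfam a n k"
  proof (clarsimp simp: le_fun_def)
    fix i w assume w: "w \<in> W i"
    have wI: "w \<in> vsp (Ivl a n) i" by (rule submodulesD(2)[OF W w])
    show "w \<in> Vfam a n k i"
    proof (cases "w = 0")
      case True
      then show ?thesis using wI by (simp add: Vfam_def)
    next
      case False
      then obtain m where m: "w (0, m) \<noteq> 0" "\<And>l. l < m \<Longrightarrow> w (0, l) = 0" using Ivl_least[OF wI] by blast
      have "Vfam a n m \<le> W"
        using Ivl_submodule[OF a W w m] by (auto simp: le_fun_def Vfam_def)
      then have "k \<le> m" unfolding k_def by (rule Least_le)
      then show ?thesis using wI m(2) by (auto simp: Vfam_def)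
    qed
  qed
  ultimately show thesis using that by (metis antisym)
qed

lemma uniserial_Ivl:
  assumes a: "a \<in> verts \<Lambda>" "n \<le> plen a"
  shows "uniserial \<Lambda> (Ivl a n :: 'k::field rep)"
  unfolding uniserial_def
proof (intro conjI ballI Ivl_module a)
  fix V W :: "nat \<Rightarrow> 'k amb set"
  assume "V \<in> submodules \<Lambda> (Ivl a n)" "W \<in> submodules \<Lambda> (Ivl a n)"
  then obtain k k' where "V = Vfam a n k" "W = Vfam a n k'" using submodule_Vfam[OF a] by metis
  then show "V \<le> W \<or> W \<le> V" using Vfam_antimono[of k k' a n] Vfam_antimono[of k' k a n] by (meson nle_le)
qed

text \<open>Preimages under an epimorphism turn strict chains of submodules of N into strict chains
  of submodules of M.\<close>

lemma mod_length_epi: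
  assumes M: "M \<in> modules \<Lambda>" and f: "f \<in> rep_epis \<Lambda> M N"
  shows "mod_length \<Lambda> N \<le> mod_length \<Lambda> M"
  unfolding mod_length_def
proof (rule SUP_subset_mono)
  have fh: "f \<in> homs \<Lambda> M N" "\<And>i. f i ` vsp M i = vsp N i" using f by (auto simp: rep_epis_def)
  define pre where "pre = (\<lambda>W i. {v \<in> vsp M i. f i v \<in> W i})"
  have pre: "pre W \<in> submodules \<Lambda> M" if W: "W \<in> submodules \<Lambda> N" for W
  proof (rule submodulesI)
    fix i
    show "amb.subspace (pre W i)"
      using amb.subspace_inter[OF module_subspace[OF M, of i] lp.linear_subspace_linear_preimage[OF homs_lin[OF fh(1), of i] submodulesD(1)[OF W, of i]]]
      by (simp add: pre_def Int_def)
    fix v assume "v \<in> pre W i"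
    then show "v \<in> vsp M i" "arr M i v \<in> pre W (nxt \<Lambda> i)"
      using submodulesD(3)[OF W] homs_arr[OF fh(1)] module_closed[OF M] by (auto simp: pre_def)
  qed
  have less: "pre V < pre W" if V: "V \<in> submodules \<Lambda> N" and W: "W \<in> submodules \<Lambda> N" and VW: "V < W" for V W
  proof -
    have "V \<le> W" "\<not> W \<le> V" using VW by (auto simp: less_le_not_le)
    then obtain i w where w: "w \<in> W i" "w \<notin> V i" by (auto simp: le_fun_def)
    obtain v where v: "v \<in> vsp M i" "f i v = w" using submodulesD(2)[OF W w(1)] fh(2)[of i] by force
    then have "v \<in> pre W i" "v \<notin> pre V i" using w by (auto simp: pre_def)
    then have "\<not> pre W \<le> pre V" by (auto simp: le_fun_def)
    moreover have "pre V \<le> pre W" using \<open>V \<le> W\<close> by (auto simp: pre_def le_fun_def)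
    ultimately show ?thesis by (simp add: less_le_not_le)
  qed
  show "{n. \<exists>c. (\<forall>m\<le>n. c m \<in> submodules \<Lambda> N) \<and> (\<forall>m<n. c m < c (Suc m))}
    \<subseteq> {n. \<exists>c. (\<forall>m\<le>n. c m \<in> submodules \<Lambda> M) \<and> (\<forall>m<n. c m < c (Suc m))}"
  proof
    fix n assume "n \<in> {n. \<exists>c. (\<forall>m\<le>n. c m \<in> submodules \<Lambda> N) \<and> (\<forall>m<n. c m < c (Suc m))}"
    then obtain c where c: "\<And>m. m \<le> n \<Longrightarrow> c m \<in> submodules \<Lambda> N" "\<And>m. m < n \<Longrightarrow> c m < c (Suc m)" by blast
    show "n \<in> {n. \<exists>c. (\<forall>m\<le>n. c m \<in> submodules \<Lambda> M) \<and> (\<forall>m<n. c m < c (Suc m))}"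
      by (intro CollectI exI[of _ "\<lambda>m. pre (c m)"]) (use c pre less in auto)
  qed
qed simp

lemma iso_epi: "isomorphic \<Lambda> M N \<Longrightarrow> \<exists>f. f \<in> rep_epis \<Lambda> M N"
  by (auto simp: isomorphic_def rep_epis_def bij_betw_def)

lemma mod_length_iso: "M \<in> modules \<Lambda> \<Longrightarrow> N \<in> modules \<Lambda> \<Longrightarrow> isomorphic \<Lambda> M N \<Longrightarrow> mod_length \<Lambda> M = mod_length \<Lambda> N"
  using mod_length_epi iso_epi isomorphic_sym by (meson antisym)

lemma mod_length_Ivl:
  assumes a: "a \<in> verts \<Lambda>" "n \<le> plen a"
  shows "mod_length \<Lambda> (Ivl a n :: 'k::field rep) = enat n"
proof (rule antisym)
  let ?I = "Ivl a n :: 'k rep"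
  show "mod_length \<Lambda> ?I \<le> enat n"
    unfolding mod_length_def
  proof (rule SUP_least)
    fix m assume "m \<in> {n. \<exists>c. (\<forall>m\<le>n. c m \<in> submodules \<Lambda> ?I) \<and> (\<forall>m<n. c m < c (Suc m))}"
    then obtain c where c: "\<And>k. k \<le> m \<Longrightarrow> c k \<in> submodules \<Lambda> ?I" "\<And>k. k < m \<Longrightarrow> c k < c (Suc k)" by blast
    have "\<forall>k. \<exists>p. k \<le> m \<longrightarrow> p \<le> n \<and> c k = Vfam a n p" using submodule_Vfam[OF a c(1)] by metis
    then obtain p where p: "\<And>k. k \<le> m \<Longrightarrow> p k \<le> n \<and> c k = Vfam a n (p k)" by metis
    \<comment> \<open>A strict chain of m + 1 submodules uses m + 1 different indices among the n +
      1 available ones.\<close>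
    have "inj_on p {..m}"
    proof (rule linorder_inj_onI)
      fix i j assume "i < j" "i \<in> {..m}" "j \<in> {..m}"
      then have "c i < c j"
      proof (induction j)
        case (Suc j)
        show ?case
        proof (cases "i = j")
          case True
          then show ?thesis using c(2)[of j] Suc.prems by simp
        next
          case False
          then have "c i < c j" using Suc by simp
          also have "c j < c (Suc j)" using c(2)[of j] Suc.prems by simp
          finally show ?thesis .
        qed
      qed simp
      then show "p i \<noteq> p j" using p[of i] p[of j] \<open>i \<in> {..m}\<close> \<open>j \<in> {..m}\<close> by auto
    qed auto
    moreover have "p ` {..m} \<subseteq> {..n}" using p by auto
    ultimately have "card {..m} \<le> card {..n}" by (meson card_inj_on_le finite_atMost)
    then show "enat m \<le> enat n" by simp
  qed
  show "enat n \<le> mod_length \<Lambda> ?I"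
    unfolding mod_length_def
  proof (rule SUP_upper, intro CollectI exI[of _ "\<lambda>m. Vfam a n (n - m)"] conjI allI impI)
    show "Vfam a n (n - m) \<in> submodules \<Lambda> ?I" for m by (rule Vfam_submodule[OF a])
    fix m assume m: "m < n"
    let ?k = "n - Suc m" and ?u = "unit_vec (0, n - Suc m) :: 'k amb"
    have "?u \<in> Vfam a n ?k ((nxt \<Lambda> ^^ ?k) a)" using m by (auto simp: Vfam_def vsp_Ivl unit_vec_apply)
    moreover have "?u \<notin> Vfam a n (n - m) ((nxt \<Lambda> ^^ ?k) a)" using m by (auto simp: Vfam_def unit_vec_apply)
    ultimately have "\<not> (Vfam a n ?k :: nat \<Rightarrow> 'k amb set) \<le> Vfam a n (n - m)" by (auto simp: le_fun_def)
    then show "(Vfam a n (n - m) :: nat \<Rightarrow> 'k amb set) < Vfam a n ?k"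
      using Vfam_antimono[of ?k "n - m" a n, where ?'a = 'k] by (simp add: less_le_not_le)
  qed
qed

section \<open>The modules \<open>\<Delta>\<^sub>j\<close>\<close>

lemma vt_ee:
  assumes j: "j \<in> {1..nrels \<Lambda>}"
  shows "vt (ee (j - 1)) = nxt \<Lambda> (kext \<Lambda> (2 * (j - 1)))"
proof -
  have *: "vt (e (st i)) = nxt \<Lambda> (kidx \<Lambda> (2 * i))" if i: "i \<in> {1..nrels \<Lambda>}" for i
  proof -
    \<comment> \<open>The last arrow of the relation starts at
      \<open>kidx \<Lambda> (2 * i)\<close>, so the relation ends one step after that
      vertex.\<close>
    have "e (st i) = st i + int (rlen \<Lambda> i - 1) + 1" using e_st[OF i] rel_facts(1)[OF i] by simp
    then have "vt (e (st i)) = nxt \<Lambda> ((nxt \<Lambda> ^^ (rlen \<Lambda> i - 1)) (vt (st i)))" by (simp add: nxt_pow_vt nxt_vt)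
    then show ?thesis using rel_facts(3)[OF i] vt_st[OF i] by simp
  qed
  show ?thesis
  proof (cases "j = 1")
    case True
    have "nrels \<Lambda> \<in> {1..nrels \<Lambda>}" using nrels_ge by simp
    from *[OF this] show ?thesis using True vt_shift[of "e (st (nrels \<Lambda>))" "-1"] by (simp add: ee_def kext_def)
  next
    case False
    define i where "i = j - 1"
    have "i \<in> {1..nrels \<Lambda>}" "i \<noteq> 0" using j False by (auto simp: i_def)
    then show ?thesis using *[of i] unfolding i_def[symmetric] by (simp add: ee_def kext_def)
  qed
qed

lemma dcode_facts:
  assumes j: "j \<in> {1..nrels \<Lambda>}"
  shows "fst (dcode j) = nxt \<Lambda> (kext \<Lambda> (2 * (j - 1)))"
    "(nxt \<Lambda> ^^ (snd (dcode j) - 1)) (fst (dcode j)) = kext \<Lambda> (2 * j)" "snd (dcode j) < \<N>"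
proof -
  show "fst (dcode j) = nxt \<Lambda> (kext \<Lambda> (2 * (j - 1)))" by (simp only: dcode_def iv_def fst_conv vt_ee[OF j])
  have c: "ee (j - 1) < ee j" using consec_ee(1)[OF j] by (simp add: consec_def)
  show "snd (dcode j) < \<N>" using consec_ee(2)[OF j] c by (simp add: dcode_def iv_def)
  have "(nxt \<Lambda> ^^ (snd (dcode j) - 1)) (fst (dcode j)) = vt (ee j - 1)"
    using c by (simp add: dcode_def iv_def nxt_pow_vt of_nat_diff)
  also have "ee j - 1 = st j + int (rlen \<Lambda> j - 1)" using e_st[OF j] rel_facts(1)[OF j] j by (simp add: ee_def)
  also have "vt \<dots> = kext \<Lambda> (2 * j)" using rel_facts(3)[OF j] vt_st[OF j] j by (simp add: nxt_pow_vt[symmetric] kext_def)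
  finally show "(nxt \<Lambda> ^^ (snd (dcode j) - 1)) (fst (dcode j)) = kext \<Lambda> (2 * j)" .
qed

text \<open>Two paths with the same start and end differ in length by a multiple of the number of
  vertices, so a path shorter than one turn is the shortest.\<close>

lemma nxt_pow_shortest:
  assumes "a \<in> verts \<Lambda>" "(nxt \<Lambda> ^^ m) a = (nxt \<Lambda> ^^ n) a" "n < \<N>"
  shows "n \<le> m"
proof (rule ccontr)
  assume "\<not> n \<le> m"
  let ?x = "int a - 1"
  have "vt (?x + int m) = vt (?x + int n)"
    using assms(2) vt_surj[OF assms(1)] by (metis nxt_pow_vt)
  then have "(?x + int m) mod int \<N> = (?x + int n) mod int \<N>" by (simp add: vt_eq_iff)
  then have "int \<N> dvd (int n - int m)" by (metis add_diff_cancel_left mod_eq_dvd_iff)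
  then show False using \<open>\<not> n \<le> m\<close> assms(3) zdvd_not_zless[of "int n - int m" "int \<N>"] by simp
qed

lemma Delta_candidate_cases:
  assumes j: "j \<in> {1..nrels \<Lambda>}" and M: "Delta_candidate \<Lambda> j M"
  obtains n where "(fst (dcode j), n) \<in> codes" "snd (dcode j) \<le> n" "isomorphic \<Lambda> M (IC (fst (dcode j), n))"
proof -
  have ind: "indecomposable \<Lambda> M" and soc: "isomorphic \<Lambda> (socle \<Lambda> M) (simple_at (kext \<Lambda> (2 * j)))"
    and top: "has_top \<Lambda> M (simple_at (nxt \<Lambda> (kext \<Lambda> (2 * (j - 1)))))"
    using M by (auto simp: Delta_candidate_def)
  have mM: "M \<in> modules \<Lambda>" using ind by (simp add: indecomposable_def)
  obtain c where c: "c \<in> codes" "0 < snd c" "isomorphic \<Lambda> M (IC c)" using indecomposable_cases[OF ind] .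
  then obtain a n where an: "c = (a, n)" "a \<in> verts \<Lambda>" "0 < n" "n \<le> plen a" by (auto simp: codes_def)
  have iso: "isomorphic \<Lambda> M (Ivl a n)" using c(3) by (simp add: IC_def an)
  have a: "a = fst (dcode j)" using has_top_unique[OF mM an(2-4) iso top] dcode_facts(1)[OF j] by simp
  have "(nxt \<Lambda> ^^ (n - 1)) a = (nxt \<Lambda> ^^ (snd (dcode j) - 1)) a"
    using socle_unique[OF mM an(2-4) iso soc] dcode_facts(2)[OF j] a by simp
  then have "snd (dcode j) - 1 \<le> n - 1"
    using nxt_pow_shortest[OF an(2)] dcode_facts(3)[OF j] by simp
  then have "snd (dcode j) \<le> n" using an(3) by simp
  then show thesis using that[of n] c an a by simp
qed

lemma Delta_candidate_dcode:
  assumes j: "j \<in> {1..nrels \<Lambda>}"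
  shows "Delta_candidate \<Lambda> j (IC (dcode j) :: 'k::field rep)"
proof -
  obtain a n where an: "dcode j = (a, n)" "a \<in> verts \<Lambda>" "0 < n" "n \<le> plen a"
    using dcode_codes[OF j] by (cases "dcode j") (auto simp: codes_def)
  show ?thesis
    unfolding Delta_candidate_def
    using indecomposable_IC[of "dcode j"] dcode_codes[OF j] uniserial_Ivl[OF an(2,4)] socle_Ivl[OF an(2-4)]
      has_top_Ivl[OF an(2-4)] dcode_facts(1,2)[OF j]
    by (simp add: IC_def an)
qed

text \<open>\<open>Delta\<close> is an arbitrary candidate of minimal length. All candidates are
  intervals with the same starting vertex, so the minimal length determines the isomorphism
  class.\<close>

lemma Delta_iso:
  assumes j: "j \<in> {1..nrels \<Lambda>}"
  shows "indecomposable \<Lambda> (Delta \<Lambda> j :: 'k::field rep)"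
    "isomorphic \<Lambda> (Delta \<Lambda> j :: 'k rep) (IC (dcode j))"
proof -
  let ?D = "Delta \<Lambda> j :: 'k rep" and ?C = "IC (dcode j) :: 'k rep"
  have len: "mod_length \<Lambda> M = enat n" if "M \<in> modules \<Lambda>" "(a, n) \<in> codes" "isomorphic \<Lambda> M (IC (a, n))"
    for M :: "'k rep" and a n
    using mod_length_iso[OF that(1) IC_module[OF that(2)] that(3)] mod_length_Ivl[of a n, where ?'k = 'k] that(2)
    by (simp add: IC_def codes_def)
  have candM: "M \<in> modules \<Lambda>" if "Delta_candidate \<Lambda> j M" for M :: "'k rep"
    using that by (simp add: Delta_candidate_def indecomposable_def)
  have lC: "mod_length \<Lambda> ?C = enat (snd (dcode j))"
    using len[of ?C "fst (dcode j)" "snd (dcode j)"] dcode_codes[OF j] by (simp add: IC_module isomorphic_refl)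
  have "is_arg_min (mod_length \<Lambda>) (Delta_candidate \<Lambda> j) ?C"
    unfolding is_arg_min_def
  proof (intro conjI Delta_candidate_dcode[OF j] notI)
    assume "\<exists>y :: 'k rep. Delta_candidate \<Lambda> j y \<and> mod_length \<Lambda> y < mod_length \<Lambda> ?C"
    then obtain M :: "'k rep" where M: "Delta_candidate \<Lambda> j M" "mod_length \<Lambda> M < mod_length \<Lambda> ?C" by blast
    obtain n where n: "(fst (dcode j), n) \<in> codes" "snd (dcode j) \<le> n" "isomorphic \<Lambda> M (IC (fst (dcode j), n))"
      using Delta_candidate_cases[OF j M(1)] .
    show False using M(2) len[OF candM[OF M(1)] n(1,3)] n(2) lC by simp
  qed
  then have "is_arg_min (mod_length \<Lambda>) (Delta_candidate \<Lambda> j) ?D"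
    unfolding Delta_def arg_min_def by (rule someI)
  then have D: "Delta_candidate \<Lambda> j ?D" and min: "\<not> mod_length \<Lambda> ?C < mod_length \<Lambda> ?D"
    using Delta_candidate_dcode[OF j] by (auto simp: is_arg_min_def)
  obtain n where n: "(fst (dcode j), n) \<in> codes" "snd (dcode j) \<le> n" "isomorphic \<Lambda> ?D (IC (fst (dcode j), n))"
    using Delta_candidate_cases[OF j D] .
  have "n = snd (dcode j)" using min len[OF candM[OF D] n(1,3)] n(2) lC by simp
  then show "isomorphic \<Lambda> ?D ?C" using n(3) by simp
  show "indecomposable \<Lambda> ?D" using D by (simp add: Delta_candidate_def)
qed

lemma syz_periodic_iff:
  assumes X: "X \<in> modules \<Lambda>" and c: "c \<in> codes" "0 < snd c" and iso: "isomorphic \<Lambda> X (IC c)"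
  shows "syz_periodic \<Lambda> (X :: 'k::field rep) \<longleftrightarrow> periodic_code c"
proof -
  have "isomorphic \<Lambda> ((Syz \<Lambda> ^^ m) X) X \<longleftrightarrow> (om ^^ m) c = c" for m
  proof -
    note mods = Syz_pow_module[OF X, of m] IC_module[OF c(1), where ?'a = 'k] IC_module[OF om_pow_codes[OF c(1)], of m, where ?'a = 'k]
    have 1: "isomorphic \<Lambda> ((Syz \<Lambda> ^^ m) X) (IC ((om ^^ m) c))"
      by (rule isomorphic_trans[OF Syz_pow_cong[OF X mods(2) iso] Syz_pow_IC[OF c(1)]])
    have "isomorphic \<Lambda> (IC c :: 'k rep) (IC ((om ^^ m) c))" if "isomorphic \<Lambda> ((Syz \<Lambda> ^^ m) X) X"
      by (rule isomorphic_trans[OF isomorphic_sym[OF isomorphic_trans[OF that iso] mods(1)] 1])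
    moreover have "isomorphic \<Lambda> ((Syz \<Lambda> ^^ m) X) X" if "(om ^^ m) c = c"
      using isomorphic_trans[OF 1] isomorphic_sym[OF iso X] that by simp
    ultimately show ?thesis using IC_iso_iff[OF c(1) om_pow_codes[OF c(1)] c(2), of m, where ?'k = 'k] by metis
  qed
  then show ?thesis by (simp add: syz_periodic_def periodic_code_def)
qed

lemma Delta_Omega_per:
  assumes j: "j \<in> {1..nrels \<Lambda>}"
  shows "(Delta \<Lambda> j :: 'k::field rep) \<in> Omega_per \<Lambda> \<longleftrightarrow> periodic_code (dcode j)"
proof -
  note D = Delta_iso[OF j, where ?'k = 'k]
  have "(Delta \<Lambda> j :: 'k rep) \<in> modules \<Lambda>" using D(1) by (simp add: indecomposable_def)
  then show ?thesis using syz_periodic_iff[OF _ _ _ D(2)] dcode_codes[OF j] D(1) by (simp add: Omega_per_def)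
qed

end

section \<open>Self-injectivity\<close>

context nakayama
begin

abbreviation "\<RR> \<equiv> regular_rep \<Lambda>"

definition Rg :: "nat \<Rightarrow> (nat \<times> nat) set" where
  "Rg i = {(s, l). s \<in> verts \<Lambda> \<and> l < plen s \<and> (nxt \<Lambda> ^^ l) s = i}"

lemma finite_Rg: "finite (Rg i)"
proof (rule finite_subset)
  show "Rg i \<subseteq> (SIGMA s:verts \<Lambda>. {..<plen s})" by (auto simp: Rg_def)
qed (auto simp: verts_def)

lemma vsp_regular: "vsp (\<RR> :: 'k::field rep) i = supp (Rg i)"
proof -
  have "{unit_vec (s, l) :: 'k amb |s l. s \<in> verts \<Lambda> \<and> \<not> zero_path \<Lambda> (s, l) \<and> (nxt \<Lambda> ^^ l) s = i} = unit_vec ` Rg i"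
    by (auto simp: Rg_def zero_path_plen not_le) (metis not_le zero_path_plen)
  then show ?thesis by (simp add: regular_rep_def span_unit_vec[OF finite_Rg])
qed

lemma regular_mem: "v \<in> vsp \<RR> i \<Longrightarrow> v (s, l) \<noteq> 0 \<Longrightarrow> s \<in> verts \<Lambda> \<and> l < plen s \<and> (nxt \<Lambda> ^^ l) s = i"
  unfolding vsp_regular using supp_mem[of v "Rg i" "(s, l)"] by (simp add: Rg_def)

lemma regular_memI:
  "(\<And>s l. v (s, l) \<noteq> 0 \<Longrightarrow> s \<in> verts \<Lambda> \<and> l < plen s \<and> (nxt \<Lambda> ^^ l) s = i) \<Longrightarrow> v \<in> vsp \<RR> i"
  unfolding vsp_regular by (rule suppI) (simp add: Rg_def)

lemma arr_regular:
  "arr \<RR> i v (s, l) = (if l > 0 \<and> \<not> zero_path \<Lambda> (s, l) then v (s, l - 1) else 0)"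
  by (simp add: regular_rep_def)

lemma path_regular:
  assumes v: "v \<in> vsp \<RR> i" and s: "s \<in> verts \<Lambda>"
  shows "path_map \<Lambda> \<RR> i k v (s, l) = (if k \<le> l \<and> l < plen s then v (s, l - k) else 0)"
proof (induction k arbitrary: l)
  case 0
  then show ?case using regular_mem[OF v, of s l] by auto
next
  case (Suc k)
  have "path_map \<Lambda> \<RR> i (Suc k) v (s, l) = (if l > 0 \<and> l < plen s then path_map \<Lambda> \<RR> i k v (s, l - 1) else 0)"
    using s by (simp add: arr_regular zero_path_plen not_le)
  also have "\<dots> = (if Suc k \<le> l \<and> l < plen s then v (s, l - Suc k) else 0)"
    by (auto simp: Suc)
  finally show ?case .
qed

lemma regular_module: "(\<RR> :: 'k::field rep) \<in> modules \<Lambda>"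
proof (rule moduleI)
  fix i
  show "amb.subspace (vsp (\<RR> :: 'k rep) i)" by (simp add: vsp_regular subspace_supp)
  show "\<exists>B. finite B \<and> vsp (\<RR> :: 'k rep) i \<subseteq> amb.span B"
    unfolding vsp_regular by (intro exI[of _ "unit_vec ` Rg i"]) (simp add: span_unit_vec finite_Rg)
  show "vsp (\<RR> :: 'k rep) i = {0}" if "i \<notin> verts \<Lambda>"
  proof -
    have "Rg i = {}" using that by (auto simp: Rg_def)
    then show ?thesis by (simp add: vsp_regular)
  qed
  show "lin (arr (\<RR> :: 'k rep) i)"
    by (rule linI) (auto simp: fun_eq_iff arr_regular scal_apply)
  fix v :: "'k amb" assume v: "v \<in> vsp \<RR> i"
  show "arr \<RR> i v \<in> vsp \<RR> (nxt \<Lambda> i)"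
  proof (rule regular_memI)
    fix s l assume "arr \<RR> i v (s, l) \<noteq> 0"
    then have *: "l > 0" "\<not> zero_path \<Lambda> (s, l)" "v (s, l - 1) \<noteq> 0" by (auto simp: arr_regular split: if_splits)
    have r: "s \<in> verts \<Lambda>" "(nxt \<Lambda> ^^ (l - 1)) s = i" using regular_mem[OF v *(3)] by auto
    have "(nxt \<Lambda> ^^ Suc (l - 1)) s = nxt \<Lambda> i" using r by simp
    then show "s \<in> verts \<Lambda> \<and> l < plen s \<and> (nxt \<Lambda> ^^ l) s = nxt \<Lambda> i"
      using * r zero_path_plen[OF r(1)] by (simp add: not_le)
  qed
next
  fix j and v :: "'k amb"
  assume j: "j \<in> {1..nrels \<Lambda>}" and v: "v \<in> vsp \<RR> (kidx \<Lambda> (2 * j - 1))"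
  let ?i = "kidx \<Lambda> (2 * j - 1)"
  \<comment> \<open>Coordinates (s, l) with s outside the vertices have to be excluded first, since
    \<open>plen\<close> describes zero paths from vertices only.\<close>
  have closed: "arr \<RR> i w (s, l) \<noteq> 0 \<Longrightarrow> s \<in> verts \<Lambda>" if "\<And>l. w (s, l) \<noteq> 0 \<Longrightarrow> s \<in> verts \<Lambda>" for w :: "'k amb" and i s l
    using that by (auto simp: arr_regular split: if_splits)
  have pv: "path_map \<Lambda> \<RR> ?i k v (s, l) \<noteq> 0 \<Longrightarrow> s \<in> verts \<Lambda>" for k s l
  proof (induction k arbitrary: l)
    case 0
    then show ?case using regular_mem[OF v] by simp
  next
    case (Suc k)
    then show ?case using closed[of "path_map \<Lambda> \<RR> ?i k v" s] by simp
  qed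
  show "path_map \<Lambda> \<RR> ?i (rlen \<Lambda> j) v = 0"
  proof (rule ext, rule ccontr)
    fix p :: "nat \<times> nat"
    obtain s l where p: "p = (s, l)" by (cases p)
    assume nz: "path_map \<Lambda> \<RR> ?i (rlen \<Lambda> j) v p \<noteq> 0 p"
    then have s: "s \<in> verts \<Lambda>" using pv p by simp
    have *: "rlen \<Lambda> j \<le> l" "l < plen s" "v (s, l - rlen \<Lambda> j) \<noteq> 0"
      using nz unfolding p path_regular[OF v s] by (auto split: if_splits)
    have "(nxt \<Lambda> ^^ (l - rlen \<Lambda> j)) s = ?i" using regular_mem[OF v *(3)] by simp
    then have "zero_path \<Lambda> (s, l)"
      unfolding zero_path_iff using j *(1) by (intro bexI[of _ j] exI[of _ "l - rlen \<Lambda> j"]) auto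
    then show False using zero_path_plen[OF s] *(2) by simp
  qed
qed

text \<open>If \<open>e x = e (x + 1)\<close>, the inclusion of the projective interval from \<open>x + 1\<close> into the one
  from \<open>x\<close> does not split, as its top lies in the radical.\<close>

lemma self_injective_strict:
  assumes inj: "self_injective TYPE('k::field) \<Lambda>"
  shows strict
proof (rule ccontr)
  assume "\<not> strict"
  then obtain x where "\<not> e x < e (x + 1)" by (auto simp: strict_def)
  then have x: "e (x + 1) = e x" using e_step[of x] by simp
  define a n where "a = nxt \<Lambda> (vt x)" and "n = plen (vt x)"
  let ?b = "vt x"
  have n: "n \<ge> 2" using plen_ge[OF vt_verts] by (simp add: n_def)
  have pa: "plen a = n - 1" using x plen_ge[OF vt_verts, of x] by (simp add: a_def n_def nxt_vt e_def)
  have av: "a \<in> verts \<Lambda>" by (simp add: a_def)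
  let ?M = "Ivl a (n - 1) :: 'k rep" and ?N = "Ivl ?b n :: 'k rep"
  have M: "?M \<in> modules \<Lambda>" by (rule Ivl_module[OF av]) (simp add: pa)
  have N: "?N \<in> modules \<Lambda>" by (rule Ivl_module) (simp_all add: n_def)
  have pow: "(nxt \<Lambda> ^^ l) a = (nxt \<Lambda> ^^ Suc l) ?b" for l by (simp add: a_def funpow_swap1)
  \<comment> \<open>g includes M as the radical of N, and f embeds M as the summand of the regular
    module formed by the paths from a.\<close>
  define g f :: "'k amb \<Rightarrow> 'k amb" where "g = (\<lambda>w (y, l). if 0 < l then w (y, l - 1) else 0)" and
    "f = (\<lambda>w (s, l). if s = a then w (0, l) else 0)"
  have g: "(\<lambda>i. g) \<in> homs \<Lambda> ?M ?N"
  proof (rule homsI)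
    show "lin g" by (rule linI) (auto simp: g_def fun_eq_iff scal_apply)
    fix i and w :: "'k amb" assume w: "w \<in> vsp ?M i"
    show "g w \<in> vsp ?N i"
      unfolding vsp_Ivl
    proof (rule suppI)
      fix y l assume "g w (y, l) \<noteq> 0"
      then have l: "0 < l" "w (y, l - 1) \<noteq> 0" by (auto simp: g_def split: if_splits)
      with Ivl_mem[OF w l(2)] show "(y, l) \<in> ivs ?b n i" unfolding pow by auto
    qed
    show "g (arr ?M i w) = arr ?N i (g w)"
      by (auto simp: fun_eq_iff g_def arr_Ivl)
  qed
  have "inj g"
  proof (rule injI)
    fix v w assume e: "g v = g w"
    show "v = w"
    proof (rule ext)
      fix p :: "nat \<times> nat"
      obtain y l where "p = (y, l)" by (cases p)
      then show "v p = w p" using fun_cong[OF e, of "(y, Suc l)"] by (simp add: g_def)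
    qed
  qed
  then have gm: "(\<lambda>i. g) \<in> rep_monos \<Lambda> ?M ?N" using g by (auto simp: rep_monos_def intro: inj_on_subset)
  have f: "(\<lambda>i. f) \<in> homs \<Lambda> ?M \<RR>"
  proof (rule homsI)
    show "lin f" by (rule linI) (auto simp: f_def fun_eq_iff scal_apply)
    fix i and w :: "'k amb" assume w: "w \<in> vsp ?M i"
    show "f w \<in> vsp \<RR> i"
    proof (rule regular_memI)
      fix s l assume "f w (s, l) \<noteq> 0"
      then have "s = a" "w (0, l) \<noteq> 0" by (auto simp: f_def split: if_splits)
      with Ivl_mem[OF w this(2)] show "s \<in> verts \<Lambda> \<and> l < plen s \<and> (nxt \<Lambda> ^^ l) s = i" using av pa by simp
    qed
    show "f (arr ?M i w) = arr \<RR> i (f w)"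
      using zero_path_plen[OF av] by (auto simp: fun_eq_iff f_def arr_Ivl arr_regular pa)
  qed
  have "injective \<Lambda> (\<RR> :: 'k rep)" using inj by (simp add: self_injective_def)
  note this[unfolded injective_def, THEN conjunct2]
  from bspec[OF bspec[OF bspec[OF bspec[OF this M] N] gm] f] obtain h where h: "h \<in> homs \<Lambda> ?N \<RR>" "\<And>i v. v \<in> vsp ?M i \<Longrightarrow> h i (g v) = f v"
    by blast
  let ?u = "unit_vec (0, 0) :: 'k amb"
  have uM: "?u \<in> vsp ?M a" using n by (simp add: vsp_Ivl)
  have uN: "?u \<in> vsp ?N ?b" using n by (simp add: vsp_Ivl)
  have "g ?u = arr ?N ?b ?u"
    using n by (subst arr_Ivl_unit) (auto simp: g_def fun_eq_iff unit_vec_apply)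
  then have "f ?u = arr \<RR> ?b (h ?b ?u)"
    using h(2)[OF uM] homs_arr[OF h(1) uN] by (simp add: a_def)
  \<comment> \<open>The trivial path at a does not occur in the image of an arrow.\<close>
  then have "f ?u (a, 0) = arr \<RR> ?b (h ?b ?u) (a, 0)" by simp
  then show False by (simp add: f_def arr_regular unit_vec_apply)
qed

text \<open>If all paths of length \<open>c\<close> vanish and no shorter ones do, a homomorphism into the regular
  module amounts to a family of linear functionals reading off the socle coordinates, and linear
  functionals extend along monomorphisms.\<close>

lemma strict_self_injective:
  assumes strict
  shows "self_injective TYPE('k::field) \<Lambda>"
  unfolding self_injective_def injective_def
proof (intro conjI regular_module ballI)
  obtain c where c: "\<And>a. a \<in> verts \<Lambda> \<Longrightarrow> plen a = c" using strict_plen[OF assms] by blast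
  have c0: "c > 0" using plen_ge[OF one_verts] c[OF one_verts] by simp
  fix M N :: "'k rep" and g f
  assume M: "M \<in> modules \<Lambda>" and N: "N \<in> modules \<Lambda>" and gm: "g \<in> rep_monos \<Lambda> M N" and f: "f \<in> homs \<Lambda> M \<RR>"
  have g: "g \<in> homs \<Lambda> M N" "\<And>i. inj_on (g i) (vsp M i)" using gm by (auto simp: rep_monos_def)
  have "\<exists>q. range q \<subseteq> vsp M i \<and> lin q \<and> (\<forall>v\<in>vsp M i. q (g i v) = v)" for i
    using lp.linear_exists_left_inverse_on[OF homs_lin[OF g(1)] module_subspace[OF M] g(2)] by blast
  then obtain q where q: "\<And>i. lin (q i)" "\<And>i v. v \<in> vsp M i \<Longrightarrow> q i (g i v) = v" by metis
  define t where "t = (\<lambda>s. (nxt \<Lambda> ^^ (c - 1)) s)"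
  \<comment> \<open>The socle coordinate of f along the paths from s, transported to N by a left
    inverse of g.\<close>
  define u where "u = (\<lambda>s w. f (t s) (q (t s) w) (s, c - 1))"
  have u0: "u s 0 = 0" for s by (simp add: u_def lin_0[OF q(1)] lin_0[OF homs_lin[OF f]])
  have u_add: "u s (x + y) = u s x + u s y" and u_scal: "u s (scal k x) = k * u s x" for s x y k
    by (simp_all only: u_def lin_add[OF q(1)] lin_add[OF homs_lin[OF f]] lin_scal[OF q(1)] lin_scal[OF homs_lin[OF f]]
        plus_fun_apply scal_apply)
  \<comment> \<open>In the regular module, coordinate (s, l) moves to the socle coordinate (s, c -
    1) along c - 1 - l arrows. Compatibility with these arrows forces this value.\<close>
  define h where "h = (\<lambda>i w (s, l). if s \<in> verts \<Lambda> \<and> l < c \<and> (nxt \<Lambda> ^^ l) s = i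
    then u s (path_map \<Lambda> N i (c - 1 - l) w) else 0)"
  have pl: "lin (path_map \<Lambda> N i l)" for i l by (rule module_path_lin[OF N])
  have h_lin: "lin (h i)" for i
  proof (rule linI; rule ext)
    fix x y k and p :: "nat \<times> nat"
    show "h i (x + y) p = (h i x + h i y) p"
      unfolding h_def plus_fun_apply lin_add[OF pl] u_add by (cases p) simp
    show "h i (scal k x) p = (scal k (h i x)) p"
      unfolding h_def scal_apply lin_scal[OF pl] u_scal by (cases p) simp
  qed
  have h: "h \<in> homs \<Lambda> N \<RR>"
  proof (rule homsI)
    fix i and w :: "'k amb" assume w: "w \<in> vsp N i"
    show "h i w \<in> vsp \<RR> i" by (rule regular_memI) (auto simp: h_def c split: if_splits)
    show "h (nxt \<Lambda> i) (arr N i w) = arr \<RR> i (h i w)"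
    proof (cases "i \<in> verts \<Lambda>")
      case False
      then have "w = 0" using w module_outside[OF N] by auto
      then show ?thesis
        using lin_0[OF module_lin[OF N]] lin_0[OF h_lin] lin_0[OF module_lin[OF regular_module[where ?'k = 'k]]] by simp
    next
      case i: True
      show ?thesis
      proof (rule ext)
        fix p :: "nat \<times> nat"
        obtain s l where p: "p = (s, l)" by (cases p)
        show "h (nxt \<Lambda> i) (arr N i w) p = arr \<RR> i (h i w) p"
        proof (cases "s \<in> verts \<Lambda>")
          case False
          then show ?thesis by (simp add: p h_def arr_regular)
        next
          case s: True
          show ?thesis
          proof (cases l)
            case 0
            have "path_map \<Lambda> N (nxt \<Lambda> i) (c - 1) (arr N i w) = path_map \<Lambda> N i c w"
              using path_map_Suc_left[of \<Lambda> N i "c - 1" w] c0 by simp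
            also have "\<dots> = 0" by (rule path_map_zero_path[OF N _ w]) (simp add: zero_path_plen[OF i] c[OF i])
            finally show ?thesis using 0 u0 by (simp add: p h_def arr_regular)
          next
            case (Suc m)
            have "path_map \<Lambda> N (nxt \<Lambda> i) (c - 1 - l) (arr N i w) = path_map \<Lambda> N i (c - 1 - m) w" if "l < c"
              using path_map_Suc_left[of \<Lambda> N i "c - 1 - l" w] Suc that by (simp add: Suc_diff_Suc)
            moreover have "(nxt \<Lambda> ^^ l) s = nxt \<Lambda> i \<longleftrightarrow> (nxt \<Lambda> ^^ m) s = i"
              using Suc nxt_inj[OF nxt_pow_verts[OF s] i] by simp
            ultimately show ?thesis
              using Suc s by (auto simp: p h_def arr_regular zero_path_plen c)
          qed
        qed
      qed
    qed
  qed (rule h_lin)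
  have "h i (g i v) = f i v" if v: "v \<in> vsp M i" for i v
  proof (rule ext)
    fix p :: "nat \<times> nat"
    obtain s l where p: "p = (s, l)" by (cases p)
    have fv: "f i v \<in> vsp \<RR> i" by (rule homs_closed[OF f v])
    show "h i (g i v) p = f i v p"
    proof (cases "s \<in> verts \<Lambda> \<and> l < c \<and> (nxt \<Lambda> ^^ l) s = i")
      case False
      then have "f i v (s, l) = 0" using regular_mem[OF fv, of s l] c by auto
      then show ?thesis using False unfolding p h_def by auto
    next
      case True
      have "c - 1 = (c - 1 - l) + l" using True by simp
      then have ts: "(nxt \<Lambda> ^^ (c - 1 - l)) i = t s" using True unfolding t_def by (metis funpow_funpow)
      let ?w = "path_map \<Lambda> M i (c - 1 - l) v"
      have wM: "?w \<in> vsp M (t s)" using path_map_closed[OF M v, of "c - 1 - l"] ts by simp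
      have "path_map \<Lambda> N i (c - 1 - l) (g i v) = g (t s) ?w" using homs_path[OF M g(1) v, of "c - 1 - l"] ts by simp
      then have "h i (g i v) p = f (t s) ?w (s, c - 1)" using True q(2)[OF wM] by (simp add: p h_def u_def)
      also have "f (t s) ?w = path_map \<Lambda> \<RR> i (c - 1 - l) (f i v)" using homs_path[OF M f v, of "c - 1 - l"] ts by simp
      also have "\<dots> (s, c - 1) = f i v (s, l)" using True c0 by (subst path_regular[OF fv]) (auto simp: c)
      finally show ?thesis by (simp add: p)
    qed
  qed
  then show "\<exists>h\<in>homs \<Lambda> N \<RR>. \<forall>i. \<forall>v\<in>vsp M i. h i (g i v) = f i v" using h by blast
qed

lemma self_injective_iff: "self_injective TYPE('k::field) \<Lambda> \<longleftrightarrow> strict"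
  using self_injective_strict strict_self_injective by blast

end

text \<open>The last equivalence is stated away from the self-injective case, in which it fails:
  there \<open>e\<close> is a translation, so the \<Delta>_j are the simple modules given by
  intervals [x, x + 1), and these are periodic although the \<phi>-dimension is 0.\<close>

theorem theorem3p5p1:
  fixes \<Lambda> :: cyclic_quiver_rels
  assumes "cyclic_nakayama \<Lambda>"
    and "gl_dim TYPE('k::field) \<Lambda> = \<infinity>"
  shows "(phi_dim TYPE('k) \<Lambda> = 0 \<longleftrightarrow> self_injective TYPE('k) \<Lambda>) \<and>
    phi_dim TYPE('k) \<Lambda> \<noteq> 1 \<and>
    (\<not> self_injective TYPE('k) \<Lambda> \<longrightarrow>
      (phi_dim TYPE('k) \<Lambda> = 2 \<longleftrightarrow>
        Delta \<Lambda> ` {1..nrels \<Lambda>} \<subseteq> (Omega_per \<Lambda> :: 'k rep set)))"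
proof -
  interpret nakayama \<Lambda> by (rule nakayama.intro[OF assms(1)])
  let ?\<phi> = "phi_dim TYPE('k) \<Lambda>"
  have le: "?\<phi> \<le> enat t \<longleftrightarrow> periodic_from t" for t by (rule phi_dim_le_iff)
  have le01: "?\<phi> \<le> enat 1 \<longleftrightarrow> strict" "?\<phi> \<le> enat 0 \<longleftrightarrow> strict"
  proof -
    have "?\<phi> \<le> enat 0 \<Longrightarrow> ?\<phi> \<le> enat 1" by (erule order_trans) simp
    then show "?\<phi> \<le> enat 1 \<longleftrightarrow> strict" "?\<phi> \<le> enat 0 \<longleftrightarrow> strict"
      using le strict_periodic not_strict_not_periodic by blast+
  qed
  have "?\<phi> = 0 \<longleftrightarrow> strict"
    using le01(2) by (simp add: zero_enat_def[symmetric])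
  moreover have "?\<phi> \<noteq> 1"
  proof
    assume "?\<phi> = 1"
    then have "strict" using le01(1) by (simp add: one_enat_def)
    then show False using \<open>?\<phi> = 0 \<longleftrightarrow> strict\<close> \<open>?\<phi> = 1\<close> by simp
  qed
  moreover have "?\<phi> = 2 \<longleftrightarrow> Delta \<Lambda> ` {1..nrels \<Lambda>} \<subseteq> (Omega_per \<Lambda> :: 'k rep set)" if "\<not> strict"
  proof -
    have "\<not> ?\<phi> \<le> enat 1" using that le01(1) by simp
    then have "?\<phi> = 2 \<longleftrightarrow> ?\<phi> \<le> enat 2"
      by (cases ?\<phi>) (auto simp: numeral_eq_enat)
    also have "\<dots> \<longleftrightarrow> (\<forall>j\<in>{1..nrels \<Lambda>}. periodic_code (dcode j))"
      unfolding le by (rule periodic_from_2_dcode[OF assms(2)])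
    also have "\<dots> \<longleftrightarrow> Delta \<Lambda> ` {1..nrels \<Lambda>} \<subseteq> (Omega_per \<Lambda> :: 'k rep set)"
      using Delta_Omega_per[where ?'k = 'k] by (auto simp: image_subset_iff)
    finally show ?thesis .
  qed
  ultimately show ?thesis
    using self_injective_iff[where ?'k = 'k] by blast
qed

end
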